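(* Let $q\in(0,1)$ and let $n\ge 1$, $m\ge 2$ be integers, $N=n+m$. The $*$-representation $T_0$ of $\mathrm{Pol}(\widetilde{\Xi}_{n,m})_q$ in $\mathscr{H}_0$ can be extended to a faithful $*$-representation of the $*$-algebra $\mathscr{D}(\Xi_{n,m})_q$ of finite functions on the quantum cone (with a function $g(\xi_{n+1})$ acting by $g(\xi_{n+1})e(i_1,\dots,i_{N-1})=g(q^{2(i_1+\dots+i_n)})e(i_1,\dots,i_{N-1})$).
   Context: Notation: $\mathbb{Z}_+=\{0,1,2,\dots\}$, $\mathbb{N}=\{1,2,\dots\}$; algebras are over $\mathbb{C}$. $\mathrm{Pol}(\widetilde{\Xi}_{n,m})_q$ is the unital $*$-algebra with generators $t_1,\dots,t_N$ and relations $t_it_j=qt_jt_i$ for $i<j$; $t_it_j^*=qt_j^*t_i$ for $i\ne j$; $t_it_i^*=t_i^*t_i+(q^{-2}-1)\sum_{k=i+1}^N t_kt_k^*$ for $i>n$; $t_it_i^*=t_i^*t_i+(q^{-2}-1)\sum_{k=i+1}^n t_kt_k^*-(q^{-2}-1)\sum_{k=n+1}^N t_kt_k^*$ for $i\le n$; and $-\sum_{j=1}^n t_jt_j^*+\sum_{j=n+1}^N t_jt_j^*=0$. Put $\xi_j=\sum_{k=j}^N t_kt_k^*$ for $j>n$ and $\xi_j=-\sum_{k=j}^n t_kt_k^*+\sum_{k=n+1}^N t_kt_k^*$ for $j\le n$. Then $\xi_1=0$, the $\xi_k$ commute pairwise, $t_j\xi_k=q^2\xi_kt_j$, $t_j^*\xi_k=q^{-2}\xi_kt_j^*$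 for $j<k$, and $t_j,t_j^*$ commute with $\xi_k$ for $j\ge k$. $\mathscr{D}(\Xi_{n,m})_q$ is the $*$-algebra of finite sums $$f=\sum_{I,J} t_1^{i_1}\cdots t_n^{i_n}t_{n+1}^{*i_{n+1}}\cdots t_N^{*i_N}\,f_{IJ}(\xi_2,\dots,\xi_N)\,t_N^{j_N}\cdots t_{n+1}^{j_{n+1}}t_n^{*j_n}\cdots t_1^{*j_1}$$ over $I,J\in\mathbb{Z}_+^N$ with $i_kj_k=0$ for all $k$ and $i_1+\dots+i_n+j_{n+1}+\dots+j_N=j_1+\dots+j_n+i_{n+1}+\dots+i_N$, where each $f_{IJ}$ is a finite linear combination of terms $\xi_2^{k_2}\cdots\xi_n^{k_n}\,g(\xi_{n+1})\,\xi_{n+2}^{k_{n+2}}\cdots\xi_N^{k_N}$ with $k_i\in\mathbb{Z}_+$ and $g:q^{2\mathbb{Z}}\to\mathbb{C}$ finitely supported; the decomposition is unique. Multiplication and involution are determined by those of $\mathrm{Pol}(\widetilde{\Xi}_{n,m})_q$, by pointwise multiplication and complex conjugation of functions of $\xi_{n+1}$ on $q^{2\mathbb{Z}}$ ($\xi_{n+1}$ itself being the coordinate function), and by $t_jg(\xi_{n+1})=g(q^2\xi_{n+1})t_j$, $t_j^*g(\xi_{n+1})=g(q^{-2}\xi_{n+1})t_j^*$ for $j\le n$, while $g(\xi_{n+1})$ commutes with $t_j,t_j^*$ for $j>n$ and with all $\xi_k$. $\mathscr{H}_0$ is the pre-Hilbert space that is the linear span of an orthonormal basis $\{e(i_1,\dots,i_{N-1}):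 i_1\in\mathbb{Z};\ i_2,\dots,i_n\in-\mathbb{Z}_+;\ i_{n+1},\dots,i_{N-1}\in\mathbb{N}\}$. With $e=e(i_1,\dots,i_{N-1})$ and $S_j=\sum_{k=1}^{j-1}i_k$, $T_0$ is given by $T_0(t_1)e=q^{i_1-1}e(i_1-1,i_2,\dots)$, $T_0(t_1^* )e=q^{i_1}e(i_1+1,i_2,\dots)$; for $1<j\le n$: $T_0(t_j)e=q^{S_j}(q^{2(i_j-1)}-1)^{1/2}e(\dots,i_j-1,\dots)$, $T_0(t_j^* )e=q^{S_j}(q^{2i_j}-1)^{1/2}e(\dots,i_j+1,\dots)$; for $n<j<N$: $T_0(t_j)e=q^{S_j}(1-q^{2(i_j-1)})^{1/2}e(\dots,i_j-1,\dots)$, $T_0(t_j^* )e=q^{S_j}(1-q^{2i_j})^{1/2}e(\dots,i_j+1,\dots)$; $T_0(t_N)e=T_0(t_N^* )e=q^{S_N}e$. (A term with zero coefficient is $0$.) In particular $T_0(\xi_j)e=q^{2S_j}e$ for $j\ge2$. *)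

theory Defs
  imports Complex_Main "HOL-Library.Poly_Mapping" "HOL-Algebra.Module" "HOL-Algebra.QuotRing"
begin

section \<open>Complex *-algebras and their *-representations\<close>

definition complex_ring :: "complex ring" where
  "complex_ring = \<lparr>carrier = UNIV, mult = (*), one = 1, zero = 0, add = (+)\<rparr>"

record 'a star_alg = "(complex, 'a) module" +
  star :: "'a \<Rightarrow> 'a"

text \<open>Not necessarily unital: no law mentions the \<open>one\<close> field of the record.\<close>

locale star_algebra = Module.module complex_ring A for A (structure) +
  assumes mult_closed: "\<lbrakk>x \<in> carrier A; y \<in> carrier A\<rbrakk> \<Longrightarrow> x \<otimes> y \<in> carrier A"
    and mult_assoc: "\<lbrakk>x \<in> carrier A; y \<in> carrier A; z \<in> carrier A\<rbrakk> \<Longrightarrow> (x \<otimes> y) \<otimes> z = x \<otimes> (y \<otimes> z)"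
    and distr_left: "\<lbrakk>x \<in> carrier A; y \<in> carrier A; z \<in> carrier A\<rbrakk> \<Longrightarrow> (x \<oplus> y) \<otimes> z = x \<otimes> z \<oplus> y \<otimes> z"
    and distr_right: "\<lbrakk>x \<in> carrier A; y \<in> carrier A; z \<in> carrier A\<rbrakk> \<Longrightarrow> z \<otimes> (x \<oplus> y) = z \<otimes> x \<oplus> z \<otimes> y"
    and smult_mult_left: "\<lbrakk>x \<in> carrier A; y \<in> carrier A\<rbrakk> \<Longrightarrow> (c \<odot> x) \<otimes> y = c \<odot> (x \<otimes> y)"
    and smult_mult_right: "\<lbrakk>x \<in> carrier A; y \<in> carrier A\<rbrakk> \<Longrightarrow> x \<otimes> (c \<odot> y) = c \<odot> (x \<otimes> y)"
    and star_closed: "x \<in> carrier A \<Longrightarrow> star A x \<in> carrier A"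
    and star_star: "x \<in> carrier A \<Longrightarrow> star A (star A x) = x"
    and star_add: "\<lbrakk>x \<in> carrier A; y \<in> carrier A\<rbrakk> \<Longrightarrow> star A (x \<oplus> y) = star A x \<oplus> star A y"
    and star_smult: "x \<in> carrier A \<Longrightarrow> star A (c \<odot> x) = cnj c \<odot> star A x"
    and star_mult: "\<lbrakk>x \<in> carrier A; y \<in> carrier A\<rbrakk> \<Longrightarrow> star A (x \<otimes> y) = star A y \<otimes> star A x"

text \<open>
  The pre-Hilbert space with orthonormal basis \<open>'i\<close> is \<open>'i \<Rightarrow>\<^sub>0 complex\<close>; the basis vector with
  label \<open>i\<close> is \<open>Poly_Mapping.single i 1\<close>.
\<close>

definition scale :: "complex \<Rightarrow> ('i \<Rightarrow>\<^sub>0 complex) \<Rightarrow> ('i \<Rightarrow>\<^sub>0 complex)" where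
  "scale c v = Poly_Mapping.map ((*) c) v"

definition ip :: "('i \<Rightarrow>\<^sub>0 complex) \<Rightarrow> ('i \<Rightarrow>\<^sub>0 complex) \<Rightarrow> complex" where
  "ip u v = (\<Sum>i\<in>Poly_Mapping.keys u. Poly_Mapping.lookup u i * cnj (Poly_Mapping.lookup v i))"

definition lin_ext :: "('i \<Rightarrow> ('j \<Rightarrow>\<^sub>0 complex)) \<Rightarrow> ('i \<Rightarrow>\<^sub>0 complex) \<Rightarrow> ('j \<Rightarrow>\<^sub>0 complex)" where
  "lin_ext \<phi> v = (\<Sum>i\<in>Poly_Mapping.keys v. scale (Poly_Mapping.lookup v i) (\<phi> i))"

text \<open>
  A *-representation of \<open>A\<close> by (possibly unbounded) linear operators on the subspace \<open>V\<close>. The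
  values of \<open>T a\<close> outside \<open>V\<close> are irrelevant; two operators are equal if they agree on \<open>V\<close>.
\<close>

locale star_representation = star_algebra A for A (structure) +
  fixes V :: "('i \<Rightarrow>\<^sub>0 complex) set"
    and T :: "'a \<Rightarrow> ('i \<Rightarrow>\<^sub>0 complex) \<Rightarrow> ('i \<Rightarrow>\<^sub>0 complex)"
  assumes op_closed: "\<lbrakk>a \<in> carrier A; u \<in> V\<rbrakk> \<Longrightarrow> T a u \<in> V"
    and op_add: "\<lbrakk>a \<in> carrier A; u \<in> V; v \<in> V\<rbrakk> \<Longrightarrow> T a (u + v) = T a u + T a v"
    and op_scale: "\<lbrakk>a \<in> carrier A; u \<in> V\<rbrakk> \<Longrightarrow> T a (scale c u) = scale c (T a u)"
    and rep_add: "\<lbrakk>a \<in> carrier A; b \<in> carrier A; u \<in> V\<rbrakk> \<Longrightarrow> T (a \<oplus> b) u = T a u + T b u"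
    and rep_smult: "\<lbrakk>a \<in> carrier A; u \<in> V\<rbrakk> \<Longrightarrow> T (c \<odot> a) u = scale c (T a u)"
    and rep_mult: "\<lbrakk>a \<in> carrier A; b \<in> carrier A; u \<in> V\<rbrakk> \<Longrightarrow> T (a \<otimes> b) u = T a (T b u)"
    and rep_star: "\<lbrakk>a \<in> carrier A; u \<in> V; v \<in> V\<rbrakk> \<Longrightarrow> ip (T a u) v = ip u (T (star A a) v)"

locale faithful_star_representation = star_representation +
  assumes faithful: "inj_on (\<lambda>a. restrict (T a) V) (carrier A)"


section \<open>Free *-algebras and *-algebras given by generators and relations\<close>

datatype 'x word = Word (letters: "'x list")

instantiation word :: (type) monoid_add
begin

definition zero_word :: "'a word" where "zero_word = Word []"

definition plus_word :: "'a word \<Rightarrow> 'a word \<Rightarrow> 'a word" where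
  "plus_word v w = Word (letters v @ letters w)"

instance
  by standard (simp_all add: zero_word_def plus_word_def)

end

text \<open>
  Words form the free monoid, so \<open>'x free\<close> with the convolution product of \<^type>\<open>poly_mapping\<close> is
  the free unital algebra on \<open>'x\<close>.
\<close>

type_synonym 'x free = "'x word \<Rightarrow>\<^sub>0 complex"

definition const :: "complex \<Rightarrow> 'x free" where
  "const c = Poly_Mapping.single 0 c"

definition letter :: "'x \<Rightarrow> 'x free" where
  "letter x = Poly_Mapping.single (Word [x]) 1"

definition star_free :: "('x \<Rightarrow> 'x) \<Rightarrow> 'x free \<Rightarrow> 'x free" where
  "star_free s a =
    (\<Sum>w\<in>Poly_Mapping.keys a. Poly_Mapping.single (Word (rev (map s (letters w)))) (cnj (Poly_Mapping.lookup a w)))"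

definition free_star_alg :: "'x set \<Rightarrow> ('x \<Rightarrow> 'x) \<Rightarrow> 'x free star_alg" where
  "free_star_alg L s =
    \<lparr>carrier = {a. \<forall>w\<in>Poly_Mapping.keys a. set (letters w) \<subseteq> L},
     mult = (*), one = 1, zero = 0, add = (+),
     smult = (\<lambda>c a. const c * a),
     star = star_free s\<rparr>"

definition star_ideal :: "'a star_alg \<Rightarrow> 'a set \<Rightarrow> 'a set" where
  "star_ideal F R = Idl\<^bsub>F\<^esub> (R \<union> star F ` R)"

text \<open>The ring structure is \<^const>\<open>FactRing\<close>; scalars and star act on cosets by representatives.\<close>

definition quot_star_alg :: "'a star_alg \<Rightarrow> 'a set \<Rightarrow> 'a set star_alg" where
  "quot_star_alg F I =
    \<lparr>carrier = carrier (F Quot I), mult = mult (F Quot I), one = one (F Quot I),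
     zero = zero (F Quot I), add = add (F Quot I),
     smult = (\<lambda>c X. \<Union>x\<in>X. I +>\<^bsub>F\<^esub> (c \<odot>\<^bsub>F\<^esub> x)),
     star = (\<lambda>X. star F ` X)\<rparr>"


section \<open>The polynomial algebra of the quantum cone\<close>

text \<open>
  Throughout, \<open>N = n + m\<close>. The letters \<open>Gen j\<close>, \<open>GenStar j\<close> stand for $t_j$, $t_j^*$, and \<open>Fin g\<close>
  for the finite function $g(\xi_{n+1})$; the latter occur only from the next section on.
\<close>

datatype gen = Gen nat | GenStar nat | Fin "real \<Rightarrow> complex"

fun gen_star :: "gen \<Rightarrow> gen" where
  "gen_star (Gen j) = GenStar j"
| "gen_star (GenStar j) = Gen j"
| "gen_star (Fin g) = Fin (\<lambda>x. cnj (g x))"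

abbreviation t :: "nat \<Rightarrow> gen free" where "t j \<equiv> letter (Gen j)"
abbreviation ts :: "nat \<Rightarrow> gen free" where "ts j \<equiv> letter (GenStar j)"
abbreviation fin :: "(real \<Rightarrow> complex) \<Rightarrow> gen free" where "fin g \<equiv> letter (Fin g)"

abbreviation rconst :: "real \<Rightarrow> 'x free" where "rconst r \<equiv> const (complex_of_real r)"

definition pol_gens :: "nat \<Rightarrow> nat \<Rightarrow> gen set" where
  "pol_gens n m = Gen ` {1..n+m} \<union> GenStar ` {1..n+m}"

definition pol_rels :: "real \<Rightarrow> nat \<Rightarrow> nat \<Rightarrow> gen free set" where
  "pol_rels q n m =
     {t i * t j - rconst q * t j * t i | i j. 1 \<le> i \<and> i < j \<and> j \<le> n + m}
   \<union> {t i * ts j - rconst q * ts j * t i | i j. i \<in> {1..n+m} \<and> j \<in> {1..n+m} \<and> i \<noteq> j}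
   \<union> {t i * ts i - (ts i * t i + rconst (q powi -2 - 1) * (\<Sum>k=i+1..n+m. t k * ts k))
      | i. n < i \<and> i \<le> n + m}
   \<union> {t i * ts i - (ts i * t i + rconst (q powi -2 - 1) * (\<Sum>k=i+1..n. t k * ts k)
        - rconst (q powi -2 - 1) * (\<Sum>k=n+1..n+m. t k * ts k))
      | i. 1 \<le> i \<and> i \<le> n}
   \<union> {- (\<Sum>k=1..n. t k * ts k) + (\<Sum>k=n+1..n+m. t k * ts k)}"

definition pol_free :: "nat \<Rightarrow> nat \<Rightarrow> gen free star_alg" where
  "pol_free n m = free_star_alg (pol_gens n m) gen_star"

definition pol_ideal :: "real \<Rightarrow> nat \<Rightarrow> nat \<Rightarrow> gen free set" where
  "pol_ideal q n m = star_ideal (pol_free n m) (pol_rels q n m)"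

definition Pol :: "real \<Rightarrow> nat \<Rightarrow> nat \<Rightarrow> gen free set star_alg" where
  "Pol q n m = quot_star_alg (pol_free n m) (pol_ideal q n m)"

definition xi :: "nat \<Rightarrow> nat \<Rightarrow> nat \<Rightarrow> gen free" where
  "xi n m j =
    (if n < j then \<Sum>k=j..n+m. t k * ts k
     else - (\<Sum>k=j..n. t k * ts k) + (\<Sum>k=n+1..n+m. t k * ts k))"


section \<open>Adjoining finite functions of \<open>\<xi>\<^sub>n\<^sub>+\<^sub>1\<close>\<close>

text \<open>Finitely supported functions on $q^{2\mathbb{Z}}$, extended by zero to the real line.\<close>

definition fin_funs :: "real \<Rightarrow> (real \<Rightarrow> complex) set" where
  "fin_funs q = {g. finite {x. g x \<noteq> 0} \<and> {x. g x \<noteq> 0} \<subseteq> (\<lambda>k::int. q powi (2 * k)) ` UNIV}"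

definition fun_gens :: "real \<Rightarrow> nat \<Rightarrow> nat \<Rightarrow> gen set" where
  "fun_gens q n m = pol_gens n m \<union> Fin ` fin_funs q"

definition fun_rels :: "real \<Rightarrow> nat \<Rightarrow> nat \<Rightarrow> gen free set" where
  "fun_rels q n m = pol_rels q n m
   \<union> {fin (\<lambda>x. g x + h x) - (fin g + fin h) | g h. g \<in> fin_funs q \<and> h \<in> fin_funs q}
   \<union> {fin (\<lambda>x. c * g x) - const c * fin g | c g. g \<in> fin_funs q}
   \<union> {fin (\<lambda>x. g x * h x) - fin g * fin h | g h. g \<in> fin_funs q \<and> h \<in> fin_funs q}
   \<union> {fin (\<lambda>x. complex_of_real x * g x) - xi n m (n+1) * fin g | g. g \<in> fin_funs q}
   \<union> {t j * fin g - fin (\<lambda>x. g (q\<^sup>2 * x)) * t j | j g. j \<in> {1..n} \<and> g \<in> fin_funs q}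
   \<union> {ts j * fin g - fin (\<lambda>x. g (q powi -2 * x)) * ts j | j g. j \<in> {1..n} \<and> g \<in> fin_funs q}
   \<union> {t j * fin g - fin g * t j | j g. j \<in> {n+1..n+m} \<and> g \<in> fin_funs q}
   \<union> {ts j * fin g - fin g * ts j | j g. j \<in> {n+1..n+m} \<and> g \<in> fin_funs q}
   \<union> {xi n m k * fin g - fin g * xi n m k | k g. k \<in> {1..n+m} \<and> g \<in> fin_funs q}"

definition fun_free :: "real \<Rightarrow> nat \<Rightarrow> nat \<Rightarrow> gen free star_alg" where
  "fun_free q n m = free_star_alg (fun_gens q n m) gen_star"

definition fun_ideal :: "real \<Rightarrow> nat \<Rightarrow> nat \<Rightarrow> gen free set" where
  "fun_ideal q n m = star_ideal (fun_free q n m) (fun_rels q n m)"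

text \<open>
  The unital *-algebra generated by the polynomial algebra together with the finite functions of
  $\xi_{n+1}$. It is the common home of the polynomial algebra and of the (non-unital) algebra
  of finite functions on the cone, in which products of the two kinds of elements are formed.
\<close>

definition Fun :: "real \<Rightarrow> nat \<Rightarrow> nat \<Rightarrow> gen free set star_alg" where
  "Fun q n m = quot_star_alg (fun_free q n m) (fun_ideal q n m)"

definition fun_class :: "real \<Rightarrow> nat \<Rightarrow> nat \<Rightarrow> gen free \<Rightarrow> gen free set" where
  "fun_class q n m a = fun_ideal q n m +>\<^bsub>fun_free q n m\<^esub> a"

text \<open>
  The canonical *-homomorphism from \<^term>\<open>Pol q n m\<close> to \<^term>\<open>Fun q n m\<close>: the coset of \<open>a\<close> modulo
  \<open>pol_ideal\<close> is sent to the coset of \<open>a\<close> modulo the larger \<open>fun_ideal\<close>.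
\<close>

definition pol_to_fun :: "real \<Rightarrow> nat \<Rightarrow> nat \<Rightarrow> gen free set \<Rightarrow> gen free set" where
  "pol_to_fun q n m X = X <+>\<^bsub>fun_free q n m\<^esub> fun_ideal q n m"


section \<open>Finite functions on the quantum cone\<close>

text \<open>
  $t_1^{i_1}\cdots t_n^{i_n}t_{n+1}^{*i_{n+1}}\cdots t_N^{*i_N}\;
    \xi_2^{k_2}\cdots\xi_n^{k_n}\,g(\xi_{n+1})\,\xi_{n+2}^{k_{n+2}}\cdots\xi_N^{k_N}\;
    t_N^{j_N}\cdots t_{n+1}^{j_{n+1}}t_n^{*j_n}\cdots t_1^{*j_1}$
\<close>

definition D_monom ::
  "nat \<Rightarrow> nat \<Rightarrow> (nat \<Rightarrow> nat) \<Rightarrow> (nat \<Rightarrow> nat) \<Rightarrow> (nat \<Rightarrow> nat) \<Rightarrow> (real \<Rightarrow> complex) \<Rightarrow> gen free" where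
  "D_monom n m I J K g =
     prod_list (map (\<lambda>k. t k ^ I k) [1..<n+1])
   * prod_list (map (\<lambda>k. ts k ^ I k) [n+1..<n+m+1])
   * (prod_list (map (\<lambda>k. xi n m k ^ K k) [2..<n+1])
      * fin g
      * prod_list (map (\<lambda>k. xi n m k ^ K k) [n+2..<n+m+1]))
   * prod_list (map (\<lambda>k. t k ^ J k) (rev [n+1..<n+m+1]))
   * prod_list (map (\<lambda>k. ts k ^ J k) (rev [1..<n+1]))"

definition D_monoms :: "real \<Rightarrow> nat \<Rightarrow> nat \<Rightarrow> gen free set" where
  "D_monoms q n m =
    {D_monom n m I J K g | I J K g.
       g \<in> fin_funs q \<and> (\<forall>k\<in>{1..n+m}. I k * J k = 0) \<and>
       (\<Sum>k=1..n. I k) + (\<Sum>k=n+1..n+m. J k) = (\<Sum>k=1..n. J k) + (\<Sum>k=n+1..n+m. I k)}"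

text \<open>
  The *-algebra of finite functions on the quantum cone, with the operations inherited from
  \<^term>\<open>Fun q n m\<close>: all finite linear combinations of the above monomials. (The inner linear
  combination defining $f_{IJ}$ and the outer sum over $I$, $J$ are merged into one sum.)
\<close>

definition D :: "real \<Rightarrow> nat \<Rightarrow> nat \<Rightarrow> gen free set star_alg" where
  "D q n m = (Fun q n m)
    \<lparr>carrier := {fun_class q n m (\<Sum>x\<in>S. const (c x) * x) | S c. finite S \<and> S \<subseteq> D_monoms q n m}\<rparr>"


section \<open>The pre-Hilbert space and the representation of the polynomial algebra\<close>

text \<open>
  The label $(i_1,\dots,i_{N-1})$ is encoded as a function on \<^typ>\<open>nat\<close> that vanishes outside
  \<open>{1..N-1}\<close>.
\<close>

definition idx :: "nat \<Rightarrow> nat \<Rightarrow> (nat \<Rightarrow> int) set" where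
  "idx n m = {i. (\<forall>k. k \<notin> {1..<n+m} \<longrightarrow> i k = 0) \<and> (\<forall>k\<in>{2..n}. i k \<le> 0) \<and> (\<forall>k\<in>{n+1..<n+m}. 1 \<le> i k)}"

definition H0 :: "nat \<Rightarrow> nat \<Rightarrow> ((nat \<Rightarrow> int) \<Rightarrow>\<^sub>0 complex) set" where
  "H0 n m = {v. Poly_Mapping.keys v \<subseteq> idx n m}"

definition partial_sum :: "(nat \<Rightarrow> int) \<Rightarrow> nat \<Rightarrow> int" where
  "partial_sum i j = (\<Sum>k=1..<j. i k)"

fun T0_gen :: "real \<Rightarrow> nat \<Rightarrow> nat \<Rightarrow> gen \<Rightarrow> (nat \<Rightarrow> int) \<Rightarrow> ((nat \<Rightarrow> int) \<Rightarrow>\<^sub>0 complex)" where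
  "T0_gen q n m (Gen j) i =
    (if j = 1 then
       Poly_Mapping.single (i(1 := i 1 - 1)) (complex_of_real (q powi (i 1 - 1)))
     else if j \<le> n then
       Poly_Mapping.single (i(j := i j - 1))
         (complex_of_real (q powi partial_sum i j * sqrt (q powi (2 * (i j - 1)) - 1)))
     else if j < n + m then
       Poly_Mapping.single (i(j := i j - 1))
         (complex_of_real (q powi partial_sum i j * sqrt (1 - q powi (2 * (i j - 1)))))
     else Poly_Mapping.single i (complex_of_real (q powi partial_sum i j)))"
| "T0_gen q n m (GenStar j) i =
    (if j = 1 then
       Poly_Mapping.single (i(1 := i 1 + 1)) (complex_of_real (q powi i 1))
     else if j \<le> n then
       Poly_Mapping.single (i(j := i j + 1))
         (complex_of_real (q powi partial_sum i j * sqrt (q powi (2 * i j) - 1)))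
     else if j < n + m then
       Poly_Mapping.single (i(j := i j + 1))
         (complex_of_real (q powi partial_sum i j * sqrt (1 - q powi (2 * i j))))
     else Poly_Mapping.single i (complex_of_real (q powi partial_sum i j)))"
| "T0_gen q n m (Fin g) i = 0" \<comment> \<open>dummy value: \<open>Fin g\<close> does not occur in \<open>Pol\<close>\<close>

definition T0_free :: "real \<Rightarrow> nat \<Rightarrow> nat \<Rightarrow> gen free \<Rightarrow>
    ((nat \<Rightarrow> int) \<Rightarrow>\<^sub>0 complex) \<Rightarrow> ((nat \<Rightarrow> int) \<Rightarrow>\<^sub>0 complex)" where
  "T0_free q n m a v =
    (\<Sum>w\<in>Poly_Mapping.keys a. scale (Poly_Mapping.lookup a w) (foldr (\<lambda>x. lin_ext (T0_gen q n m x)) (letters w) v))"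

text \<open>On \<^term>\<open>v \<in> H0 n m\<close> all representatives of a coset have the same value.\<close>

definition T0 :: "real \<Rightarrow> nat \<Rightarrow> nat \<Rightarrow> gen free set \<Rightarrow>
    ((nat \<Rightarrow> int) \<Rightarrow>\<^sub>0 complex) \<Rightarrow> ((nat \<Rightarrow> int) \<Rightarrow>\<^sub>0 complex)" where
  "T0 q n m X v = the_elem ((\<lambda>a. T0_free q n m a v) ` X)"

end

(*
  All relations are checked on basis vectors, where xi_k acts as multiplication by q^(2 S_k). The
  operators of t_j and t_j^* are adjoint and the inner product is definite, so the elements of the
  free algebra acting by zero form a *-invariant ideal, and the representation descends to Fun.

  In Fun, letters with different indices commute up to a scalar, t_k t_k^* and t_k^* t_k are linear
  combinations of xi_k and xi_(k+1), and the xi_k and the finite functions can be moved through all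
  letters. By induction on length, every word that contains a finite function and as many t's as
  t^*'s is a combination of the monomials defining D. So D is the image of the span of such words,
  which is visibly closed under products and star.

  For faithfulness, the monomial with exponents I, J shifts the label of a basis vector by an amount
  which, together with the balance of t's and t^*'s, determines I and J. It remains to see that
  f_IJ(xi_2, ..., xi_N) is determined by its action on vectors far from the boundary of the label
  set. There, for fixed S_(n+1), the other S_k run over increasing chains with large gaps, and a
  polynomial vanishing at all such points q^(2 S_k) is zero, one variable at a time.
*)
theory Submission
  imports Defs "HOL-Library.Multiset" "HOL-Computational_Algebra.Polynomial"
begin

section \<open>Linear maps on finitely supported functions\<close>

text \<open>The kernel argument supplies it, since a combination of monomials that acts by zero is
  shown to vanish already by the relations. Three features shape that argument. Near the boundary of
  the label set amplitudes vanish, so evaluation is informative only at labels whose distance from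
  it is at least the length of the words involved. The factor g(\<xi>_{n+1}) is not a polynomial,
  hence S_{n+1} is held fixed and the functions g are compared point by point, while the other
  \<xi>_k are separated by polynomial identity. The generators with index N act diagonally and leave
  no trace in the label; without the balance of the monomials their exponents would be
  invisible.\<close>

lemma lookup_scale [simp]:
  "Poly_Mapping.lookup (scale c v) i = c * Poly_Mapping.lookup v i"
  by (simp add: scale_def Poly_Mapping.map.rep_eq when_def)

lemma scale_add_right: "scale c (u + v) = scale c u + scale c v"
  by (rule poly_mapping_eqI) (simp add: lookup_add algebra_simps)

lemma scale_add_left: "scale (c + d) v = scale c v + scale d v"
  by (rule poly_mapping_eqI) (simp add: lookup_add algebra_simps)

lemma scale_scale [simp]: "scale c (scale d v) = scale (c * d) v"
  by (rule poly_mapping_eqI) simp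

lemma scale_0_right [simp]: "scale c 0 = 0"
  by (rule poly_mapping_eqI) simp

lemma scale_0_left [simp]: "scale 0 v = 0"
  by (rule poly_mapping_eqI) simp

lemma scale_1 [simp]: "scale 1 v = v"
  by (rule poly_mapping_eqI) simp

lemma scale_minus_1: "scale (-1) v = - v"
  by (rule poly_mapping_eqI) simp

lemma scale_single [simp]: "scale c (Poly_Mapping.single i d) = Poly_Mapping.single i (c * d)"
  by (rule poly_mapping_eqI) (simp add: lookup_single when_def)

lemma scale_sum: "scale c (\<Sum>i\<in>A. f i) = (\<Sum>i\<in>A. scale c (f i))"
  by (induction A rule: infinite_finite_induct) (simp_all add: scale_add_right)

lemma keys_scale: "Poly_Mapping.keys (scale c v) \<subseteq> Poly_Mapping.keys v"
  by (auto simp: in_keys_iff)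

text \<open>At a fresh key an update is a sum, the shape on which additive maps can be
  evaluated.\<close>

lemma poly_mapping_add_induct [case_names zero add]:
  assumes "P 0"
    and "\<And>i c v. i \<notin> Poly_Mapping.keys v \<Longrightarrow> P v \<Longrightarrow> P (Poly_Mapping.single i c + v)"
  shows "P v"
proof (induction v rule: Poly_Mapping.update_induct)
  case const
  show ?case by (fact assms(1))
next
  case (update f i c)
  have "Poly_Mapping.update i c f = Poly_Mapping.single i c + f"
    using update by (intro poly_mapping_eqI)
      (auto simp: lookup_add lookup_update lookup_single when_def in_keys_iff)
  then show ?case using assms(2) update by simp
qed

text \<open>The supports of \<open>u\<close>, \<open>v\<close> and \<open>u + v\<close> differ;
  rewriting all sums over one finite superset makes them comparable.\<close>

lemma lin_ext_superset:
  assumes "finite A" "Poly_Mapping.keys v \<subseteq> A"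
  shows "lin_ext \<phi> v = (\<Sum>i\<in>A. scale (Poly_Mapping.lookup v i) (\<phi> i))"
  unfolding lin_ext_def
  by (rule sum.mono_neutral_left) (use assms in \<open>auto simp: in_keys_iff\<close>)

lemma lin_ext_add: "lin_ext \<phi> (u + v) = lin_ext \<phi> u + lin_ext \<phi> v"
proof -
  let ?A = "Poly_Mapping.keys u \<union> Poly_Mapping.keys v"
  have "lin_ext \<phi> (u + v) = (\<Sum>i\<in>?A. scale (Poly_Mapping.lookup (u + v) i) (\<phi> i))"
    by (rule lin_ext_superset) (auto simp: keys_add)
  also have "\<dots> = lin_ext \<phi> u + lin_ext \<phi> v"
    by (simp add: lookup_add scale_add_left sum.distrib lin_ext_superset[of ?A])
  finally show ?thesis .
qed

lemma lin_ext_single [simp]: "lin_ext \<phi> (Poly_Mapping.single i c) = scale c (\<phi> i)"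
  by (simp add: lin_ext_def)

lemma lin_ext_0 [simp]: "lin_ext \<phi> 0 = 0"
  by (simp add: lin_ext_def)

lemma lin_ext_scale: "lin_ext \<phi> (scale c v) = scale c (lin_ext \<phi> v)"
  by (subst lin_ext_superset[OF finite_keys keys_scale])
     (simp add: lin_ext_def scale_sum)

lemma lin_ext_minus: "lin_ext \<phi> (- v) = - lin_ext \<phi> v"
  using lin_ext_scale[of \<phi> "-1" v] by (simp add: scale_minus_1)

lemma lin_ext_diff: "lin_ext \<phi> (u - v) = lin_ext \<phi> u - lin_ext \<phi> v"
  using lin_ext_add[of \<phi> u "- v"] by (simp add: lin_ext_minus)

lemma lin_ext_sum: "lin_ext \<phi> (\<Sum>i\<in>A. f i) = (\<Sum>i\<in>A. lin_ext \<phi> (f i))"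
  by (induction A rule: infinite_finite_induct) (simp_all add: lin_ext_add)

lemma lookup_lin_ext:
  "Poly_Mapping.lookup (lin_ext \<phi> v) j =
    (\<Sum>i\<in>Poly_Mapping.keys v. Poly_Mapping.lookup v i * Poly_Mapping.lookup (\<phi> i) j)"
  by (simp add: lin_ext_def lookup_sum)

lemma lin_ext_cong:
  assumes "\<And>i. i \<in> Poly_Mapping.keys v \<Longrightarrow> \<phi> i = \<psi> i"
  shows "lin_ext \<phi> v = lin_ext \<psi> v"
  using assms by (simp add: lin_ext_def)

lemma lin_ext_eqI:
  assumes "\<And>u v. f (u + v) = f u + f v" "\<And>c v. f (scale c v) = scale c (f v)"
    and "\<And>i. i \<in> Poly_Mapping.keys v \<Longrightarrow> f (Poly_Mapping.single i 1) = \<phi> i"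
  shows "f v = lin_ext \<phi> v"
  using assms(3)
proof (induction v rule: poly_mapping_add_induct)
  case zero
  show ?case using assms(2)[of 0 0] by simp
next
  case (add i c v)
  have k: "Poly_Mapping.keys (Poly_Mapping.single i c + v) = (if c = 0 then {} else {i}) \<union> Poly_Mapping.keys v"
    using add.hyps by (auto simp: in_keys_iff lookup_add lookup_single when_def split: if_splits)
  \<comment> \<open>For \<open>c = 0\<close> the index \<open>i\<close> is no key of the sum, so the
    assumption says nothing about \<open>f\<close> at \<open>i\<close>.\<close>
  have "f (Poly_Mapping.single i c) = scale c (\<phi> i)"
  proof (cases "c = 0")
    case True
    then show ?thesis using assms(2)[of 0 0] by simp
  next
    case False
    then have "f (Poly_Mapping.single i 1) = \<phi> i" using add.prems k by auto
    then show ?thesis using assms(2)[of c "Poly_Mapping.single i 1"] by simp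
  qed
  moreover have "f v = lin_ext \<phi> v"
    using add.IH add.prems k by auto
  ultimately show ?case by (simp add: assms(1) lin_ext_add)
qed

definition supported :: "'i set \<Rightarrow> ('i \<Rightarrow>\<^sub>0 complex) set" where
  "supported B = {v. Poly_Mapping.keys v \<subseteq> B}"

lemma supported_add: "u \<in> supported B \<Longrightarrow> v \<in> supported B \<Longrightarrow> u + v \<in> supported B"
  using keys_add[of u v] by (auto simp: supported_def)

lemma supported_scale: "v \<in> supported B \<Longrightarrow> scale c v \<in> supported B"
  using keys_scale[of c v] by (auto simp: supported_def)

lemma supported_0 [simp]: "0 \<in> supported B"
  by (simp add: supported_def)

lemma supported_sum: "(\<And>i. i \<in> A \<Longrightarrow> f i \<in> supported B) \<Longrightarrow> (\<Sum>i\<in>A. f i) \<in> supported B"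
  by (induction A rule: infinite_finite_induct) (simp_all add: supported_add)

lemma supported_lin_ext:
  assumes "v \<in> supported B" "\<And>i. i \<in> B \<Longrightarrow> \<phi> i \<in> supported B'"
  shows "lin_ext \<phi> v \<in> supported B'"
  unfolding lin_ext_def
  by (rule supported_sum, rule supported_scale) (use assms in \<open>auto simp: supported_def\<close>)

section \<open>The inner product and adjoint operators\<close>

lemma ip_superset:
  assumes "finite A" "Poly_Mapping.keys u \<subseteq> A"
  shows "ip u v = (\<Sum>i\<in>A. Poly_Mapping.lookup u i * cnj (Poly_Mapping.lookup v i))"
  unfolding ip_def by (rule sum.mono_neutral_left) (use assms in \<open>auto simp: in_keys_iff\<close>)

lemma ip_add_left: "ip (u + u') v = ip u v + ip u' v"
proof -
  let ?A = "Poly_Mapping.keys u \<union> Poly_Mapping.keys u'"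
  show ?thesis
    by (subst (1 2 3) ip_superset[of ?A])
       (auto simp: lookup_add algebra_simps sum.distrib keys_add)
qed

lemma ip_scale_left: "ip (scale c u) v = c * ip u v"
  by (subst ip_superset[OF finite_keys keys_scale]) (simp add: ip_def sum_distrib_left mult.assoc)

lemma ip_commute: "ip u v = cnj (ip v u)"
proof -
  let ?A = "Poly_Mapping.keys u \<union> Poly_Mapping.keys v"
  show ?thesis
    by (subst (1 2) ip_superset[of ?A]) (auto simp: mult.commute)
qed

lemma ip_add_right: "ip u (v + v') = ip u v + ip u v'"
  by (metis ip_commute ip_add_left complex_cnj_add)

lemma ip_scale_right: "ip u (scale c v) = cnj c * ip u v"
  by (metis ip_commute ip_scale_left complex_cnj_mult)

lemma ip_0 [simp]: "ip 0 v = 0" "ip u 0 = 0"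
  by (simp_all add: ip_def)

text \<open>Needed for the adjoints of the defining relations, whose action is accessible only
  through its norm.\<close>

lemma ip_self_eq_0: "ip v v = 0 \<longleftrightarrow> v = 0"
proof
  assume "ip v v = 0"
  moreover have "ip v v = of_real (\<Sum>i\<in>Poly_Mapping.keys v. (cmod (Poly_Mapping.lookup v i))\<^sup>2)"
    unfolding ip_def of_real_sum by (intro sum.cong refl complex_norm_square[symmetric])
  ultimately have "(\<Sum>i\<in>Poly_Mapping.keys v. (cmod (Poly_Mapping.lookup v i))\<^sup>2) = 0"
    by (metis of_real_eq_0_iff)
  then have "\<forall>i\<in>Poly_Mapping.keys v. (cmod (Poly_Mapping.lookup v i))\<^sup>2 = 0"
    by (subst (asm) sum_nonneg_eq_0_iff) simp_all
  then show "v = 0" by (intro poly_mapping_eqI) (auto simp: in_keys_iff)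
qed simp

lemma ip_sum_left: "ip (\<Sum>i\<in>A. f i) v = (\<Sum>i\<in>A. ip (f i) v)"
  by (induction A rule: infinite_finite_induct) (simp_all add: ip_add_left)

text \<open>Matrix criterion. Comparing entries on \<open>B\<close> is enough, because entries
  outside \<open>B\<close> are paired with zeros of the other vector.\<close>

lemma lin_ext_adjoint:
  assumes "u \<in> supported B" "v \<in> supported B"
    and "\<And>i j. i \<in> B \<Longrightarrow> j \<in> B \<Longrightarrow>
      Poly_Mapping.lookup (\<phi> i) j = cnj (Poly_Mapping.lookup (\<psi> j) i)"
  shows "ip (lin_ext \<phi> u) v = ip u (lin_ext \<psi> v)"
proof -
  have 1: "ip (\<phi> i) v = cnj (Poly_Mapping.lookup (lin_ext \<psi> v) i)" if "i \<in> B" for i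
  proof -
    have "ip (\<phi> i) v = cnj (ip v (\<phi> i))" by (rule ip_commute)
    also have "\<dots> = cnj (Poly_Mapping.lookup (lin_ext \<psi> v) i)"
      using assms that unfolding ip_def lookup_lin_ext supported_def
      by (intro arg_cong[where f = cnj] sum.cong) auto
    finally show ?thesis .
  qed
  have "ip (lin_ext \<phi> u) v = (\<Sum>i\<in>Poly_Mapping.keys u. Poly_Mapping.lookup u i * ip (\<phi> i) v)"
    by (simp add: lin_ext_def ip_sum_left ip_scale_left)
  also have "\<dots> = ip u (lin_ext \<psi> v)"
    unfolding ip_def using 1 assms(1) by (intro sum.cong) (auto simp: supported_def ip_def)
  finally show ?thesis .
qed

section \<open>The free *-algebra and its representations\<close>

lemma const_mult_single: "const c * Poly_Mapping.single w d = Poly_Mapping.single w (c * d)"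
  by (simp add: const_def mult_single)

lemma const_mult: "const c * a = scale c a"
  by (simp add: const_def scale_def mult_map_scale_conv_mult)

lemma const_add: "const (c + d) = const c + const d"
  by (simp add: const_def single_add)

lemma const_times: "const (c * d) = const c * const d"
  by (simp add: const_def mult_single)

lemma const_0 [simp]: "const 0 = 0"
  by (simp add: const_def)

lemma const_1 [simp]: "const 1 = 1"
  by (simp add: const_def)

lemma const_minus: "const (- c) = - const c"
  by (simp add: const_def single_uminus)

lemma const_commute: "a * const c = const c * a"
proof (induction a rule: poly_mapping_add_induct)
  case (add w d v)
  then show ?case by (simp add: distrib_left distrib_right const_def mult_single mult.commute)
qed simp

lemma const_left_commute: "a * (const c * b) = const c * (a * b)"
  by (simp add: const_commute mult.assoc[symmetric])

lemma letters_plus [simp]: "letters (v + w) = letters v @ letters w"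
  by (simp add: plus_word_def)

definition wd :: "'x list \<Rightarrow> 'x free" where
  "wd xs = Poly_Mapping.single (Word xs) 1"

lemma wd_Nil [simp]: "wd [] = 1"
  by (simp add: wd_def flip: zero_word_def)

lemma wd_append: "wd (xs @ ys) = wd xs * wd ys"
  by (simp add: wd_def mult_single plus_word_def)

lemma letter_conv_wd: "letter x = wd [x]"
  by (simp add: wd_def letter_def)

lemma wd_Cons: "wd (x # xs) = letter x * wd xs"
  using wd_append[of "[x]" xs] by (simp add: letter_conv_wd)

lemma wd_replicate: "wd (replicate k x) = letter x ^ k"
  by (induction k) (simp_all add: wd_Cons)

lemma wd_concat: "wd (concat xss) = prod_list (map wd xss)"
  by (induction xss) (simp_all add: wd_append)

lemma free_induct [case_names zero add]:
  fixes a :: "'x free"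
  assumes "P 0" and "\<And>xs c a. Word xs \<notin> Poly_Mapping.keys a \<Longrightarrow> P a \<Longrightarrow> P (const c * wd xs + a)"
  shows "P a"
proof (induction a rule: poly_mapping_add_induct)
  case (add w c v)
  then show ?case
    using assms(2)[of "letters w" v c] by (simp add: wd_def const_mult_single)
qed (fact assms(1))

lemma free_expand: "a = (\<Sum>w\<in>Poly_Mapping.keys a. const (Poly_Mapping.lookup a w) * wd (letters w))"
  by (rule poly_mapping_eqI)
     (simp add: wd_def const_mult_single lookup_sum lookup_single when_def in_keys_iff if_distrib sum.delta cong: if_cong)

definition wact :: "('x \<Rightarrow> 'i \<Rightarrow> ('i \<Rightarrow>\<^sub>0 complex)) \<Rightarrow> 'x list \<Rightarrow> ('i \<Rightarrow>\<^sub>0 complex) \<Rightarrow> ('i \<Rightarrow>\<^sub>0 complex)" where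
  "wact \<phi> xs v = foldr (\<lambda>x. lin_ext (\<phi> x)) xs v"

lemma wact_simps [simp]:
  "wact \<phi> [] v = v"
  "wact \<phi> (x # xs) v = lin_ext (\<phi> x) (wact \<phi> xs v)"
  "wact \<phi> (xs @ ys) v = wact \<phi> xs (wact \<phi> ys v)"
  by (simp_all add: wact_def)

lemma wact_add: "wact \<phi> xs (u + v) = wact \<phi> xs u + wact \<phi> xs v"
  by (induction xs) (simp_all add: lin_ext_add)

lemma wact_scale: "wact \<phi> xs (scale c v) = scale c (wact \<phi> xs v)"
  by (induction xs) (simp_all add: lin_ext_scale)

text \<open>The universal property of the free algebra: the action of the letters extended to an
  algebra homomorphism into linear operators. It is written as a linear extension over words, so
  that the facts about \<open>lin_ext\<close> apply to the algebra element as well.\<close>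

definition rep :: "('x \<Rightarrow> 'i \<Rightarrow> ('i \<Rightarrow>\<^sub>0 complex)) \<Rightarrow> 'x free \<Rightarrow> ('i \<Rightarrow>\<^sub>0 complex) \<Rightarrow> ('i \<Rightarrow>\<^sub>0 complex)" where
  "rep \<phi> a v = lin_ext (\<lambda>w. wact \<phi> (letters w) v) a"

lemma rep_add: "rep \<phi> (a + b) v = rep \<phi> a v + rep \<phi> b v"
  by (simp add: rep_def lin_ext_add)

lemma rep_0 [simp]: "rep \<phi> 0 v = 0"
  by (simp add: rep_def)

lemma rep_diff: "rep \<phi> (a - b) v = rep \<phi> a v - rep \<phi> b v"
  by (simp add: rep_def lin_ext_diff)

lemma rep_sum: "rep \<phi> (\<Sum>i\<in>A. f i) v = (\<Sum>i\<in>A. rep \<phi> (f i) v)"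
  by (simp add: rep_def lin_ext_sum)

lemma rep_const_mult: "rep \<phi> (const c * a) v = scale c (rep \<phi> a v)"
  by (simp add: rep_def const_mult lin_ext_scale)

lemma rep_wd: "rep \<phi> (wd xs) v = wact \<phi> xs v"
  by (simp add: rep_def wd_def)

lemma rep_letter: "rep \<phi> (letter x) v = lin_ext (\<phi> x) v"
  by (simp add: letter_conv_wd rep_wd)

lemma rep_1 [simp]: "rep \<phi> 1 v = v"
  using rep_wd[of \<phi> "[]"] by simp

lemma rep_add_right: "rep \<phi> a (u + v) = rep \<phi> a u + rep \<phi> a v"
  by (simp add: rep_def wact_add lin_ext_def scale_add_right sum.distrib)

lemma rep_scale_right: "rep \<phi> a (scale c v) = scale c (rep \<phi> a v)"
  by (simp add: rep_def wact_scale lin_ext_def scale_sum mult.commute)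

lemma rep_0_right [simp]: "rep \<phi> a 0 = 0"
  using rep_scale_right[of \<phi> a 0 0] by simp

lemma rep_mult: "rep \<phi> (a * b) v = rep \<phi> a (rep \<phi> b v)"
proof (induction a rule: free_induct)
  case (add xs c a)
  have "rep \<phi> (wd xs * b) v = wact \<phi> xs (rep \<phi> b v)"
  proof (induction b rule: free_induct)
    case zero
    show ?case using wact_scale[of \<phi> xs 0 0] by simp
  next
    case (add ys d b)
    have "wd xs * (const d * wd ys) = const d * wd (xs @ ys)"
      by (simp add: const_left_commute wd_append)
    with add show ?case
      by (simp add: distrib_left rep_add rep_const_mult rep_wd wact_add wact_scale)
  qed
  with add show ?case
    by (simp add: distrib_right rep_add mult.assoc rep_const_mult rep_wd)
qed simp

text \<open>Serves to compare \<open>T0_gen\<close> with \<open>act\<close>, which differ only on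
  the letters \<open>Fin g\<close>; polynomial elements do not contain these.\<close>

lemma rep_cong:
  assumes "\<And>w x. w \<in> Poly_Mapping.keys a \<Longrightarrow> x \<in> set (letters w) \<Longrightarrow> \<phi> x = \<psi> x"
  shows "rep \<phi> a v = rep \<psi> a v"
proof -
  have "wact \<phi> xs v = wact \<psi> xs v" if "\<forall>x\<in>set xs. \<phi> x = \<psi> x" for xs
    using that by (induction xs) simp_all
  then show ?thesis
    unfolding rep_def using assms by (intro lin_ext_cong) blast
qed

lemma T0_free_eq_rep: "T0_free q n m a v = rep (T0_gen q n m) a v"
  by (simp add: T0_free_def rep_def lin_ext_def wact_def)

section \<open>The involution of the free algebra\<close>

lemma star_free_superset:
  assumes "finite A" "Poly_Mapping.keys a \<subseteq> A"
  shows "star_free s a = (\<Sum>w\<in>A. Poly_Mapping.single (Word (rev (map s (letters w)))) (cnj (Poly_Mapping.lookup a w)))"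
  unfolding star_free_def by (rule sum.mono_neutral_left) (use assms in \<open>auto simp: in_keys_iff\<close>)

lemma star_free_add: "star_free s (a + b) = star_free s a + star_free s b"
proof -
  let ?A = "Poly_Mapping.keys a \<union> Poly_Mapping.keys b"
  show ?thesis
    by (subst (1 2 3) star_free_superset[of ?A])
       (auto simp: lookup_add single_add sum.distrib keys_add)
qed

lemma star_free_0 [simp]: "star_free s 0 = 0"
  by (simp add: star_free_def)

lemma star_free_const_mult: "star_free s (const c * a) = const (cnj c) * star_free s a"
  unfolding const_mult
  by (subst star_free_superset[OF finite_keys keys_scale]) (simp add: star_free_def scale_sum)

lemma star_free_minus: "star_free s (- a) = - star_free s a"
  using star_free_const_mult[of s "-1" a] by (simp add: const_minus)

lemma star_free_diff: "star_free s (a - b) = star_free s a - star_free s b"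
  using star_free_add[of s a "- b"] by (simp add: star_free_minus)

lemma star_free_sum: "star_free s (\<Sum>i\<in>A. f i) = (\<Sum>i\<in>A. star_free s (f i))"
  by (induction A rule: infinite_finite_induct) (simp_all add: star_free_add)

lemma star_free_wd: "star_free s (wd xs) = wd (rev (map s xs))"
  by (simp add: star_free_def wd_def)

lemma star_free_1 [simp]: "star_free s 1 = 1"
  using star_free_wd[of s "[]"] by simp

lemma star_free_letter: "star_free s (letter x) = letter (s x)"
  by (simp add: letter_conv_wd star_free_wd)

lemma star_free_mult: "star_free s (a * b) = star_free s b * star_free s a"
proof (induction a rule: free_induct)
  case (add xs c a)
  have "star_free s (wd xs * b) = star_free s b * wd (rev (map s xs))"
  proof (induction b rule: free_induct)
    case (add ys d b)
    have "star_free s (wd xs * (const d * wd ys)) = const (cnj d) * wd (rev (map s (xs @ ys)))"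
      unfolding const_left_commute star_free_const_mult wd_append[symmetric] star_free_wd ..
    with add show ?case
      by (simp add: distrib_left distrib_right star_free_add star_free_const_mult star_free_wd
          wd_append mult.assoc)
  qed simp
  with add show ?case
    by (simp add: distrib_left distrib_right star_free_add mult.assoc star_free_const_mult star_free_wd
        const_left_commute)
qed simp

lemma star_free_star_free:
  assumes "\<And>x. s (s x) = x"
  shows "star_free s (star_free s a) = a"
  by (induction a rule: free_induct)
     (simp_all add: star_free_add star_free_const_mult star_free_wd rev_map comp_def assms)

lemma keys_star_free: 
  "Poly_Mapping.keys (star_free s a) \<subseteq> (\<lambda>w. Word (rev (map s (letters w)))) ` Poly_Mapping.keys a"
  unfolding star_free_def by (rule order_trans[OF keys_sum]) auto

text \<open>\<open>W\<close> is an arbitrary set of words: \<open>lists L\<close> gives the free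
  algebra on \<open>L\<close>, while \<open>D_words\<close> gives the non-unital subalgebra that
  represents \<open>D\<close>.\<close>

definition words_in :: "'x list set \<Rightarrow> 'x free set" where
  "words_in W = {a. \<forall>w\<in>Poly_Mapping.keys a. letters w \<in> W}"

lemma words_in_0 [simp]: "0 \<in> words_in W"
  by (simp add: words_in_def)

lemma words_in_add: "a \<in> words_in W \<Longrightarrow> b \<in> words_in W \<Longrightarrow> a + b \<in> words_in W"
  using keys_add[of a b] by (auto simp: words_in_def)

lemma words_in_const_mult: "a \<in> words_in W \<Longrightarrow> const c * a \<in> words_in W"
  using keys_scale[of c a] by (auto simp: words_in_def const_mult)

lemma words_in_minus: "a \<in> words_in W \<Longrightarrow> - a \<in> words_in W"
  using words_in_const_mult[of a W "-1"] by (simp add: const_minus)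

lemma words_in_diff: "a \<in> words_in W \<Longrightarrow> b \<in> words_in W \<Longrightarrow> a - b \<in> words_in W"
  using words_in_add[of a W "- b"] words_in_minus[of b W] by simp

lemma words_in_sum: "(\<And>i. i \<in> A \<Longrightarrow> f i \<in> words_in W) \<Longrightarrow> (\<Sum>i\<in>A. f i) \<in> words_in W"
  by (induction A rule: infinite_finite_induct) (simp_all add: words_in_add)

lemma words_in_wd: "wd xs \<in> words_in W \<longleftrightarrow> xs \<in> W"
  by (simp add: words_in_def wd_def)

lemma words_in_mult:
  assumes "a \<in> words_in U" "b \<in> words_in V" "\<And>xs ys. xs \<in> U \<Longrightarrow> ys \<in> V \<Longrightarrow> xs @ ys \<in> W"
  shows "a * b \<in> words_in W"
  unfolding words_in_def
proof safe
  fix w assume "w \<in> Poly_Mapping.keys (a * b)"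
  then obtain u v where "w = u + v" "u \<in> Poly_Mapping.keys a" "v \<in> Poly_Mapping.keys b"
    using keys_mult[of a b] by blast
  then show "letters w \<in> W" using assms by (simp add: words_in_def)
qed

lemma words_in_star_free:
  assumes "a \<in> words_in U" "\<And>xs. xs \<in> U \<Longrightarrow> rev (map s xs) \<in> W"
  shows "star_free s a \<in> words_in W"
  unfolding words_in_def
proof safe
  fix w assume "w \<in> Poly_Mapping.keys (star_free s a)"
  then obtain v where "v \<in> Poly_Mapping.keys a" "w = Word (rev (map s (letters v)))"
    using keys_star_free[of s a] by blast
  then show "letters w \<in> W" using assms by (simp add: words_in_def)
qed

text \<open>Peeling off a term must not lead out of \<open>words_in W\<close>. The induction
  therefore runs over partial sums of the expansion of \<open>a\<close>, all of whose words belong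
  to \<open>W\<close>.\<close>

lemma words_in_induct [consumes 1, case_names zero add]:
  assumes "a \<in> words_in W" "P 0"
    and "\<And>xs c a. xs \<in> W \<Longrightarrow> a \<in> words_in W \<Longrightarrow> P a \<Longrightarrow> P (const c * wd xs + a)"
  shows "P a"
proof -
  define f where "f w = const (Poly_Mapping.lookup a w) * wd (letters w)" for w
  have "sum f A \<in> words_in W \<and> P (sum f A)" if "finite A" "\<And>w. w \<in> A \<Longrightarrow> letters w \<in> W" for A
    using that
  proof (induction A)
    case (insert w A)
    then have w: "letters w \<in> W" and A: "sum f A \<in> words_in W" "P (sum f A)" by simp_all
    have "f w \<in> words_in W"
      unfolding f_def using w by (intro words_in_const_mult) (simp add: words_in_wd)
    moreover have "P (f w + sum f A)"
      unfolding f_def[of w] by (rule assms(3)[OF w A])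
    ultimately show ?case using insert.hyps A by (simp add: words_in_add)
  qed (simp add: assms(2))
  moreover have "sum f (Poly_Mapping.keys a) = a"
    unfolding f_def by (rule free_expand[symmetric])
  moreover have "\<And>w. w \<in> Poly_Mapping.keys a \<Longrightarrow> letters w \<in> W"
    using assms(1) by (simp add: words_in_def)
  ultimately show ?thesis by (metis finite_keys)
qed

abbreviation free_on :: "'x set \<Rightarrow> 'x free set" where
  "free_on L \<equiv> words_in (lists L)"

lemma free_on_mult: "a \<in> free_on L \<Longrightarrow> b \<in> free_on L \<Longrightarrow> a * b \<in> free_on L"
  by (rule words_in_mult[of a "lists L" b "lists L"]) auto

lemma free_on_wd: "set xs \<subseteq> L \<Longrightarrow> wd xs \<in> free_on L"
  by (auto simp: words_in_wd)

lemma free_on_1 [simp]: "1 \<in> free_on L"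
  using free_on_wd[of "[]" L] by simp

lemma free_on_letter: "x \<in> L \<Longrightarrow> letter x \<in> free_on L"
  by (simp add: letter_conv_wd free_on_wd)

lemma free_on_const [simp]: "const c \<in> free_on L"
  using words_in_const_mult[OF free_on_1, of c L] by simp

lemma free_on_power: "a \<in> free_on L \<Longrightarrow> a ^ k \<in> free_on L"
  by (induction k) (simp_all add: free_on_mult)

lemma free_on_prod_list: "(\<And>a. a \<in> set as \<Longrightarrow> a \<in> free_on L) \<Longrightarrow> prod_list as \<in> free_on L"
  by (induction as) (simp_all add: free_on_mult)

lemma free_on_star: "a \<in> free_on L \<Longrightarrow> s ` L \<subseteq> L \<Longrightarrow> star_free s a \<in> free_on L"
  by (rule words_in_star_free[of a "lists L"]) (auto simp: lists_eq_set)

lemma free_on_mono: "L \<subseteq> L' \<Longrightarrow> free_on L \<subseteq> free_on L'"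
  unfolding words_in_def using lists_mono by blast

lemmas free_on_intros = free_on_mult free_on_1 free_on_letter free_on_const free_on_power
  free_on_prod_list words_in_0 words_in_add words_in_minus words_in_diff words_in_sum

lemma free_star_alg_simps [simp]:
  "carrier (free_star_alg L s) = free_on L"
  "monoid.mult (free_star_alg L s) = (*)" "one (free_star_alg L s) = 1"
  "zero (free_star_alg L s) = 0" "add (free_star_alg L s) = (+)"
  "module.smult (free_star_alg L s) = (\<lambda>c a. const c * a)"
  "star (free_star_alg L s) = star_free s"
  by (auto simp: free_star_alg_def words_in_def lists_eq_set)

lemma ring_free_star_alg: "ring (free_star_alg L s)"
proof (rule ringI)
  show "abelian_group (free_star_alg L s)"
  proof (rule abelian_groupI)
    fix a assume "a \<in> carrier (free_star_alg L s)"
    then show "\<exists>b\<in>carrier (free_star_alg L s). b \<oplus>\<^bsub>free_star_alg L s\<^esub> a = \<zero>\<^bsub>free_star_alg L s\<^esub>"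
      by (intro bexI[of _ "- a"]) (simp_all add: words_in_minus)
  qed (simp_all add: words_in_add add.assoc add.commute)
  show "monoid (free_star_alg L s)"
    by (rule monoidI) (simp_all add: free_on_mult mult.assoc)
qed (simp_all add: distrib_left distrib_right)

lemma supported_wact:
  assumes "\<And>x i. x \<in> set xs \<Longrightarrow> i \<in> B \<Longrightarrow> \<phi> x i \<in> supported B" "v \<in> supported B"
  shows "wact \<phi> xs v \<in> supported B"
  using assms by (induction xs) (simp_all add: supported_lin_ext)

lemma supported_rep:
  assumes "\<And>x i. x \<in> L \<Longrightarrow> i \<in> B \<Longrightarrow> \<phi> x i \<in> supported B" "a \<in> free_on L" "v \<in> supported B"
  shows "rep \<phi> a v \<in> supported B"
  unfolding rep_def lin_ext_def
  by (intro supported_sum supported_scale supported_wact) (use assms in \<open>auto simp: words_in_def\<close>)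

text \<open>The letters are moved across the inner product one at a time, which reverses their
  order. Adjointness of letters is assumed on \<open>B\<close> only, so every intermediate vector
  has to stay supported there.\<close>

lemma rep_adjoint:
  assumes "\<And>x i. x \<in> L \<Longrightarrow> i \<in> B \<Longrightarrow> \<phi> x i \<in> supported B"
    and "\<And>x i j. x \<in> L \<Longrightarrow> i \<in> B \<Longrightarrow> j \<in> B \<Longrightarrow>
      Poly_Mapping.lookup (\<phi> x i) j = cnj (Poly_Mapping.lookup (\<phi> (s x) j) i)"
    and "s ` L \<subseteq> L" "a \<in> free_on L" "u \<in> supported B" "v \<in> supported B"
  shows "ip (rep \<phi> a u) v = ip u (rep \<phi> (star_free s a) v)"
  using assms(4)
proof (induction rule: words_in_induct)
  case (add xs c a)
  have "ip (wact \<phi> xs u) v = ip u (wact \<phi> (rev (map s xs)) v)"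
    if "xs \<in> lists L" "v \<in> supported B" for v
    using that
  proof (induction xs arbitrary: v rule: list.induct)
    case (Cons x xs)
    have "wact \<phi> xs u \<in> supported B"
      using Cons.prems(1) by (intro supported_wact assms(1,5)) (auto simp: lists_eq_set)
    then have "ip (wact \<phi> (x # xs) u) v = ip (wact \<phi> xs u) (lin_ext (\<phi> (s x)) v)"
      using Cons.prems assms(2) by (auto intro: lin_ext_adjoint[of _ B])
    also have "\<dots> = ip u (wact \<phi> (rev (map s xs)) (lin_ext (\<phi> (s x)) v))"
      using Cons.prems assms(1,3) by (intro Cons.IH supported_lin_ext) auto
    finally show ?case by simp
  qed simp
  with add assms(6) show ?case
    by (simp add: rep_add rep_const_mult rep_wd ip_add_left ip_scale_left star_free_add
        star_free_const_mult star_free_wd ip_add_right ip_scale_right)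
qed simp

section \<open>Quotients by *-ideals\<close>

text \<open>Closure under negatives follows from closure under multiples, because
  \<open>const (-1)\<close> is an element of the free algebra.\<close>

lemma ideal_free_star_alg_iff:
  "ideal I (free_star_alg L s) \<longleftrightarrow>
    I \<subseteq> free_on L \<and> 0 \<in> I \<and> (\<forall>a\<in>I. \<forall>b\<in>I. a + b \<in> I) \<and>
    (\<forall>a\<in>I. \<forall>x\<in>free_on L. x * a \<in> I \<and> a * x \<in> I)"
  (is "?l \<longleftrightarrow> ?r")
proof
  assume ?l
  then interpret ideal I "free_star_alg L s" .
  show ?r
    using a_subset additive_subgroup.zero_closed[OF is_additive_subgroup]
      additive_subgroup.a_closed[OF is_additive_subgroup] I_l_closed I_r_closed
    by auto
next
  assume r: ?r
  interpret F: ring "free_star_alg L s" by (rule ring_free_star_alg)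
  have m: "- a \<in> I" if "a \<in> I" for a
  proof -
    have "const (-1) * a \<in> I" using r that by simp
    then show ?thesis by (simp add: const_minus)
  qed
  have a: "a_inv (free_star_alg L s) a = - a" if "a \<in> free_on L" for a
    using that F.minus_equality[of "- a" a] by (simp add: words_in_minus)
  show ?l
  proof (rule idealI)
    show "subgroup I (add_monoid (free_star_alg L s))"
      by (rule group.subgroupI[OF F.a_group]) (use r m a in \<open>auto simp: a_inv_def\<close>)
  qed (use r F.ring_axioms in auto)
qed

lemma star_free_const [simp]: "star_free s (const c) = const (cnj c)"
  using star_free_const_mult[of s c 1] by simp

text \<open>Common frame for \<open>Pol\<close> and \<open>Fun\<close>, which differ in the alphabet
  and in the relations only.\<close>

locale free_quotient =
  fixes L :: "'x set" and s :: "'x \<Rightarrow> 'x" and R :: "'x free set"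
  assumes s_image: "s ` L \<subseteq> L" and s_s: "\<And>x. s (s x) = x" and R_subset: "R \<subseteq> free_on L"
begin

abbreviation "F \<equiv> free_star_alg L s"

definition I :: "'x free set" where "I = star_ideal F R"

definition Q :: "'x free set star_alg" where "Q = quot_star_alg F I"

definition cls :: "'x free \<Rightarrow> 'x free set" where "cls a = I +>\<^bsub>F\<^esub> a"

lemma star_closed_F: "a \<in> free_on L \<Longrightarrow> star_free s a \<in> free_on L"
  by (rule free_on_star[OF _ s_image])

lemma star_star_F: "star_free s (star_free s a) = a"
  by (rule star_free_star_free[OF s_s])

lemma gens_subset: "R \<union> star_free s ` R \<subseteq> free_on L"
  using R_subset star_closed_F by blast

lemma ideal_I: "ideal I F"
  unfolding I_def star_ideal_def
  by (rule ring.genideal_ideal[OF ring_free_star_alg]) (use gens_subset in simp)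

lemma I_props: "I \<subseteq> free_on L" "0 \<in> I" "\<And>a b. a \<in> I \<Longrightarrow> b \<in> I \<Longrightarrow> a + b \<in> I"
  "\<And>a x. a \<in> I \<Longrightarrow> x \<in> free_on L \<Longrightarrow> x * a \<in> I"
  "\<And>a x. a \<in> I \<Longrightarrow> x \<in> free_on L \<Longrightarrow> a * x \<in> I"
  using ideal_I unfolding ideal_free_star_alg_iff by blast+

lemma I_const_mult: "a \<in> I \<Longrightarrow> const c * a \<in> I"
  by (rule I_props(4)) simp_all

lemma I_minus: "a \<in> I \<Longrightarrow> - a \<in> I"
  using I_const_mult[of a "-1"] by (simp add: const_minus)

lemma I_diff: "a \<in> I \<Longrightarrow> b \<in> I \<Longrightarrow> a - b \<in> I"
  using I_props(3)[of a "- b"] I_minus by simp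

lemma R_in_I: "a \<in> R \<Longrightarrow> a \<in> I"
  using ring.genideal_self[OF ring_free_star_alg, of "R \<union> star_free s ` R" L s] gens_subset
  unfolding I_def star_ideal_def by auto

text \<open>Acts as the induction principle for \<open>I\<close>: a property of its elements is
  proved by showing that it defines an ideal containing the generators.\<close>

lemma I_minimal:
  assumes "ideal J F" "R \<union> star_free s ` R \<subseteq> J"
  shows "I \<subseteq> J"
  using ring.genideal_minimal[OF ring_free_star_alg assms] unfolding I_def star_ideal_def by simp

text \<open>The involution exchanges left and right multiples and permutes the generating set, so
  the preimage of \<open>I\<close> under it is again a two-sided ideal containing the
  generators.\<close>

lemma I_star: "a \<in> I \<Longrightarrow> star_free s a \<in> I"
proof -
  assume a: "a \<in> I"
  have "I \<subseteq> {a \<in> free_on L. star_free s a \<in> I}"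
  proof (rule I_minimal)
    show "ideal {a \<in> free_on L. star_free s a \<in> I} F"
      unfolding ideal_free_star_alg_iff
      using I_props star_closed_F
      by (auto simp: words_in_add star_free_add star_free_mult free_on_mult)
    have "star_free s a \<in> I" if "a \<in> R" for a
      using ring.genideal_self[OF ring_free_star_alg, of "R \<union> star_free s ` R" L s] gens_subset that
      unfolding I_def star_ideal_def by auto
    then show "R \<union> star_free s ` R \<subseteq> {a \<in> free_on L. star_free s a \<in> I}"
      using gens_subset R_in_I by (auto simp: star_star_F)
  qed
  with a show ?thesis by blast
qed

lemma cls_eq: "cls a = (\<lambda>i. i + a) ` I"
  by (auto simp: cls_def a_r_coset_def r_coset_def)

lemma mem_cls: "b \<in> cls a \<longleftrightarrow> b - a \<in> I"
  by (auto simp: cls_eq intro!: image_eqI[of _ _ "b - a"])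

lemma self_in_cls: "a \<in> cls a"
  by (simp add: mem_cls I_props)

lemma cls_eq_iff: "cls a = cls b \<longleftrightarrow> a - b \<in> I"
proof
  assume "cls a = cls b"
  then show "a - b \<in> I" using self_in_cls[of a] by (simp add: mem_cls)
next
  assume ab: "a - b \<in> I"
  show "cls a = cls b"
  proof (rule Set.set_eqI)
    fix x
    have "x - a \<in> I \<Longrightarrow> x - b \<in> I" using I_props(3)[OF _ ab, of "x - a"] by simp
    moreover have "x - b \<in> I \<Longrightarrow> x - a \<in> I" using I_diff[OF _ ab, of "x - b"] by simp
    ultimately show "x \<in> cls a \<longleftrightarrow> x \<in> cls b" by (auto simp: mem_cls)
  qed
qed

lemma cls_0: "cls 0 = I"
  by (simp add: cls_eq)

lemma carrier_Q: "carrier Q = cls ` free_on L"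
  by (auto simp: Q_def quot_star_alg_def FactRing_def A_RCOSETS_defs RCOSETS_def cls_def a_r_coset_def)

lemma mult_Q:
  assumes "a \<in> free_on L" "b \<in> free_on L"
  shows "cls a \<otimes>\<^bsub>Q\<^esub> cls b = cls (a * b)"
  using ideal.rcoset_mult_add[OF ideal_I, of a b] assms
  by (simp add: Q_def quot_star_alg_def FactRing_def cls_def)

lemma add_Q:
  assumes "a \<in> free_on L" "b \<in> free_on L"
  shows "cls a \<oplus>\<^bsub>Q\<^esub> cls b = cls (a + b)"
  using ideal.a_rcos_sum[OF ideal_I, of a b] assms
  by (simp add: Q_def quot_star_alg_def FactRing_def cls_def)

lemma zero_Q: "\<zero>\<^bsub>Q\<^esub> = cls 0"
  by (simp add: Q_def quot_star_alg_def FactRing_def cls_0)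

lemma smult_Q:
  assumes "a \<in> free_on L"
  shows "c \<odot>\<^bsub>Q\<^esub> cls a = cls (const c * a)"
proof -
  have x: "cls (const c * x) = cls (const c * a)" if "x \<in> cls a" for x
    unfolding cls_eq_iff using that I_const_mult[of "x - a" c]
    by (simp add: mem_cls right_diff_distrib)
  \<comment> \<open>A scalar multiple of a coset is defined as a union of cosets; by
    \<open>x\<close> they all coincide, and at least one of them has to exist.\<close>
  have "cls a \<noteq> {}" using self_in_cls by blast
  then have "(\<Union>x\<in>cls a. cls (const c * x)) = cls (const c * a)"
    by (rule SUP_eq_const) (rule x)
  then show ?thesis unfolding Q_def quot_star_alg_def cls_def by simp
qed

lemma star_Q: "star Q (cls a) = cls (star_free s a)"
proof -
  have "star_free s ` cls a = cls (star_free s a)"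
  proof safe
    fix x assume "x \<in> cls a"
    then show "star_free s x \<in> cls (star_free s a)"
      using I_star[of "x - a"] by (simp add: mem_cls star_free_diff)
  next
    fix x assume "x \<in> cls (star_free s a)"
    then have "star_free s x \<in> cls a"
      using I_star[of "x - star_free s a"] by (simp add: mem_cls star_free_diff star_star_F)
    then show "x \<in> star_free s ` cls a" by (metis star_star_F imageI)
  qed
  then show ?thesis by (simp add: Q_def quot_star_alg_def)
qed

lemma cring_complex_ring: "cring complex_ring"
proof (rule cringI)
  show "abelian_group complex_ring"
  proof (rule abelian_groupI)
    fix x assume "x \<in> carrier complex_ring"
    show "\<exists>y\<in>carrier complex_ring. y \<oplus>\<^bsub>complex_ring\<^esub> x = \<zero>\<^bsub>complex_ring\<^esub>"
      by (rule bexI[of _ "- x"]) (simp_all add: complex_ring_def)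
  qed (simp_all add: complex_ring_def)
  show "comm_monoid complex_ring"
    by (rule comm_monoidI) (simp_all add: complex_ring_def)
qed (simp_all add: complex_ring_def distrib_right)

text \<open>Covers the quotient itself (\<open>C = free_on L\<close>) as well as non-unital subalgebras of it.\<close>

lemma star_algebra_sub:
  assumes "C \<subseteq> free_on L" "0 \<in> C" "\<And>a b. a \<in> C \<Longrightarrow> b \<in> C \<Longrightarrow> a + b \<in> C"
    and "\<And>c a. a \<in> C \<Longrightarrow> const c * a \<in> C" "\<And>a b. a \<in> C \<Longrightarrow> b \<in> C \<Longrightarrow> a * b \<in> C"
    and "\<And>a. a \<in> C \<Longrightarrow> star_free s a \<in> C"
  shows "star_algebra (Q\<lparr>carrier := cls ` C\<rparr>)"
proof -
  let ?A = "Q\<lparr>carrier := cls ` C\<rparr>"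
  have C: "a \<in> free_on L" if "a \<in> C" for a using assms(1) that by blast
  have minus: "- a \<in> C" if "a \<in> C" for a
    using assms(4)[OF that, of "-1"] by (simp add: const_minus)
  note ops = C add_Q mult_Q smult_Q star_Q zero_Q free_on_mult words_in_add words_in_const_mult star_closed_F
  have "abelian_group ?A"
  proof (rule abelian_groupI)
    fix x assume "x \<in> carrier ?A"
    then obtain a where "a \<in> C" "x = cls a" by auto
    then show "\<exists>y\<in>carrier ?A. y \<oplus>\<^bsub>?A\<^esub> x = \<zero>\<^bsub>?A\<^esub>"
      by (intro bexI[of _ "cls (- a)"]) (auto simp: ops minus)
  qed (auto simp: ops assms ac_simps)
  then have "Module.module complex_ring ?A"
    by (intro moduleI cring_complex_ring)
      (auto simp: ops assms complex_ring_def const_add const_times distrib_left distrib_right mult.assoc)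
  moreover have "star_algebra_axioms ?A"
  proof
    fix c x assume "x \<in> carrier ?A"
    then obtain a where "a \<in> C" "x = cls a" by auto
    then show "star ?A (c \<odot>\<^bsub>?A\<^esub> x) = cnj c \<odot>\<^bsub>?A\<^esub> star ?A x"
      by (simp add: ops star_free_const_mult del: star_free_const)
  next
    fix c x y assume "x \<in> carrier ?A" "y \<in> carrier ?A"
    then obtain a b where "a \<in> C" "x = cls a" "b \<in> C" "y = cls b" by auto
    then show "x \<otimes>\<^bsub>?A\<^esub> (c \<odot>\<^bsub>?A\<^esub> y) = c \<odot>\<^bsub>?A\<^esub> (x \<otimes>\<^bsub>?A\<^esub> y)"
      by (simp add: ops const_left_commute)
  qed (auto simp: ops assms distrib_left distrib_right mult.assoc star_star_F star_free_add
        star_free_mult)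
  ultimately show ?thesis by (rule star_algebra.intro)
qed

lemma star_algebra_Q: "star_algebra Q"
proof -
  have "star_algebra (Q\<lparr>carrier := cls ` free_on L\<rparr>)"
    by (rule star_algebra_sub) (auto simp: free_on_mult words_in_add words_in_const_mult star_closed_F)
  then show ?thesis by (simp flip: carrier_Q)
qed

end

lemma rep_const: "rep \<phi> (const c) v = scale c v"
  using rep_const_mult[of \<phi> c 1 v] by simp

text \<open>The relations are demanded on basis vectors and for \<open>R\<close> alone; linearity
  and adjointness extend them to all of \<open>supported B\<close> and to the starred
  relations.\<close>

locale free_quotient_rep = free_quotient L s R
  for L :: "'x set" and s R +
  fixes \<phi> :: "'x \<Rightarrow> 'i \<Rightarrow> ('i \<Rightarrow>\<^sub>0 complex)" and B :: "'i set"
  assumes \<phi>_supported: "\<And>x i. x \<in> L \<Longrightarrow> i \<in> B \<Longrightarrow> \<phi> x i \<in> supported B"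
    and \<phi>_adjoint: "\<And>x i j. x \<in> L \<Longrightarrow> i \<in> B \<Longrightarrow> j \<in> B \<Longrightarrow>
      Poly_Mapping.lookup (\<phi> x i) j = cnj (Poly_Mapping.lookup (\<phi> (s x) j) i)"
    and rels: "\<And>a i. a \<in> R \<Longrightarrow> i \<in> B \<Longrightarrow> rep \<phi> a (Poly_Mapping.single i 1) = 0"
begin

lemma rep_supported: "a \<in> free_on L \<Longrightarrow> v \<in> supported B \<Longrightarrow> rep \<phi> a v \<in> supported B"
  by (rule supported_rep) (use \<phi>_supported in auto)

lemma rep_star_free:
  "a \<in> free_on L \<Longrightarrow> u \<in> supported B \<Longrightarrow> v \<in> supported B \<Longrightarrow>
    ip (rep \<phi> a u) v = ip u (rep \<phi> (star_free s a) v)"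
  by (rule rep_adjoint) (use \<phi>_supported \<phi>_adjoint s_image in auto)

lemma rep_R: "a \<in> R \<Longrightarrow> v \<in> supported B \<Longrightarrow> rep \<phi> a v = 0"
proof -
  assume "a \<in> R" "v \<in> supported B"
  then have "rep \<phi> a v = lin_ext (\<lambda>_. 0) v"
    by (intro lin_ext_eqI rep_add_right rep_scale_right rels) (auto simp: supported_def)
  then show ?thesis by (simp add: lin_ext_def)
qed

lemma rep_I:
  assumes "a \<in> I" "v \<in> supported B"
  shows "rep \<phi> a v = 0"
proof -
  let ?K = "{a \<in> free_on L. \<forall>v\<in>supported B. rep \<phi> a v = 0}"
  have "I \<subseteq> ?K"
  proof (rule I_minimal)
    show "ideal ?K F"
      unfolding ideal_free_star_alg_iff
      using rep_supported by (auto simp: words_in_add free_on_mult rep_add rep_mult)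
    have "rep \<phi> (star_free s a) v = 0" if "a \<in> R" "v \<in> supported B" for a v
    proof -
      let ?w = "rep \<phi> (star_free s a) v"
      have a: "a \<in> free_on L" using that R_subset by blast
      have w: "?w \<in> supported B" using rep_supported star_closed_F a that by blast
      \<comment> \<open>The squared norm of the starred relation applied to \<open>v\<close>
        contains the relation itself, applied to \<open>?w\<close>, and that vanishes.\<close>
      have "ip ?w ?w = ip (rep \<phi> a ?w) v"
        using rep_star_free[OF a w that(2)] by simp
      then show ?thesis using rep_R[OF that(1) w] by (simp add: ip_self_eq_0)
    qed
    then show "R \<union> star_free s ` R \<subseteq> ?K"
      using gens_subset rep_R by auto
  qed
  with assms show ?thesis by blast
qed

text \<open>Has the same shape as \<open>T0\<close>, so that \<open>T0 q n m\<close> is literally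
  the instance for \<open>Pol\<close>.\<close>

definition T :: "'x free set \<Rightarrow> ('i \<Rightarrow>\<^sub>0 complex) \<Rightarrow> ('i \<Rightarrow>\<^sub>0 complex)" where
  "T X v = the_elem ((\<lambda>a. rep \<phi> a v) ` X)"

lemma T_cls:
  assumes "v \<in> supported B"
  shows "T (cls a) v = rep \<phi> a v"
proof -
  have "rep \<phi> b v = rep \<phi> a v" if "b \<in> cls a" for b
    using rep_I[of "b - a" v] that assms by (simp add: mem_cls rep_diff)
  then have "(\<lambda>a. rep \<phi> a v) ` cls a = {rep \<phi> a v}" using self_in_cls[of a] by blast
  then show ?thesis by (simp add: T_def)
qed

text \<open>The operators do not depend on the carrier, so a single \<open>T\<close> represents both
  \<open>Fun\<close> and its subalgebra \<open>D\<close>.\<close>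

lemma star_representation_sub:
  assumes "star_algebra (Q\<lparr>carrier := cls ` C\<rparr>)" "C \<subseteq> free_on L"
  shows "star_representation (Q\<lparr>carrier := cls ` C\<rparr>) (supported B) T"
proof -
  have C: "a \<in> free_on L" if "a \<in> C" for a using assms(2) that by blast
  show ?thesis
    by (rule star_representation.intro[OF assms(1)], unfold star_representation_axioms_def)
      (auto simp: C T_cls add_Q mult_Q smult_Q star_Q rep_supported supported_add supported_scale
        rep_add rep_add_right rep_scale_right rep_const rep_mult rep_star_free)
qed

lemma star_representation_Q: "star_representation Q (supported B) T"
  using star_representation_sub[of "free_on L"] star_algebra_Q by (simp flip: carrier_Q)

end

section \<open>The representation on generators\<close>

lemma gen_star_gen_star [simp]: "gen_star (gen_star x) = x"
  by (cases x) auto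

lemma gen_star_pol_gens: "gen_star ` pol_gens n m \<subseteq> pol_gens n m"
  by (auto simp: pol_gens_def)

lemma gen_star_fun_gens: "gen_star ` fun_gens q n m \<subseteq> fun_gens q n m"
proof -
  have "(\<lambda>x. cnj (g x)) \<in> fin_funs q" if "g \<in> fin_funs q" for g
    using that by (simp add: fin_funs_def)
  then show ?thesis using gen_star_pol_gens[of n m] by (auto simp: fun_gens_def)
qed

lemma pol_gens_subset_fun_gens: "pol_gens n m \<subseteq> fun_gens q n m"
  by (simp add: fun_gens_def)

locale quantum_cone =
  fixes q :: real and n m :: nat
  assumes q_pos: "0 < q" and q_less_1: "q < 1" and n_pos: "1 \<le> n" and m_ge_2: "2 \<le> m"
begin

lemma q_nonzero [simp]: "q \<noteq> 0"
  using q_pos by simp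

lemma powi_le_1_iff: "q powi z \<le> 1 \<longleftrightarrow> 0 \<le> z"
proof
  assume "0 \<le> z"
  then show "q powi z \<le> 1" using q_pos q_less_1 by (simp add: power_int_def power_le_one)
next
  assume le: "q powi z \<le> 1"
  show "0 \<le> z"
  proof (rule ccontr)
    assume "\<not> 0 \<le> z"
    moreover have "1 < inverse q" using q_pos q_less_1 by (simp add: one_less_inverse)
    ultimately have "1 < inverse q ^ nat (- z)" by (intro one_less_power) auto
    then have "1 < q powi z" using \<open>\<not> 0 \<le> z\<close> by (simp add: power_int_def)
    with le show False by simp
  qed
qed

lemma powi_inj: "q powi y = q powi z \<longleftrightarrow> y = z"
proof
  assume "q powi y = q powi z"
  then have "q powi (y - z) \<le> 1" "q powi (z - y) \<le> 1"
    by (simp_all add: power_int_diff)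
  then show "y = z" by (simp add: powi_le_1_iff)
qed simp

text \<open>The signature of the form defining the cone. With these signs the two cases of \<xi>_j,
  and the two families of commutator relations, become one.\<close>

definition eps :: "nat \<Rightarrow> real" where
  "eps k = (if k \<le> n then -1 else 1)"

lemma eps_square [simp]: "eps k * eps k = 1" "eps k * (eps k * x) = x"
  by (simp_all add: eps_def)

text \<open>
  The coefficients of $t_j$ and $t_j^*$ on the label \<open>i\<close> are $q^{S_j}$ times \<open>amp j (i j)\<close> and
  \<open>amp j (i j + 1)\<close>. As $t_N$ acts diagonally, \<open>shift N\<close> does nothing and \<open>amp N\<close> is constant, which
  lets one formula cover all \<open>j\<close>.
\<close>

definition amp :: "nat \<Rightarrow> int \<Rightarrow> real" where
  "amp j z =
    (if j = 1 then q powi (z - 1)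
     else if j \<le> n then sqrt (q powi (2 * (z - 1)) - 1)
     else if j < n + m then sqrt (1 - q powi (2 * (z - 1)))
     else 1)"

definition shift :: "nat \<Rightarrow> int \<Rightarrow> (nat \<Rightarrow> int) \<Rightarrow> (nat \<Rightarrow> int)" where
  "shift j z i = (if j < n + m then i(j := i j + z) else i)"

text \<open>Replaces the dummy value of \<open>T0_gen\<close> on \<open>Fin g\<close> by the
  intended one: multiplication by g at the eigenvalue q^(2 S_{n+1}) of \<xi>_{n+1}.\<close>

definition act :: "gen \<Rightarrow> (nat \<Rightarrow> int) \<Rightarrow> ((nat \<Rightarrow> int) \<Rightarrow>\<^sub>0 complex)" where
  "act x i = (case x of Fin g \<Rightarrow> Poly_Mapping.single i (g (q powi (2 * partial_sum i (n + 1))))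
                      | _ \<Rightarrow> T0_gen q n m x i)"

lemma partial_sum_1 [simp]: "partial_sum i (Suc 0) = 0"
  by (simp add: partial_sum_def)

lemma partial_sum_Suc: "1 \<le> k \<Longrightarrow> partial_sum i (Suc k) = partial_sum i k + i k"
  by (simp add: partial_sum_def)

lemma act_Gen:
  "1 \<le> j \<Longrightarrow> act (Gen j) i =
    Poly_Mapping.single (shift j (-1) i) (of_real (q powi partial_sum i j * amp j (i j)))"
  using n_pos m_ge_2 by (auto simp: act_def shift_def amp_def)

lemma act_GenStar:
  "1 \<le> j \<Longrightarrow> act (GenStar j) i =
    Poly_Mapping.single (shift j 1 i) (of_real (q powi partial_sum i j * amp j (i j + 1)))"
  using n_pos m_ge_2 by (auto simp: act_def shift_def amp_def)

lemma act_Fin: "act (Fin g) i = Poly_Mapping.single i (g (q powi (2 * partial_sum i (n + 1))))"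
  by (simp add: act_def)

text \<open>For j = N nothing is shifted; the bound \<open>k \<le> n + m\<close> keeps
  \<open>j < k\<close> from holding in that case.\<close>

lemma partial_sum_shift:
  assumes "1 \<le> j" "k \<le> n + m"
  shows "partial_sum (shift j z i) k = partial_sum i k + (if j < k then z else 0)"
proof (cases "j < k")
  case True
  then have "j < n + m" using assms by simp
  have "partial_sum (shift j z i) k = (\<Sum>l=1..<k. i l + (if l = j then z else 0))"
    unfolding partial_sum_def using \<open>j < n + m\<close> by (intro sum.cong) (auto simp: shift_def)
  also have "\<dots> = partial_sum i k + z"
    using True assms(1) by (simp add: sum.distrib partial_sum_def)
  finally show ?thesis using True by simp
next
  case False
  then show ?thesis by (auto simp: partial_sum_def shift_def intro!: sum.cong)
qed

lemma shift_other: "j \<noteq> k \<Longrightarrow> shift j z i k = i k"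
  by (simp add: shift_def)

lemma shift_commute: "j \<noteq> k \<Longrightarrow> shift j y (shift k z i) = shift k z (shift j y i)"
  by (auto simp: shift_def fun_upd_twist)

lemma shift_shift [simp]: "shift j y (shift j z i) = shift j (z + y) i"
  by (auto simp: shift_def)

lemma shift_0 [simp]: "shift j 0 i = i"
  by (simp add: shift_def)

lemma amp_shift: "j \<le> n + m \<Longrightarrow> amp j (shift j z i j + y) = amp j (i j + z + y)"
  using n_pos m_ge_2 by (auto simp: shift_def amp_def)

lemma powi_double: "q powi (2 * z) = (q powi z)\<^sup>2"
  by (simp add: power_int_power' mult.commute flip: power_int_power)

text \<open>The eigenvalues of the \<xi>_k. At k = 1 the formula q^(2 S_1) would give 1, while
  \<xi>_1 = 0 on the cone; at k = N + 1 the sum is empty. With both values set to 0 a single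
  recursion is valid for all k from 1 to N.\<close>

definition xival :: "nat \<Rightarrow> (nat \<Rightarrow> int) \<Rightarrow> real" where
  "xival k i = (if k \<le> 1 \<or> n + m < k then 0 else q powi (2 * partial_sum i k))"

lemma idx_nonpos: "i \<in> idx n m \<Longrightarrow> 1 < k \<Longrightarrow> k \<le> n \<Longrightarrow> i k \<le> 0"
  by (simp add: idx_def)

lemma idx_pos: "i \<in> idx n m \<Longrightarrow> n < k \<Longrightarrow> k < n + m \<Longrightarrow> 1 \<le> i k"
  by (simp add: idx_def)

text \<open>The hypotheses keep the radicand nonnegative, where squaring undoes \<open>sqrt\<close>.
  For labels in \<open>idx n m\<close> they hold at \<open>z = i k\<close> as well as at
  \<open>z = i k + 1\<close>.\<close>

lemma amp_square:
  assumes "1 \<le> k" "1 < k \<Longrightarrow> k \<le> n \<Longrightarrow> z \<le> 1" "n < k \<Longrightarrow> k < n + m \<Longrightarrow> 1 \<le> z"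
  shows "(amp k z)\<^sup>2 =
    (if k = 1 then q powi (2 * (z - 1))
     else if k \<le> n then q powi (2 * (z - 1)) - 1
     else if k < n + m then 1 - q powi (2 * (z - 1)) else 1)"
proof -
  have "1 \<le> q powi (2 * (z - 1))" if "z \<le> 1"
    using powi_le_1_iff[of "2 * (z - 1)"] that by (cases "z = 1") auto
  moreover have "q powi (2 * (z - 1)) \<le> 1" if "1 \<le> z"
    using that by (simp add: powi_le_1_iff)
  moreover have "(q powi (z - 1))\<^sup>2 = q powi (2 * (z - 1))"
    by (rule powi_double[symmetric])
  ultimately show ?thesis using assms n_pos by (auto simp: amp_def)
qed

text \<open>The left side is the eigenvalue of \<open>t k * ts k\<close>: the step up and the step
  back down carry the same amplitude. Since S_k + i_k = S_{k+1}, it is a difference of consecutive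
  eigenvalues.\<close>

lemma xival_tts:
  assumes "k \<in> {1..n+m}" "i \<in> idx n m"
  shows "q powi (2 * partial_sum i k) * (amp k (i k + 1))\<^sup>2 = eps k * (xival k i - xival (k + 1) i)"
proof -
  have "(amp k (i k + 1))\<^sup>2 = (if k = 1 then q powi (2 * i k)
     else if k \<le> n then q powi (2 * i k) - 1
     else if k < n + m then 1 - q powi (2 * i k) else 1)"
    using assms(1) idx_nonpos[OF assms(2), of k] idx_pos[OF assms(2), of k] by (subst amp_square) auto
  moreover have "q powi (2 * partial_sum i (k + 1)) = q powi (2 * partial_sum i k) * q powi (2 * i k)"
    using assms by (simp add: partial_sum_Suc distrib_left power_int_add)
  ultimately show ?thesis
    using assms n_pos m_ge_2 by (auto simp: xival_def eps_def algebra_simps)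
qed

text \<open>Here the step down comes first, so the amplitude is read one unit lower; this is the
  origin of the factor q^-2.\<close>

lemma xival_tst:
  assumes "k \<in> {1..n+m}" "i \<in> idx n m"
  shows "q powi (2 * partial_sum i k) * (amp k (i k))\<^sup>2 = eps k * (xival k i - q powi -2 * xival (k + 1) i)"
proof -
  have "(amp k (i k))\<^sup>2 = (if k = 1 then q powi (2 * (i k - 1))
     else if k \<le> n then q powi (2 * (i k - 1)) - 1
     else if k < n + m then 1 - q powi (2 * (i k - 1)) else 1)"
    using assms(1) idx_nonpos[OF assms(2), of k] idx_pos[OF assms(2), of k] by (subst amp_square) auto
  moreover have "q powi (2 * partial_sum i (k + 1)) = q powi (2 * partial_sum i k) * q powi (2 * i k)"
    using assms by (simp add: partial_sum_Suc distrib_left power_int_add)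
  moreover have "q powi (2 * (i k - 1)) = q powi -2 * q powi (2 * i k)"
    by (simp add: right_diff_distrib flip: power_int_add)
  ultimately show ?thesis
    using assms n_pos m_ge_2 by (auto simp: xival_def eps_def algebra_simps)
qed

abbreviation bv :: "(nat \<Rightarrow> int) \<Rightarrow> ((nat \<Rightarrow> int) \<Rightarrow>\<^sub>0 complex)" where
  "bv i \<equiv> Poly_Mapping.single i 1"

abbreviation R :: "gen free \<Rightarrow> ((nat \<Rightarrow> int) \<Rightarrow>\<^sub>0 complex) \<Rightarrow> ((nat \<Rightarrow> int) \<Rightarrow>\<^sub>0 complex)" where
  "R \<equiv> rep act"

lemma R_single: "R a (Poly_Mapping.single i c) = scale c (R a (bv i))"
  using rep_scale_right[of act a c "bv i"] by simp

lemma R_tts: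
  assumes "k \<in> {1..n+m}" "i \<in> idx n m"
  shows "R (t k * ts k) (bv i) = Poly_Mapping.single i (of_real (eps k * (xival k i - xival (k + 1) i)))"
  unfolding xival_tts[OF assms, symmetric] powi_double power2_eq_square
  using assms amp_shift[of k 1 i 0]
  by (simp add: rep_mult rep_letter act_Gen act_GenStar partial_sum_shift algebra_simps)

lemma R_tst:
  assumes "k \<in> {1..n+m}" "i \<in> idx n m"
  shows "R (ts k * t k) (bv i) =
    Poly_Mapping.single i (of_real (eps k * (xival k i - q powi -2 * xival (k + 1) i)))"
  unfolding xival_tst[OF assms, symmetric] powi_double power2_eq_square
  using assms amp_shift[of k "-1" i 1]
  by (simp add: rep_mult rep_letter act_Gen act_GenStar partial_sum_shift algebra_simps)

lemma xi_step:
  assumes "k \<in> {1..n+m}"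
  shows "xi n m k = rconst (eps k) * (t k * ts k) + xi n m (k + 1)"
proof (cases "n < k")
  case True
  then show ?thesis using assms by (simp add: xi_def eps_def sum.atLeast_Suc_atMost)
next
  case False
  then show ?thesis using assms
    by (cases "k = n") (simp_all add: xi_def eps_def const_minus sum.atLeast_Suc_atMost[of k])
qed

lemma xi_beyond [simp]: "xi n m (Suc (n + m)) = 0"
  by (simp add: xi_def)

text \<open>Starting from the empty sum \<xi>_{N+1}, the differences in \<open>R_tts\<close>
  telescope. At k = 1 the total is 0, which is the relation of the cone.\<close>

lemma R_xi:
  assumes "1 \<le> k" "k \<le> n + m + 1" "i \<in> idx n m"
  shows "R (xi n m k) (bv i) = Poly_Mapping.single i (of_real (xival k i))"
  using assms(2,1)
proof (induction k rule: inc_induct)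
  case base
  show ?case by (simp add: xival_def)
next
  case (step k)
  then have k: "k \<in> {1..n+m}" by simp
  have "R (xi n m k) (bv i) =
      Poly_Mapping.single i (of_real (eps k) * of_real (eps k * (xival k i - xival (k + 1) i)) + of_real (xival (k + 1) i))"
    unfolding xi_step[OF k] rep_add rep_const_mult R_tts[OF k assms(3)] scale_single single_add
    using step by simp
  also have "of_real (eps k) * of_real (eps k * (xival k i - xival (k + 1) i)) + complex_of_real (xival (k + 1) i)
    = of_real (xival k i)"
    by (simp flip: of_real_mult)
  finally show ?case .
qed

text \<open>Brings the relations into the form in which the eigenvalues \<open>xival\<close> apply
  directly; the last one says that \<xi>_1 vanishes.\<close>

lemma pol_rels_eq:
  "pol_rels q n m =
     {t i * t j - rconst q * t j * t i | i j. 1 \<le> i \<and> i < j \<and> j \<le> n + m}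
   \<union> {t i * ts j - rconst q * ts j * t i | i j. i \<in> {1..n+m} \<and> j \<in> {1..n+m} \<and> i \<noteq> j}
   \<union> {t i * ts i - (ts i * t i + rconst (eps i * (q powi -2 - 1)) * xi n m (i + 1)) | i. i \<in> {1..n+m}}
   \<union> {xi n m 1}"
proof -
  have 1: "{t i * ts i - (ts i * t i + rconst (eps i * (q powi -2 - 1)) * xi n m (i + 1)) | i. i \<in> {1..n+m}}
    = {t i * ts i - (ts i * t i + rconst (eps i * (q powi -2 - 1)) * xi n m (i + 1)) | i. n < i \<and> i \<le> n + m}
    \<union> {t i * ts i - (ts i * t i + rconst (eps i * (q powi -2 - 1)) * xi n m (i + 1)) | i. 1 \<le> i \<and> i \<le> n}"
    by auto (metis One_nat_def Suc_leI le_add1 le_eq_less_or_eq le_less_trans less_imp_le_nat linorder_not_le n_pos trans_le_add1)+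
  have 2: "rconst (eps i * (q powi -2 - 1)) * xi n m (i + 1) =
      rconst (q powi -2 - 1) * (\<Sum>k=i+1..n+m. t k * ts k)" if "n < i" for i
    using that by (simp add: xi_def eps_def)
  have 3: "rconst (eps i * (q powi -2 - 1)) * xi n m (i + 1) =
      rconst (q powi -2 - 1) * (\<Sum>k=i+1..n. t k * ts k)
        - rconst (q powi -2 - 1) * (\<Sum>k=n+1..n+m. t k * ts k)" if "i \<le> n" for i
  proof -
    have e: "rconst (eps i * (q powi -2 - 1)) = - rconst (q powi -2 - 1)"
      using that by (simp only: eps_def if_True mult_minus1 of_real_minus const_minus)
    \<comment> \<open>At i = n the index i + 1 falls into the other branch of \<open>xi\<close>; the
      formulas agree because the first sum is then empty.\<close>
    have x: "xi n m (i + 1) = - (\<Sum>k=i+1..n. t k * ts k) + (\<Sum>k=n+1..n+m. t k * ts k)"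
      using that by (cases "i = n") (simp_all add: xi_def)
    show ?thesis unfolding e x by (simp add: algebra_simps)
  qed
  have 4: "xi n m 1 = - (\<Sum>k=1..n. t k * ts k) + (\<Sum>k=n+1..n+m. t k * ts k)"
    using n_pos by (simp add: xi_def)
  have 5: "{t i * ts i - (ts i * t i + rconst (eps i * (q powi -2 - 1)) * xi n m (i + 1)) | i. n < i \<and> i \<le> n + m}
    = {t i * ts i - (ts i * t i + rconst (q powi -2 - 1) * (\<Sum>k=i+1..n+m. t k * ts k)) | i. n < i \<and> i \<le> n + m}"
    unfolding setcompr_eq_image by (rule image_cong) (simp_all only: mem_Collect_eq 2)
  have 6: "{t i * ts i - (ts i * t i + rconst (eps i * (q powi -2 - 1)) * xi n m (i + 1)) | i. 1 \<le> i \<and> i \<le> n}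
    = {t i * ts i - (ts i * t i + rconst (q powi -2 - 1) * (\<Sum>k=i+1..n. t k * ts k)
        - rconst (q powi -2 - 1) * (\<Sum>k=n+1..n+m. t k * ts k)) | i. 1 \<le> i \<and> i \<le> n}"
    unfolding setcompr_eq_image by (rule image_cong) (simp_all only: mem_Collect_eq 3 add_diff_eq)
  show ?thesis unfolding pol_rels_def 1 4 5 6 by (simp only: Un_assoc)
qed

text \<open>Both orders move the label alike and with the same amplitudes. The factor arises because
  \<open>t i\<close> lowers S_j by 1, whereas \<open>t j\<close> leaves S_i unchanged.\<close>

lemma R_t_t:
  assumes "1 \<le> i" "i < j" "j \<le> n + m"
  shows "R (t i * t j - rconst q * t j * t i) (bv l) = 0"
proof -
  have "q powi (partial_sum l j) = q * q powi (partial_sum l j - 1)"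
    using power_int_add_1'[of q "partial_sum l j - 1"] by simp
  then show ?thesis using assms
    by (simp add: rep_diff rep_mult mult.assoc rep_const rep_letter act_Gen partial_sum_shift
        shift_other shift_commute[of i j] mult_ac flip: of_real_mult)
qed

text \<open>For i < j the factor comes from \<open>t i\<close> lowering S_j, for i > j from
  \<open>ts j\<close> raising S_i; this is why one relation covers both orders.\<close>

lemma R_t_ts:
  assumes "i \<in> {1..n+m}" "j \<in> {1..n+m}" "i \<noteq> j"
  shows "R (t i * ts j - rconst q * ts j * t i) (bv l) = 0"
proof -
  have "q powi (partial_sum l j) = q * q powi (partial_sum l j - 1)"
    using power_int_add_1'[of q "partial_sum l j - 1"] by simp
  moreover have "q powi (partial_sum l i + 1) = q * q powi (partial_sum l i)"
    using power_int_add_1'[of q "partial_sum l i"] by simp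
  ultimately show ?thesis using assms
    by (cases "i < j") (simp_all add: rep_diff rep_mult mult.assoc rep_const rep_letter act_Gen act_GenStar
        partial_sum_shift shift_other shift_commute[of i j] mult_ac flip: of_real_mult)
qed

lemma R_pol_rels:
  assumes "a \<in> pol_rels q n m" "l \<in> idx n m"
  shows "R a (bv l) = 0"
proof -
  have "R (t i * ts i - (ts i * t i + rconst (eps i * (q powi -2 - 1)) * xi n m (i + 1))) (bv l) = 0"
    if i: "i \<in> {1..n+m}" for i
  proof -
    have "R (t i * ts i - (ts i * t i + rconst (eps i * (q powi -2 - 1)) * xi n m (i + 1))) (bv l) =
      Poly_Mapping.single l (of_real (eps i * (xival i l - xival (i + 1) l) -
        (eps i * (xival i l - q powi -2 * xival (i + 1) l) + eps i * (q powi -2 - 1) * xival (i + 1) l)))"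
      unfolding rep_diff rep_add rep_const_mult R_tts[OF i assms(2)] R_tst[OF i assms(2)] of_real_diff of_real_add
        of_real_mult[of "eps i * (q powi -2 - 1)"]
      using i assms(2) by (simp only: R_xi single_diff single_add scale_single) (simp add: R_xi)
    then show ?thesis by (simp add: algebra_simps)
  qed
  moreover have "R (xi n m 1) (bv l) = 0"
    using R_xi[of 1 l] assms(2) by (simp add: xival_def)
  ultimately show ?thesis
    using assms(1) R_t_t R_t_ts unfolding pol_rels_eq by (elim UnE CollectE exE conjE singletonE) (simp_all only:)
qed

lemma fin_funs_scale:
  assumes "g \<in> fin_funs q"
  shows "(\<lambda>x. g (q powi (2 * z) * x)) \<in> fin_funs q"
proof -
  let ?S = "{x. g x \<noteq> 0}" and ?S' = "{x. g (q powi (2 * z) * x) \<noteq> 0}"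
  have S: "?S' = (\<lambda>x. q powi (2 * (- z)) * x) ` ?S"
  proof safe
    fix x assume "g (q powi (2 * z) * x) \<noteq> 0"
    then show "x \<in> (\<lambda>x. q powi (2 * (- z)) * x) ` ?S"
      by (intro image_eqI[of _ _ "q powi (2 * z) * x"]) (simp_all add: power_int_minus)
  qed (simp add: power_int_minus flip: mult.assoc)
  have "q powi (2 * (- z)) * q powi (2 * k) \<in> (\<lambda>k. q powi (2 * k)) ` UNIV" for k
    by (rule image_eqI[of _ _ "k - z"]) (simp_all add: right_diff_distrib flip: power_int_add)
  with assms show ?thesis unfolding fin_funs_def mem_Collect_eq S by blast
qed

lemma fin_funs_closed:
  assumes "g \<in> fin_funs q"
  shows "(\<lambda>x. c * g x) \<in> fin_funs q" "(\<lambda>x. h x * g x) \<in> fin_funs q"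
    "(\<lambda>x. g x * h x) \<in> fin_funs q"
    "(\<lambda>x. g (q\<^sup>2 * x)) \<in> fin_funs q" "(\<lambda>x. g (q powi -2 * x)) \<in> fin_funs q"
proof -
  have "f \<in> fin_funs q" if "\<And>x. g x = 0 \<Longrightarrow> f x = 0" for f
  proof -
    have "{x. f x \<noteq> 0} \<subseteq> {x. g x \<noteq> 0}" using that by auto
    then show ?thesis using assms finite_subset unfolding fin_funs_def by blast
  qed
  then show "(\<lambda>x. c * g x) \<in> fin_funs q" "(\<lambda>x. h x * g x) \<in> fin_funs q" "(\<lambda>x. g x * h x) \<in> fin_funs q"
    by simp_all
  show "(\<lambda>x. g (q\<^sup>2 * x)) \<in> fin_funs q" "(\<lambda>x. g (q powi -2 * x)) \<in> fin_funs q"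
    using fin_funs_scale[OF assms, of 1] fin_funs_scale[OF assms, of "-1"] by simp_all
qed

lemma fin_funs_add:
  assumes "g \<in> fin_funs q" "h \<in> fin_funs q"
  shows "(\<lambda>x. g x + h x) \<in> fin_funs q"
proof -
  have "{x. g x + h x \<noteq> 0} \<subseteq> {x. g x \<noteq> 0} \<union> {x. h x \<noteq> 0}" by auto
  then show ?thesis using assms finite_subset unfolding fin_funs_def by blast
qed

lemma fin_funs_0 [simp]: "(\<lambda>_. 0) \<in> fin_funs q"
  by (simp add: fin_funs_def)

lemma R_fin: "R (fin g) (bv i) = Poly_Mapping.single i (g (q powi (2 * partial_sum i (n + 1))))"
  by (simp add: rep_letter act_Fin)

lemma R_fun_rels:
  assumes "a \<in> fun_rels q n m" "l \<in> idx n m"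
  shows "R a (bv l) = 0"
proof -
  let ?S = "partial_sum l (Suc n)"
  have x: "R (xi n m k) (Poly_Mapping.single l c) = Poly_Mapping.single l (of_real (xival k l) * c)"
    if "k \<in> {1..n+m}" for k c
    using that assms(2) by (subst R_single) (simp add: R_xi mult.commute)
  have e: "xival (Suc n) l = q powi (2 * ?S)" "n + 1 \<in> {1..n+m}"
    using n_pos m_ge_2 by (simp_all add: xival_def)
  \<comment> \<open>For j \<le> n the sum S_{n+1} is lower by 1 after \<open>t j\<close> and higher
    by 1 after \<open>ts j\<close>; rescaling the argument of g compensates for this.\<close>
  have sh: "q\<^sup>2 * q powi (2 * (?S - 1)) = q powi (2 * ?S)" "q powi -2 * q powi (2 * (?S + 1)) = q powi (2 * ?S)"
    by (simp_all add: right_diff_distrib distrib_left power_int_diff power_int_add power_int_minus)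
  note simps = rep_diff rep_add rep_mult rep_const rep_letter act_Fin single_add single_diff
    act_Gen act_GenStar partial_sum_shift
  note assms(1)[unfolded fun_rels_def Un_iff]
  then consider "a \<in> pol_rels q n m"
    | g h where "a = fin (\<lambda>x. g x + h x) - (fin g + fin h)"
    | c g where "a = fin (\<lambda>x. c * g x) - const c * fin g"
    | g h where "a = fin (\<lambda>x. g x * h x) - fin g * fin h"
    | g where "a = fin (\<lambda>x. complex_of_real x * g x) - xi n m (n+1) * fin g"
    | j g where "a = t j * fin g - fin (\<lambda>x. g (q\<^sup>2 * x)) * t j" "j \<in> {1..n}"
    | j g where "a = ts j * fin g - fin (\<lambda>x. g (q powi -2 * x)) * ts j" "j \<in> {1..n}"
    | j g where "a = t j * fin g - fin g * t j" "j \<in> {n+1..n+m}"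
    | j g where "a = ts j * fin g - fin g * ts j" "j \<in> {n+1..n+m}"
    | k g where "a = xi n m k * fin g - fin g * xi n m k" "k \<in> {1..n+m}"
    by (elim disjE; blast)
  then show ?thesis
  proof cases
    case 1
    then show ?thesis using R_pol_rels assms(2) by blast
  next
    case 5
    then show ?thesis using x[OF e(2)] by (simp add: simps e)
  next
    case 6
    then show ?thesis using m_ge_2 by (simp add: simps sh sh[simplified] mult.commute)
  next
    case 7
    then show ?thesis using m_ge_2 by (simp add: simps sh[simplified] mult.commute)
  next
    case 10
    then show ?thesis using x by (simp add: simps mult.commute)
  qed (use m_ge_2 in \<open>simp_all add: simps mult.commute\<close>)
qed

lemma shift_in_idx:
  assumes "i \<in> idx n m" "1 \<le> j" "1 < j \<Longrightarrow> j \<le> n \<Longrightarrow> i j + z \<le> 0"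
    "n < j \<Longrightarrow> j < n + m \<Longrightarrow> 1 \<le> i j + z"
  shows "shift j z i \<in> idx n m"
  using assms by (auto simp: idx_def shift_def)

text \<open>The coefficient vanishes precisely where the shift would leave the label set: for
  \<open>t j\<close> at i_j = 1 when n < j < N, for \<open>ts j\<close> at i_j = 0 when 1 < j \<le>
  n.\<close>

lemma act_supported:
  assumes "x \<in> fun_gens q n m" "i \<in> idx n m"
  shows "act x i \<in> supported (idx n m)"
proof -
  consider j where "x = Gen j" "j \<in> {1..n+m}" | j where "x = GenStar j" "j \<in> {1..n+m}" | g where "x = Fin g"
    using assms(1) by (auto simp: fun_gens_def pol_gens_def)
  then show ?thesis
  proof cases
    case 1
    have "shift j (-1) i \<in> idx n m" if "amp j (i j) \<noteq> 0"
    proof -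
      have "i j \<noteq> 1" if "n < j" "j < n + m" using \<open>amp j (i j) \<noteq> 0\<close> that n_pos by (auto simp: amp_def)
      then show ?thesis
        using 1 idx_nonpos[OF assms(2), of j] idx_pos[OF assms(2), of j]
        by (intro shift_in_idx assms(2)) auto
    qed
    then show ?thesis using 1 by (auto simp: act_Gen supported_def)
  next
    case 2
    have "shift j 1 i \<in> idx n m" if "amp j (i j + 1) \<noteq> 0"
    proof -
      have "i j \<noteq> 0" if "1 < j" "j \<le> n" using \<open>amp j (i j + 1) \<noteq> 0\<close> that n_pos by (auto simp: amp_def)
      then show ?thesis
        using 2 idx_nonpos[OF assms(2), of j] idx_pos[OF assms(2), of j]
        by (intro shift_in_idx assms(2)) auto
    qed
    then show ?thesis using 2 by (auto simp: act_GenStar supported_def)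
  next
    case 3
    then show ?thesis using assms(2) by (auto simp: act_Fin supported_def)
  qed
qed

lemma act_adjoint:
  assumes "x \<in> fun_gens q n m"
  shows "Poly_Mapping.lookup (act x i) l = cnj (Poly_Mapping.lookup (act (gen_star x) l) i)"
proof -
  have *: "Poly_Mapping.lookup (act (Gen j) i) l = cnj (Poly_Mapping.lookup (act (GenStar j) l) i)"
    if j: "j \<in> {1..n+m}" for i l j
  proof (cases "shift j (-1) i = l")
    case True
    then have "shift j 1 l = i" by auto
    with True j amp_shift[of j "-1" i 1] show ?thesis
      by (auto simp: act_Gen act_GenStar partial_sum_shift)
  next
    case False
    then have "shift j 1 l \<noteq> i" by auto
    with False j show ?thesis by (simp add: act_Gen act_GenStar lookup_single)
  qed
  have "Poly_Mapping.lookup (act (GenStar j) i) l = cnj (Poly_Mapping.lookup (act (Gen j) l) i)"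
    if "j \<in> {1..n+m}" for j using *[OF that, of l i] by simp
  with * show ?thesis using assms
    by (auto simp: fun_gens_def pol_gens_def act_Fin lookup_single when_def)
qed

section \<open>The quotients \<open>Fun\<close> and \<open>Pol\<close> and their
  representations\<close>

lemma free_on_xi: "1 \<le> k \<Longrightarrow> xi n m k \<in> free_on (pol_gens n m)"
  unfolding xi_def pol_gens_def by (cases "n < k") (auto intro!: free_on_intros)

lemma pol_rels_subset: "pol_rels q n m \<subseteq> free_on (pol_gens n m)"
  unfolding pol_rels_eq
  by (auto intro!: free_on_intros free_on_xi) (auto simp: pol_gens_def)

lemma fun_rels_subset: "fun_rels q n m \<subseteq> free_on (fun_gens q n m)"
proof -
  have g: "Gen j \<in> fun_gens q n m" "GenStar j \<in> fun_gens q n m" if "1 \<le> j" "j \<le> n + m" for j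
    using that by (auto simp: fun_gens_def pol_gens_def)
  have f: "Fin g \<in> fun_gens q n m" if "g \<in> fin_funs q" for g
    using that by (auto simp: fun_gens_def)
  have x: "xi n m k \<in> free_on (fun_gens q n m)" if "1 \<le> k" for k
    using free_on_xi[OF that] free_on_mono[OF pol_gens_subset_fun_gens] by blast
  have p: "pol_rels q n m \<subseteq> free_on (fun_gens q n m)"
    using pol_rels_subset free_on_mono[OF pol_gens_subset_fun_gens] by blast
  show ?thesis
    unfolding fun_rels_def using p
    by (intro Un_least) (auto simp: free_on_intros x g f fin_funs_closed fin_funs_add)
qed

lemma H0_eq: "H0 n m = supported (idx n m)"
  by (simp add: H0_def supported_def)

sublocale Fun: free_quotient_rep "fun_gens q n m" gen_star "fun_rels q n m" act "idx n m"
  by unfold_locales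
    (use gen_star_fun_gens fun_rels_subset act_supported act_adjoint R_fun_rels in auto)

lemma act_eq_T0_gen: "x \<in> pol_gens n m \<Longrightarrow> act x = T0_gen q n m x"
  by (rule ext) (auto simp: act_def pol_gens_def)

lemma R_eq_T0_free:
  assumes "a \<in> free_on (pol_gens n m)"
  shows "rep (T0_gen q n m) a v = R a v"
proof (rule rep_cong)
  fix w x assume "w \<in> Poly_Mapping.keys a" "x \<in> set (letters w)"
  then have "x \<in> pol_gens n m" using assms by (auto simp: words_in_def)
  then show "T0_gen q n m x = act x" by (simp add: act_eq_T0_gen)
qed

sublocale Pol: free_quotient_rep "pol_gens n m" gen_star "pol_rels q n m" "T0_gen q n m" "idx n m"
proof
  fix x i j assume x: "x \<in> pol_gens n m" and i: "i \<in> idx n m"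
  have s: "gen_star x \<in> pol_gens n m" using x gen_star_pol_gens by blast
  have f: "x \<in> fun_gens q n m" using x pol_gens_subset_fun_gens by blast
  show "T0_gen q n m x i \<in> supported (idx n m)"
    using act_supported[OF f i] by (simp add: act_eq_T0_gen[OF x])
  show "Poly_Mapping.lookup (T0_gen q n m x i) j = cnj (Poly_Mapping.lookup (T0_gen q n m (gen_star x) j) i)"
    using act_adjoint[OF f, of i j] by (simp add: act_eq_T0_gen x s)
next
  fix a i assume "a \<in> pol_rels q n m" "i \<in> idx n m"
  then show "rep (T0_gen q n m) a (bv i) = 0"
    using R_pol_rels R_eq_T0_free pol_rels_subset by fastforce
qed (use gen_star_pol_gens pol_rels_subset in auto)

lemma Pol_eq: "Pol q n m = Pol.Q"
  by (simp add: Pol_def pol_free_def pol_ideal_def Pol.Q_def Pol.I_def)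

lemma Fun_eq: "Fun q n m = Fun.Q"
  by (simp add: Fun_def fun_free_def fun_ideal_def Fun.Q_def Fun.I_def)

lemma fun_class_eq: "fun_class q n m = Fun.cls"
  by (rule ext) (simp add: fun_class_def fun_free_def fun_ideal_def Fun.cls_def Fun.I_def)

lemma T0_eq: "T0 q n m = Pol.T"
  by (intro ext) (simp add: T0_def Pol.T_def T0_free_eq_rep[abs_def])

text \<open>The intersection with the polynomial free algebra is taken because \<open>Fun.I\<close>
  is an ideal of a larger ring, while minimality of \<open>Pol.I\<close> speaks about ideals of the
  smaller one.\<close>

lemma pol_I_subset: "Pol.I \<subseteq> Fun.I"
proof -
  have "Pol.I \<subseteq> Fun.I \<inter> free_on (pol_gens n m)"
  proof (rule Pol.I_minimal)
    have "x \<in> free_on (fun_gens q n m)" if "x \<in> free_on (pol_gens n m)" for x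
      using that free_on_mono[OF pol_gens_subset_fun_gens] by blast
    then show "ideal (Fun.I \<inter> free_on (pol_gens n m)) Pol.F"
      unfolding ideal_free_star_alg_iff using Fun.I_props
      by (auto simp: words_in_add free_on_mult)
    have "pol_rels q n m \<subseteq> Fun.I" using Fun.R_in_I by (auto simp: fun_rels_def)
    then show "pol_rels q n m \<union> star_free gen_star ` pol_rels q n m \<subseteq> Fun.I \<inter> free_on (pol_gens n m)"
      using Pol.gens_subset Fun.I_star by auto
  qed
  then show ?thesis by blast
qed

lemma pol_to_fun_cls:
  assumes "a \<in> free_on (pol_gens n m)"
  shows "pol_to_fun q n m (Pol.cls a) = Fun.cls a"
proof -
  have "pol_to_fun q n m (Pol.cls a) = (\<Union>x\<in>Pol.cls a. \<Union>i\<in>Fun.I. {x + i})"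
    by (simp add: pol_to_fun_def fun_free_def set_add_def set_mult_def fun_ideal_def Fun.I_def)
  also have "\<dots> = Fun.cls a"
  proof safe
    fix x i assume "x \<in> Pol.cls a" "i \<in> Fun.I"
    then have "(x - a) + i \<in> Fun.I"
      using pol_I_subset Fun.I_props(3) by (auto simp: Pol.mem_cls)
    then show "x + i \<in> Fun.cls a" by (simp add: Fun.mem_cls algebra_simps)
  next
    fix x assume "x \<in> Fun.cls a"
    then show "x \<in> (\<Union>x\<in>Pol.cls a. \<Union>i\<in>Fun.I. {x + i})"
      using Pol.self_in_cls[of a] by (intro UN_I[of a] UN_I[of "x - a"]) (auto simp: Fun.mem_cls)
  qed
  finally show ?thesis .
qed

end

section \<open>Relations in the algebra\<close>

lemma const_diff: "const (c - d) = const c - const d"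
  by (simp add: const_def single_diff)

context quantum_cone
begin

abbreviation "G \<equiv> free_on (fun_gens q n m)"

text \<open>Membership in the free algebra is part of the relation, so that chains of equivalences
  carry their own side conditions.\<close>

definition eqv :: "gen free \<Rightarrow> gen free \<Rightarrow> bool" (infix "\<approx>" 50) where
  "a \<approx> b \<longleftrightarrow> a \<in> G \<and> b \<in> G \<and> a - b \<in> Fun.I"

text \<open>
  The scalar may be 0, so that products with the vanishing elements $\<xi>_1$ and $\<xi>_{N+1}$ need no
  separate treatment.
\<close>

definition prop_to :: "gen free \<Rightarrow> gen free \<Rightarrow> bool" (infix "\<propto>" 50) where
  "a \<propto> b \<longleftrightarrow> b \<in> G \<and> (\<exists>c. a \<approx> const c * b)"

lemma eqv_carrier: "a \<approx> b \<Longrightarrow> a \<in> G" "a \<approx> b \<Longrightarrow> b \<in> G"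
  by (simp_all add: eqv_def)

lemma eqv_refl: "a \<in> G \<Longrightarrow> a \<approx> a"
  by (simp add: eqv_def Fun.I_props)

lemma eqv_sym: "a \<approx> b \<Longrightarrow> b \<approx> a"
  using Fun.I_minus[of "a - b"] by (simp add: eqv_def)

lemma eqv_trans [trans]: "a \<approx> b \<Longrightarrow> b \<approx> c \<Longrightarrow> a \<approx> c"
  using Fun.I_props(3)[of "a - b" "b - c"] by (simp add: eqv_def)

lemma eqv_add: "a \<approx> b \<Longrightarrow> c \<approx> d \<Longrightarrow> a + c \<approx> b + d"
  using Fun.I_props(3)[of "a - b" "c - d"] by (simp add: eqv_def words_in_add algebra_simps)

lemma eqv_mult:
  assumes "a \<approx> b" "c \<approx> d"
  shows "a * c \<approx> b * d"
proof -
  have "(a - b) * c + b * (c - d) \<in> Fun.I"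
    using assms by (intro Fun.I_props) (simp_all add: eqv_def)
  then show ?thesis using assms by (simp add: eqv_def free_on_mult algebra_simps)
qed

lemma eqv_mult_left: "a \<approx> b \<Longrightarrow> c \<in> G \<Longrightarrow> c * a \<approx> c * b"
  by (intro eqv_mult eqv_refl)

lemma eqv_mult_right: "a \<approx> b \<Longrightarrow> c \<in> G \<Longrightarrow> a * c \<approx> b * c"
  by (intro eqv_mult eqv_refl)

lemma eqv_const: "a \<approx> b \<Longrightarrow> const c * a \<approx> const c * b"
  by (intro eqv_mult_left) simp_all

lemma eqv_const_swap:
  assumes "a \<approx> const c * b" "b \<in> G" "c \<noteq> 0"
  shows "b \<approx> const (1 / c) * a"
proof -
  have "const (1 / c) * a \<approx> const (1 / c) * (const c * b)" using assms(1) by (rule eqv_const)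
  then show ?thesis using assms(3) eqv_sym by (simp flip: mult.assoc const_times)
qed

lemma eqv_star: "a \<approx> b \<Longrightarrow> star_free gen_star a \<approx> star_free gen_star b"
  using Fun.I_star[of "a - b"] by (simp add: eqv_def Fun.star_closed_F star_free_diff)

lemma eqv_rel: "a - b \<in> fun_rels q n m \<Longrightarrow> a \<in> G \<Longrightarrow> b \<in> G \<Longrightarrow> a \<approx> b"
  by (simp add: eqv_def Fun.R_in_I)

lemma prop_to_carrier: "a \<propto> b \<Longrightarrow> a \<in> G" "a \<propto> b \<Longrightarrow> b \<in> G"
  by (auto simp: prop_to_def eqv_def)

lemma eqv_imp_prop_to: "a \<approx> b \<Longrightarrow> a \<propto> b"
  unfolding prop_to_def by (metis eqv_carrier(2) const_1 mult_1)

lemma prop_toI: "a \<approx> const c * b \<Longrightarrow> b \<in> G \<Longrightarrow> a \<propto> b"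
  by (auto simp: prop_to_def)

lemma prop_to_refl: "a \<in> G \<Longrightarrow> a \<propto> a"
  by (intro eqv_imp_prop_to eqv_refl)

lemma prop_to_trans [trans]:
  assumes "a \<propto> b" "b \<propto> c"
  shows "a \<propto> c"
proof -
  obtain x y where a: "a \<approx> const x * b" and b: "b \<approx> const y * c"
    using assms by (auto simp: prop_to_def)
  note a
  also have "const x * b \<approx> const x * (const y * c)" by (rule eqv_const[OF b])
  also have "const x * (const y * c) = const (x * y) * c" by (simp add: const_times mult.assoc)
  finally show ?thesis using assms(2) by (intro prop_toI) (auto simp: prop_to_def)
qed

lemma prop_to_mult:
  assumes "a \<propto> b" "c \<propto> d"
  shows "a * c \<propto> b * d"
proof -
  obtain x y where "a \<approx> const x * b" and b: "c \<approx> const y * d"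
    using assms by (auto simp: prop_to_def)
  then have "a * c \<approx> const x * b * (const y * d)" by (rule eqv_mult)
  also have "const x * b * (const y * d) = const (x * y) * (b * d)"
    by (simp add: const_times mult.assoc const_left_commute[of b])
  finally show ?thesis using assms by (intro prop_toI) (auto simp: prop_to_def free_on_mult)
qed

lemma prop_to_mult_left: "a \<propto> b \<Longrightarrow> c \<in> G \<Longrightarrow> c * a \<propto> c * b"
  by (intro prop_to_mult prop_to_refl)

lemma prop_to_mult_right: "a \<propto> b \<Longrightarrow> c \<in> G \<Longrightarrow> a * c \<propto> b * c"
  by (intro prop_to_mult prop_to_refl)

lemma prop_to_0: "a \<approx> 0 \<Longrightarrow> b \<in> G \<Longrightarrow> a \<propto> b"
  by (rule prop_toI[of _ 0]) simp_all

lemmas const_shift = const_left_commute[of "letter x" for x] const_left_commute[of "xi k l j" for k l j]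

lemma G_t [simp]: "1 \<le> k \<Longrightarrow> k \<le> n + m \<Longrightarrow> t k \<in> G"
  and G_ts [simp]: "1 \<le> k \<Longrightarrow> k \<le> n + m \<Longrightarrow> ts k \<in> G"
  and G_fin [simp]: "g \<in> fin_funs q \<Longrightarrow> fin g \<in> G"
  by (auto intro!: free_on_letter simp: fun_gens_def pol_gens_def)

lemma G_xi [simp]: "1 \<le> k \<Longrightarrow> xi n m k \<in> G"
  using free_on_xi free_on_mono[OF pol_gens_subset_fun_gens] by blast

lemma G_pol [simp]: "x \<in> pol_gens n m \<Longrightarrow> letter x \<in> G"
  by (intro free_on_letter) (auto simp: fun_gens_def)

lemma pol_rel: "a - b \<in> pol_rels q n m \<Longrightarrow> a \<in> G \<Longrightarrow> b \<in> G \<Longrightarrow> a \<approx> b"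
  by (intro eqv_rel) (auto simp: fun_rels_def)

section \<open>Exchange relations between generators\<close>

lemma t_t:
  assumes "1 \<le> i" "i < j" "j \<le> n + m"
  shows "t i * t j \<approx> rconst q * (t j * t i)"
proof (rule pol_rel)
  show "t i * t j - rconst q * (t j * t i) \<in> pol_rels q n m"
    unfolding pol_rels_eq mult.assoc using assms by blast
qed (use assms in \<open>simp_all add: free_on_mult\<close>)

lemma t_ts:
  assumes "i \<in> {1..n+m}" "j \<in> {1..n+m}" "i \<noteq> j"
  shows "t i * ts j \<approx> rconst q * (ts j * t i)"
proof (rule pol_rel)
  show "t i * ts j - rconst q * (ts j * t i) \<in> pol_rels q n m"
    unfolding pol_rels_eq mult.assoc using assms by blast
qed (use assms in \<open>simp_all add: free_on_mult\<close>)

lemma t_ts_same: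
  assumes "i \<in> {1..n+m}"
  shows "t i * ts i \<approx> ts i * t i + rconst (eps i * (q powi -2 - 1)) * xi n m (i + 1)"
proof (rule pol_rel)
  show "t i * ts i - (ts i * t i + rconst (eps i * (q powi -2 - 1)) * xi n m (i + 1)) \<in> pol_rels q n m"
    unfolding pol_rels_eq using assms by blast
qed (use assms in \<open>simp_all add: free_on_intros del: of_real_mult\<close>)

lemma xi_1: "xi n m 1 \<approx> 0"
  by (rule pol_rel) (auto simp: pol_rels_eq)

lemma ts_ts:
  assumes "1 \<le> i" "i < j" "j \<le> n + m"
  shows "ts j * ts i \<approx> rconst q * (ts i * ts j)"
  using eqv_star[OF t_t[OF assms]] by (simp add: star_free_mult star_free_letter const_commute)

lemma t_t':
  assumes "1 \<le> i" "i < j" "j \<le> n + m"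
  shows "t j * t i \<approx> rconst (1 / q) * (t i * t j)"
  using eqv_const_swap[OF t_t[OF assms]] assms q_pos by (simp add: free_on_mult)

lemma ts_ts':
  assumes "1 \<le> i" "i < j" "j \<le> n + m"
  shows "ts i * ts j \<approx> rconst (1 / q) * (ts j * ts i)"
  using eqv_const_swap[OF ts_ts[OF assms]] assms q_pos by (simp add: free_on_mult)

lemma ts_t:
  assumes "i \<in> {1..n+m}" "j \<in> {1..n+m}" "i \<noteq> j"
  shows "ts j * t i \<approx> rconst (1 / q) * (t i * ts j)"
  using eqv_const_swap[OF t_ts[OF assms]] assms q_pos by (simp add: free_on_mult)

fun gen_idx :: "gen \<Rightarrow> nat" where
  "gen_idx (Gen j) = j"
| "gen_idx (GenStar j) = j"
| "gen_idx (Fin g) = 0"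

lemma letter_commute:
  assumes "x \<in> pol_gens n m" "y \<in> pol_gens n m" "gen_idx x \<noteq> gen_idx y"
  shows "letter x * letter y \<propto> letter y * letter x"
proof -
  define i j where "i = gen_idx x" and "j = gen_idx y"
  have ij: "i \<in> {1..n+m}" "j \<in> {1..n+m}" "i \<noteq> j" "x = Gen i \<or> x = GenStar i" "y = Gen j \<or> y = GenStar j"
    using assms by (auto simp: i_def j_def pol_gens_def)
  have *: "a * b \<propto> b * a" if "a * b \<approx> const c * (b * a)" "b \<in> G" "a \<in> G" for a b c
    using that by (intro prop_toI) (simp_all add: free_on_mult)
  have "t i * t j \<propto> t j * t i"
  proof (cases "i < j")
    case True
    with ij t_t[of i j] show ?thesis by (intro *) auto
  next
    case False
    with ij t_t'[of j i] show ?thesis by (intro *) auto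
  qed
  moreover have "ts i * ts j \<propto> ts j * ts i"
  proof (cases "i < j")
    case True
    with ij ts_ts'[of i j] show ?thesis by (intro *) auto
  next
    case False
    with ij ts_ts[of j i] show ?thesis by (intro *) auto
  qed
  moreover have "t i * ts j \<propto> ts j * t i"
    using ij t_ts[of i j] by (intro *) auto
  moreover have "ts i * t j \<propto> t j * ts i"
    using ij ts_t[of j i] by (intro *) auto
  ultimately show ?thesis using ij(4,5) by blast
qed

text \<open>Companion of \<open>xi_step\<close> with the opposite order of the two generators:
  inserting the commutator relation squares the sign, and q^-2 - 1 combines with the 1 already in
  front of \<xi>_{k+1}.\<close>

lemma xi_conv_ts_t:
  assumes "k \<in> {1..n+m}"
  shows "xi n m k \<approx> rconst (eps k) * (ts k * t k) + rconst (q powi -2) * xi n m (k + 1)"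
proof -
  let ?e = "complex_of_real (eps k)" and ?p = "complex_of_real (q powi -2)"
  have "xi n m k = const ?e * (t k * ts k) + xi n m (k + 1)"
    by (rule xi_step[OF assms])
  also have "\<dots> \<approx> const ?e * (ts k * t k + const (?e * (?p - 1)) * xi n m (k + 1)) + xi n m (k + 1)"
    using t_ts_same[OF assms] by (intro eqv_add eqv_const eqv_refl) simp_all
  also have "\<dots> = const ?e * (ts k * t k) + const ?p * xi n m (k + 1)"
  proof -
    have "const ?e * (const (?e * (?p - 1)) * xi n m (k + 1)) = const (?p - 1) * xi n m (k + 1)"
      by (simp add: eps_def flip: const_times mult.assoc)
    also have "\<dots> = const ?p * xi n m (k + 1) - xi n m (k + 1)"
      by (simp add: const_diff left_diff_distrib)
    finally show ?thesis by (simp add: distrib_left)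
  qed
  finally show ?thesis .
qed

text \<open>\<open>xi_conv_ts_t\<close> solved for \<open>ts k * t k\<close>. The coefficients stay
  existential, since rewriting only uses that a combination of \<xi>_k and \<xi>_{k+1}
  results.\<close>

lemma ts_t_conv_xi:
  assumes "k \<in> {1..n+m}"
  shows "\<exists>c d. ts k * t k \<approx> const c * xi n m k + const d * xi n m (k + 1)"
proof -
  let ?e = "complex_of_real (eps k)" and ?p = "complex_of_real (q powi -2)"
  have "const ?e * xi n m k + const (- ?e * ?p) * xi n m (k + 1) \<approx>
      const ?e * (const ?e * (ts k * t k) + const ?p * xi n m (k + 1)) + const (- ?e * ?p) * xi n m (k + 1)"
    using xi_conv_ts_t[OF assms] assms
    by (intro eqv_add eqv_const eqv_refl) (auto intro!: free_on_intros)
  also have "\<dots> = ts k * t k"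
    by (simp add: distrib_left eps_def const_minus flip: mult.assoc const_times)
  finally show ?thesis using eqv_sym by blast
qed

lemma t_ts_conv_xi:
  assumes "k \<in> {1..n+m}"
  shows "\<exists>c d. t k * ts k \<approx> const c * xi n m k + const d * xi n m (k + 1)"
proof -
  let ?e = "complex_of_real (eps k)"
  have "const ?e * xi n m k + const (- ?e) * xi n m (k + 1) = t k * ts k"
    unfolding xi_step[OF assms]
    by (simp add: distrib_left eps_def const_minus flip: mult.assoc const_times)
  moreover have "t k * ts k \<approx> t k * ts k" using assms by (intro eqv_refl) (simp add: free_on_mult)
  ultimately show ?thesis by metis
qed

definition comm_factor :: "nat \<Rightarrow> nat \<Rightarrow> real" where
  "comm_factor j k = (if j < k then q\<^sup>2 else 1)"

text \<open>Downward induction from \<xi>_{N+1} = 0. For j < k, passing \<open>t k\<close> and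
  \<open>ts k\<close> yields q twice; for j > k the factors 1/q and q cancel. Only j = k needs the
  commutator relation, as \<open>comm_factor\<close> jumps between k + 1 and k there.\<close>

lemma t_xi:
  assumes "j \<in> {1..n+m}" "1 \<le> k" "k \<le> n + m + 1"
  shows "t j * xi n m k \<approx> rconst (comm_factor j k) * (xi n m k * t j)"
  using assms(3,2)
proof (induction k rule: inc_induct)
  case base
  show ?case by (simp add: eqv_refl)
next
  case (step k)
  then have k: "k \<in> {1..n+m}" by simp
  have IH: "t j * xi n m (k + 1) \<approx> rconst (comm_factor j (k + 1)) * (xi n m (k + 1) * t j)"
    using step by simp
  let ?e = "complex_of_real (eps k)" and ?f = "complex_of_real (comm_factor j k)"
  have main: "?case" if f: "comm_factor j (k + 1) = comm_factor j k"
    and tt: "t j * (t k * ts k) \<approx> const ?f * (t k * ts k * t j)"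
  proof -
    have "t j * xi n m k = const ?e * (t j * (t k * ts k)) + t j * xi n m (k + 1)"
      unfolding xi_step[OF k] by (simp add: distrib_left const_shift)
    also have "\<dots> \<approx> const ?e * (const ?f * (t k * ts k * t j)) + const ?f * (xi n m (k + 1) * t j)"
      using tt IH f by (intro eqv_add eqv_const) simp_all
    also have "\<dots> = const ?f * (xi n m k * t j)"
      unfolding xi_step[OF k]
      by (simp add: distrib_left distrib_right mult.assoc const_left_commute[of "const ?e" ?f])
    finally show ?thesis .
  qed
  consider "j < k" | "j = k" | "k < j" by linarith
  then show ?case
  proof cases
    case 1
    have "t j * t k * ts k \<approx> rconst q * (t k * t j) * ts k"
      using 1 assms(1) k by (intro eqv_mult_right t_t) auto
    also have "\<dots> = rconst q * t k * (t j * ts k)" by (simp add: mult.assoc)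
    also have "\<dots> \<approx> rconst q * t k * (rconst q * (ts k * t j))"
      using 1 assms(1) k by (intro eqv_mult_left t_ts) (auto simp: free_on_mult)
    also have "\<dots> = rconst (q\<^sup>2) * (t k * ts k * t j)"
      by (simp add: mult.assoc const_shift const_times power2_eq_square)
    finally show ?thesis using 1 by (intro main) (simp_all add: comm_factor_def mult.assoc)
  next
    case 2
    let ?p = "complex_of_real (q powi -2)"
    \<comment> \<open>With \<xi>_k written through \<open>ts k * t k\<close>, its q^-2 cancels the
      q^2 gained when \<open>t k\<close> passes \<xi>_{k+1}; what remains is \<open>xi_step\<close>
      multiplied by \<open>t k\<close> on the right.\<close>
    have "t k * xi n m k \<approx> t k * (const ?e * (ts k * t k) + const ?p * xi n m (k + 1))"
      using k by (intro eqv_mult_left xi_conv_ts_t) auto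
    also have "\<dots> = const ?e * (t k * ts k * t k) + const ?p * (t k * xi n m (k + 1))"
      by (simp add: distrib_left const_shift mult.assoc)
    also have "\<dots> \<approx> const ?e * (t k * ts k * t k) + const ?p * (rconst (q\<^sup>2) * (xi n m (k + 1) * t k))"
      using IH 2 k by (intro eqv_add eqv_const eqv_refl) (auto simp: comm_factor_def free_on_mult words_in_const_mult)
    also have "\<dots> = xi n m k * t k"
      unfolding xi_step[OF k] using q_pos
      by (simp add: distrib_right mult.assoc power_int_minus flip: const_times mult.assoc[of "const _" "const _"])
    finally show ?thesis using 2 by (simp add: comm_factor_def)
  next
    case 3
    have "t j * t k * ts k \<approx> rconst (1 / q) * (t k * t j) * ts k"
      using 3 assms(1) k by (intro eqv_mult_right t_t') auto
    also have "\<dots> = rconst (1 / q) * t k * (t j * ts k)" by (simp add: mult.assoc)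
    also have "\<dots> \<approx> rconst (1 / q) * t k * (rconst q * (ts k * t j))"
      using 3 assms(1) k by (intro eqv_mult_left t_ts) (auto simp: free_on_mult)
    also have "\<dots> = const (complex_of_real (1 / q) * complex_of_real q) * (t k * ts k * t j)"
      unfolding const_times by (simp only: mult.assoc const_shift)
    also have "\<dots> = t k * ts k * t j" using q_pos by simp
    finally show ?thesis using 3 by (intro main) (simp_all add: comm_factor_def mult.assoc)
  qed
qed

lemma star_free_xi: "star_free gen_star (xi n m k) = xi n m k"
  by (simp add: xi_def star_free_add star_free_minus star_free_diff star_free_sum star_free_mult star_free_letter)

lemma ts_xi:
  assumes "j \<in> {1..n+m}" "1 \<le> k" "k \<le> n + m + 1"
  shows "ts j * xi n m k \<approx> rconst (1 / comm_factor j k) * (xi n m k * ts j)"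
proof -
  have "xi n m k * ts j \<approx> rconst (comm_factor j k) * (ts j * xi n m k)"
    using eqv_star[OF t_xi[OF assms]]
    by (simp add: star_free_mult star_free_letter star_free_xi const_commute)
  from eqv_const_swap[OF this] show ?thesis
    using assms q_pos by (simp add: comm_factor_def free_on_mult split: if_splits)
qed

lemma letter_xi:
  assumes "x \<in> pol_gens n m" "1 \<le> k" "k \<le> n + m + 1"
  shows "letter x * xi n m k \<propto> xi n m k * letter x" "xi n m k * letter x \<propto> letter x * xi n m k"
proof -
  have *: "a * b \<propto> b * a \<and> b * a \<propto> a * b"
    if "a * b \<approx> const c * (b * a)" "b \<in> G" "a \<in> G" "c \<noteq> 0" for a b c
    using that eqv_const_swap[of "a * b" c "b * a"] by (auto intro!: prop_toI simp: free_on_mult)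
  have c: "comm_factor j k \<noteq> 0" for j using q_pos by (simp add: comm_factor_def)
  from assms(1) consider j where "x = Gen j" "j \<in> {1..n+m}" | j where "x = GenStar j" "j \<in> {1..n+m}"
    by (auto simp: pol_gens_def)
  then have "letter x * xi n m k \<propto> xi n m k * letter x \<and> xi n m k * letter x \<propto> letter x * xi n m k"
  proof cases
    case 1
    then show ?thesis using *[OF t_xi[OF 1(2) assms(2,3)]] assms(2) c by simp
  next
    case 2
    then show ?thesis using *[OF ts_xi[OF 2(2) assms(2,3)]] assms(2) c by simp
  qed
  then show "letter x * xi n m k \<propto> xi n m k * letter x" "xi n m k * letter x \<propto> letter x * xi n m k"
    by auto
qed

text \<open>Only \<xi>_l is expanded: the factor acquired when \<open>ts l\<close> passes \<xi>_k is
  inverse to the one acquired by \<open>t l\<close>.\<close>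

lemma xi_xi:
  assumes "1 \<le> k" "k \<le> n + m + 1" "1 \<le> l" "l \<le> n + m + 1"
  shows "xi n m l * xi n m k \<approx> xi n m k * xi n m l"
  using assms(4,3)
proof (induction l rule: inc_induct)
  case base
  show ?case by (simp add: eqv_refl)
next
  case (step l)
  then have l: "l \<in> {1..n+m}" by simp
  let ?e = "complex_of_real (eps l)" and ?c = "comm_factor l k"
  have "t l * (ts l * xi n m k) \<approx> t l * (rconst (1 / ?c) * (xi n m k * ts l))"
    using l by (intro eqv_mult_left ts_xi assms) auto
  also have "\<dots> = rconst (1 / ?c) * (t l * xi n m k * ts l)"
    by (simp only: const_shift mult.assoc)
  also have "\<dots> \<approx> rconst (1 / ?c) * (rconst ?c * (xi n m k * t l) * ts l)"
    using l by (intro eqv_const eqv_mult_right t_xi assms) auto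
  also have "\<dots> = const (complex_of_real (1 / ?c) * complex_of_real ?c) * (xi n m k * (t l * ts l))"
    unfolding const_times by (simp only: mult.assoc)
  also have "\<dots> = xi n m k * (t l * ts l)" using q_pos by (simp add: comm_factor_def)
  finally have tts: "t l * (ts l * xi n m k) \<approx> xi n m k * (t l * ts l)" .
  have "xi n m l * xi n m k = const ?e * (t l * (ts l * xi n m k)) + xi n m (l + 1) * xi n m k"
    unfolding xi_step[OF l] by (simp add: distrib_right mult.assoc)
  also have "\<dots> \<approx> const ?e * (xi n m k * (t l * ts l)) + xi n m k * xi n m (l + 1)"
    using tts step by (intro eqv_add eqv_const) simp_all
  also have "\<dots> = xi n m k * xi n m l"
    unfolding xi_step[OF l] by (simp add: distrib_left const_shift)
  finally show ?case .
qed

lemma letter_fin: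
  assumes "x \<in> pol_gens n m" "g \<in> fin_funs q"
  shows "\<exists>g'\<in>fin_funs q. letter x * fin g \<approx> fin g' * letter x"
proof -
  have r: "\<exists>g'\<in>fin_funs q. letter x * fin g \<approx> fin g' * letter x"
    if "letter x * fin g - fin g' * letter x \<in> fun_rels q n m" "g' \<in> fin_funs q" for g'
    using that assms by (intro bexI[of _ g'] eqv_rel) (simp_all add: free_on_mult)
  define j where "j = gen_idx x"
  have j: "j \<in> {1..n+m}" and x: "x = Gen j \<or> x = GenStar j"
    using assms(1) by (auto simp: j_def pol_gens_def)
  show ?thesis
  proof (cases "j \<le> n")
    case True
    then have j': "j \<in> {1..n}" using j by simp
    have "t j * fin g - fin (\<lambda>x. g (q\<^sup>2 * x)) * t j \<in> fun_rels q n m"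
      "ts j * fin g - fin (\<lambda>x. g (q powi -2 * x)) * ts j \<in> fun_rels q n m"
      unfolding fun_rels_def Un_iff mem_Collect_eq using j' assms(2) by blast+
    then show ?thesis using x r fin_funs_closed[OF assms(2)] by blast
  next
    case False
    then have j': "j \<in> {n+1..n+m}" using j by simp
    have "t j * fin g - fin g * t j \<in> fun_rels q n m"
      "ts j * fin g - fin g * ts j \<in> fun_rels q n m"
      unfolding fun_rels_def Un_iff mem_Collect_eq using j' assms(2) by blast+
    then show ?thesis using x r assms(2) by blast
  qed
qed

text \<open>The involution turns this into \<open>letter_fin\<close> for the conjugate function and
  the adjoint letter, so that no rescaling has to be inverted.\<close>

lemma fin_letter:
  assumes "x \<in> pol_gens n m" "g \<in> fin_funs q"
  shows "\<exists>g'\<in>fin_funs q. fin g * letter x \<approx> letter x * fin g'"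
proof -
  have "gen_star x \<in> pol_gens n m" using assms(1) gen_star_pol_gens by blast
  moreover have c: "(\<lambda>x. cnj (h x)) \<in> fin_funs q" if "h \<in> fin_funs q" for h
    using that by (simp add: fin_funs_def)
  ultimately obtain g' where g': "g' \<in> fin_funs q"
    "letter (gen_star x) * fin (\<lambda>x. cnj (g x)) \<approx> fin g' * letter (gen_star x)"
    using letter_fin assms(2) by blast
  from eqv_star[OF g'(2)] have "fin g * letter x \<approx> letter x * fin (\<lambda>x. cnj (g' x))"
    by (simp add: star_free_mult star_free_letter)
  then show ?thesis using c g'(1) by blast
qed

lemma fin_fin:
  assumes "g \<in> fin_funs q" "h \<in> fin_funs q"
  shows "fin g * fin h \<approx> fin (\<lambda>x. g x * h x)"
proof (rule eqv_sym, rule eqv_rel)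
  show "fin (\<lambda>x. g x * h x) - fin g * fin h \<in> fun_rels q n m"
    unfolding fun_rels_def Un_iff mem_Collect_eq using assms by blast
qed (use assms in \<open>simp_all add: free_on_mult fin_funs_closed(2)\<close>)

lemma fin_add:
  assumes "g \<in> fin_funs q" "h \<in> fin_funs q"
  shows "fin (\<lambda>x. g x + h x) \<approx> fin g + fin h"
proof (rule eqv_rel)
  show "fin (\<lambda>x. g x + h x) - (fin g + fin h) \<in> fun_rels q n m"
    unfolding fun_rels_def Un_iff mem_Collect_eq using assms by blast
qed (use assms in \<open>simp_all add: words_in_add fin_funs_add\<close>)

lemma fin_scale:
  assumes "g \<in> fin_funs q"
  shows "fin (\<lambda>x. c * g x) \<approx> const c * fin g"
proof (rule eqv_rel)
  show "fin (\<lambda>x. c * g x) - const c * fin g \<in> fun_rels q n m"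
    unfolding fun_rels_def Un_iff mem_Collect_eq using assms by blast
qed (use assms in \<open>simp_all add: words_in_const_mult fin_funs_closed(1)\<close>)

lemma xi_fin:
  assumes "g \<in> fin_funs q" "1 \<le> k" "k \<le> n + m + 1"
  shows "xi n m k * fin g \<approx> fin g * xi n m k"
proof (cases "k \<le> n + m")
  case True
  show ?thesis
  proof (rule eqv_rel)
    have "k \<in> {1..n+m}" using True assms by simp
    then show "xi n m k * fin g - fin g * xi n m k \<in> fun_rels q n m"
      unfolding fun_rels_def Un_iff mem_Collect_eq using assms by blast
  qed (use assms in \<open>simp_all add: free_on_mult\<close>)
next
  case False
  then have "k = Suc (n + m)" using assms by simp
  then show ?thesis by (simp add: eqv_refl)
qed

lemma xi_absorb:
  assumes "g \<in> fin_funs q"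
  shows "xi n m (n + 1) * fin g \<approx> fin (\<lambda>x. of_real x * g x)"
proof (rule eqv_sym, rule eqv_rel)
  show "fin (\<lambda>x. of_real x * g x) - xi n m (n + 1) * fin g \<in> fun_rels q n m"
    unfolding fun_rels_def Un_iff mem_Collect_eq using assms by blast
qed (use assms in \<open>simp_all add: free_on_mult fin_funs_closed(2)\<close>)

end

section \<open>Normal ordering\<close>

lemma map_prod_list_1 [simp]: "prod_list (map (\<lambda>_. 1) ks) = (1 :: 'a :: monoid_mult)"
  by (induction ks) simp_all

context quantum_cone
begin

text \<open>One term of f_IJ. No power of \<xi>_{n+1} appears, because multiplication by it is
  absorbed into g.\<close>

definition mid :: "(nat \<Rightarrow> nat) \<Rightarrow> (real \<Rightarrow> complex) \<Rightarrow> gen free" where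
  "mid K g = prod_list (map (\<lambda>k. xi n m k ^ K k) [2..<n+1]) * fin g *
    prod_list (map (\<lambda>k. xi n m k ^ K k) [n+2..<n+m+1])"

lemma G_xi_powers:
  "(\<And>k. k \<in> set ks \<Longrightarrow> 1 \<le> k) \<Longrightarrow> prod_list (map (\<lambda>k. xi n m k ^ K k) ks) \<in> G"
  by (intro free_on_prod_list) (auto intro!: free_on_power G_xi)

lemma G_mid [simp]: "g \<in> fin_funs q \<Longrightarrow> mid K g \<in> G"
  unfolding mid_def by (intro free_on_mult G_xi_powers G_fin) auto

lemma prop_to_swap_mult:
  assumes "a * b \<propto> b * a" "a * c \<propto> c * a" "a \<in> G" "b \<in> G" "c \<in> G"
  shows "a * (b * c) \<propto> b * c * a"
proof -
  have "a * b * c \<propto> b * a * c" by (intro prop_to_mult_right assms)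
  also have "b * a * c = b * (a * c)" by (rule mult.assoc)
  also have "\<dots> \<propto> b * (c * a)" by (intro prop_to_mult_left assms)
  finally show ?thesis by (simp add: mult.assoc)
qed

lemma prop_to_swap_power:
  assumes "a * b \<propto> b * a" "a \<in> G" "b \<in> G"
  shows "a * b ^ k \<propto> b ^ k * a"
proof (induction k)
  case 0
  show ?case using assms by (simp add: prop_to_refl)
next
  case (Suc k)
  then show ?case
    using prop_to_swap_mult[of a b "b ^ k"] assms by (simp add: free_on_power)
qed

lemma prop_to_swap_prod_list:
  assumes "a \<in> G" "\<And>b. b \<in> set bs \<Longrightarrow> b \<in> G \<and> a * b \<propto> b * a"
  shows "a * prod_list bs \<propto> prod_list bs * a"
  using assms(2)
proof (induction bs)
  case Nil
  show ?case using assms(1) by (simp add: prop_to_refl)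
next
  case (Cons b bs)
  then have "prod_list bs \<in> G" by (intro free_on_prod_list) auto
  with Cons show ?case using prop_to_swap_mult[of a b "prod_list bs"] assms(1) by simp
qed

lemma prop_to_swap_xi_powers:
  assumes "a \<in> G" "\<And>k. k \<in> set ks \<Longrightarrow> 1 \<le> k \<and> a * xi n m k \<propto> xi n m k * a"
  shows "a * prod_list (map (\<lambda>k. xi n m k ^ K k) ks) \<propto> prod_list (map (\<lambda>k. xi n m k ^ K k) ks) * a"
  by (rule prop_to_swap_prod_list)
    (use assms in \<open>auto intro!: prop_to_swap_power free_on_power G_xi\<close>)

lemma letter_mid:
  assumes "x \<in> pol_gens n m" "g \<in> fin_funs q"
  shows "\<exists>g'\<in>fin_funs q. letter x * mid K g \<propto> mid K g' * letter x"
proof -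
  obtain g' where g': "g' \<in> fin_funs q" "letter x * fin g \<approx> fin g' * letter x"
    using letter_fin[OF assms] by blast
  let ?P = "prod_list (map (\<lambda>k. xi n m k ^ K k) [2..<n+1])"
    and ?Q = "prod_list (map (\<lambda>k. xi n m k ^ K k) [n+2..<n+m+1])"
  have G: "?P \<in> G" "?Q \<in> G" "letter x \<in> G"
    by (auto intro!: G_xi_powers G_pol[OF assms(1)] simp del: upt_Suc)
  have "letter x * ?P \<propto> ?P * letter x" "letter x * ?Q \<propto> ?Q * letter x"
    by (intro prop_to_swap_xi_powers G; use assms(1) in \<open>auto intro!: letter_xi\<close>)+
  note PQ = this
  have "letter x * ?P * (fin g * ?Q) \<propto> ?P * letter x * (fin g * ?Q)"
    using G assms(2) by (intro prop_to_mult_right PQ) (simp add: free_on_mult)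
  also have "?P * letter x * (fin g * ?Q) = ?P * (letter x * fin g) * ?Q"
    by (simp add: mult.assoc)
  also have "?P * (letter x * fin g) * ?Q \<propto> ?P * (fin g' * letter x) * ?Q"
    using G g' by (intro prop_to_mult_right prop_to_mult_left eqv_imp_prop_to) auto
  also have "?P * (fin g' * letter x) * ?Q = ?P * fin g' * (letter x * ?Q)"
    by (simp add: mult.assoc)
  also have "\<dots> \<propto> ?P * fin g' * (?Q * letter x)"
    using G g' by (intro prop_to_mult_left PQ) (simp add: free_on_mult)
  finally show ?thesis using g'(1) by (auto simp: mid_def mult.assoc)
qed

lemma G_wd: "u \<in> lists (pol_gens n m) \<Longrightarrow> wd u \<in> G"
  using free_on_mono[OF pol_gens_subset_fun_gens, of n m q] by (auto simp: words_in_wd lists_eq_set fun_gens_def)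

lemma word_mid:
  assumes "u \<in> lists (pol_gens n m)" "g \<in> fin_funs q"
  shows "\<exists>g'\<in>fin_funs q. wd u * mid K g \<propto> mid K g' * wd u"
  using assms(1)
proof (induction rule: lists.induct)
  case Nil
  show ?case using assms(2) by (intro bexI[of _ g]) (simp_all add: prop_to_refl)
next
  case (Cons x u)
  then obtain g' where g': "g' \<in> fin_funs q" "wd u * mid K g \<propto> mid K g' * wd u" by blast
  obtain g'' where g'': "g'' \<in> fin_funs q" "letter x * mid K g' \<propto> mid K g'' * letter x"
    using letter_mid Cons g'(1) by blast
  have "letter x * (wd u * mid K g) \<propto> letter x * (mid K g' * wd u)"
    using Cons g' by (intro prop_to_mult_left) simp_all
  also have "letter x * (mid K g' * wd u) = letter x * mid K g' * wd u" by (simp add: mult.assoc)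
  also have "\<dots> \<propto> mid K g'' * letter x * wd u"
    using Cons g'' G_wd by (intro prop_to_mult_right) simp_all
  finally show ?case using g''(1) by (auto simp: wd_Cons mult.assoc)
qed

lemma xi_word:
  assumes "u \<in> lists (pol_gens n m)" "1 \<le> k" "k \<le> n + m + 1"
  shows "xi n m k * wd u \<propto> wd u * xi n m k"
  using assms(1)
proof (induction rule: lists.induct)
  case Nil
  show ?case using assms(2) by (simp add: prop_to_refl)
next
  case (Cons x u)
  then show ?case unfolding wd_Cons
    using assms G_wd letter_xi by (intro prop_to_swap_mult) simp_all
qed

lemma xi_power_upd:
  assumes "distinct ks" "k \<in> set ks" "\<And>l. l \<in> set ks \<Longrightarrow> 1 \<le> l \<and> l \<le> n + m"
  shows "xi n m k * prod_list (map (\<lambda>l. xi n m l ^ K l) ks) \<propto>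
    prod_list (map (\<lambda>l. xi n m l ^ (K(k := Suc (K k))) l) ks)"
  using assms
proof (induction ks)
  case (Cons l ks)
  have Gks: "prod_list (map (\<lambda>l. xi n m l ^ K l) ks) \<in> G" for K
    using Cons.prems by (intro G_xi_powers) auto
  show ?case
  proof (cases "l = k")
    case True
    then have e: "map (\<lambda>l. xi n m l ^ (K(k := Suc (K k))) l) ks = map (\<lambda>l. xi n m l ^ K l) ks"
      using Cons.prems by (intro map_cong) auto
    have "xi n m k * (xi n m k ^ K k * prod_list (map (\<lambda>l. xi n m l ^ K l) ks)) \<in> G"
      using Cons.prems(3)[of l] True Gks by (intro free_on_mult free_on_power G_xi) auto
    then show ?thesis using True by (simp only: list.map prod_list.Cons e fun_upd_same power_Suc mult.assoc prop_to_refl)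
  next
    case False
    let ?X = "xi n m l ^ K l"
    let ?Y = "prod_list (map (\<lambda>l. xi n m l ^ K l) ks)"
    have k: "1 \<le> k" "k \<le> n + m + 1" and l: "1 \<le> l" "l \<le> n + m + 1"
      using Cons.prems(3)[of l] Cons.prems(3)[of k] Cons.prems(2) by auto
    have "xi n m k * ?X \<propto> ?X * xi n m k"
      using k l by (intro prop_to_swap_power eqv_imp_prop_to xi_xi) simp_all
    then have "xi n m k * ?X * ?Y \<propto> ?X * xi n m k * ?Y"
      by (intro prop_to_mult_right Gks)
    also have "\<dots> = ?X * (xi n m k * ?Y)" by (simp add: mult.assoc)
    also have "\<dots> \<propto> ?X * prod_list (map (\<lambda>l. xi n m l ^ (K(k := Suc (K k))) l) ks)"
      using Cons False l by (intro prop_to_mult_left Cons.IH) (auto intro!: free_on_power G_xi)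
    finally show ?thesis using False by (simp add: mult.assoc)
  qed
qed simp

text \<open>\<xi>_1 and \<xi>_{N+1} vanish, so that scalar 0 and any middle factor will do;
  \<xi>_{n+1} multiplies g by the coordinate function; every other \<xi>_k raises its own
  exponent.\<close>

lemma xi_mid:
  assumes "g \<in> fin_funs q" "1 \<le> k" "k \<le> n + m + 1"
  shows "\<exists>K'. \<exists>g'\<in>fin_funs q. xi n m k * mid K g \<propto> mid K' g'"
proof -
  let ?P = "\<lambda>K. prod_list (map (\<lambda>k. xi n m k ^ K k) [2..<n+1])"
    and ?Q = "\<lambda>K. prod_list (map (\<lambda>k. xi n m k ^ K k) [n+2..<n+m+1])"
  have G: "?P K \<in> G" "?Q K \<in> G" for K
    by (auto intro!: G_xi_powers simp del: upt_Suc)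
  have x: "xi n m k \<in> G" using assms(2) by simp
  have P: "xi n m k * ?P K \<propto> ?P K * xi n m k"
    using assms by (intro prop_to_swap_xi_powers x) (auto intro!: eqv_imp_prop_to xi_xi)
  have PQ: "xi n m k * (?P K * fin g * ?Q K) \<propto> ?P K * (xi n m k * (fin g * ?Q K))"
    using prop_to_mult_right[OF P, of "fin g * ?Q K"] assms(1) G by (simp add: mult.assoc free_on_mult)
  consider "k = 1" | "k = n + m + 1" | "k = n + 1" | "k \<in> {2..n}" | "k \<in> {n+2..n+m}"
    using assms by fastforce
  then show ?thesis
  proof cases
    case 1
    have "xi n m k * mid K g \<approx> 0 * mid K g" using 1 xi_1 assms(1) by (intro eqv_mult_right) auto
    then have "xi n m k * mid K g \<propto> mid K g" using assms(1) by (intro prop_to_0) auto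
    then show ?thesis using assms(1) by blast
  next
    case 2
    then have "xi n m k * mid K g \<propto> mid K g" using assms(1) by (intro prop_to_0) (simp_all add: eqv_refl)
    then show ?thesis using assms(1) by blast
  next
    case 3
    let ?g = "\<lambda>x. of_real x * g x"
    have g: "?g \<in> fin_funs q" using assms(1) by (rule fin_funs_closed)
    note PQ
    also have "?P K * (xi n m k * (fin g * ?Q K)) = ?P K * (xi n m k * fin g) * ?Q K"
      by (simp add: mult.assoc)
    also have "\<dots> \<propto> ?P K * fin ?g * ?Q K"
      unfolding 3 using assms(1) G by (intro prop_to_mult_right prop_to_mult_left eqv_imp_prop_to xi_absorb)
    finally show ?thesis using g unfolding mid_def by blast
  next
    case 4
    have e: "?Q (K(k := Suc (K k))) = ?Q K"
      using 4 by (intro arg_cong[where f = prod_list] map_cong) auto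
    have "xi n m k * ?P K * (fin g * ?Q K) \<propto> ?P (K(k := Suc (K k))) * (fin g * ?Q K)"
      using 4 assms(1) G by (intro prop_to_mult_right xi_power_upd) (auto simp: free_on_mult)
    then have "xi n m k * mid K g \<propto> mid (K(k := Suc (K k))) g"
      unfolding mid_def e by (simp only: mult.assoc)
    then show ?thesis using assms(1) by blast
  next
    case 5
    have e: "?P (K(k := Suc (K k))) = ?P K"
      using 5 by (intro arg_cong[where f = prod_list] map_cong) auto
    note PQ
    also have "?P K * (xi n m k * (fin g * ?Q K)) = ?P K * (xi n m k * fin g) * ?Q K"
      by (simp add: mult.assoc)
    also have "\<dots> \<propto> ?P K * (fin g * xi n m k) * ?Q K"
      using assms G by (intro prop_to_mult_right prop_to_mult_left eqv_imp_prop_to xi_fin)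
    also have "\<dots> = ?P K * fin g * (xi n m k * ?Q K)" by (simp add: mult.assoc)
    also have "\<dots> \<propto> ?P K * fin g * ?Q (K(k := Suc (K k)))"
      using 5 assms(1) G by (intro prop_to_mult_left xi_power_upd) (auto simp: free_on_mult)
    finally have "xi n m k * mid K g \<propto> mid (K(k := Suc (K k))) g"
      unfolding mid_def e .
    then show ?thesis using assms(1) by blast
  qed
qed

text \<open>On words in the polynomial generators this is the condition I_k J_k = 0 of the
  monomials, stated before the exponents are known.\<close>

definition reduced :: "gen list \<Rightarrow> bool" where
  "reduced u \<longleftrightarrow> (\<forall>x\<in>set u. gen_star x \<notin> set u)"

lemma same_gen_idx:
  "x \<in> pol_gens n m \<Longrightarrow> y \<in> pol_gens n m \<Longrightarrow> gen_idx x = gen_idx y \<Longrightarrow> x = y \<or> y = gen_star x"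
  by (auto simp: pol_gens_def)

lemma letter_past_word:
  assumes "x \<in> pol_gens n m" "b \<in> lists (pol_gens n m)" "gen_star x \<notin> set b"
  shows "letter x * wd b \<propto> wd b * letter x"
  using assms(2,3)
proof (induction rule: lists.induct)
  case Nil
  show ?case using assms(1) by (simp add: prop_to_refl)
next
  case (Cons y b)
  have "letter x * letter y \<propto> letter y * letter x"
  proof (cases "gen_idx x = gen_idx y")
    case True
    then have "x = y" using same_gen_idx Cons assms(1) by auto
    then show ?thesis using assms(1) by (simp add: prop_to_refl free_on_mult)
  next
    case False
    then show ?thesis using letter_commute Cons assms(1) by blast
  qed
  then show ?case unfolding wd_Cons
    using Cons assms(1) G_wd by (intro prop_to_swap_mult) simp_all
qed

text \<open>Two letters of a reduced word are equal or have different indices, so all of them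
  commute up to scalars and only their multiplicities matter.\<close>

lemma reduced_mset_prop_to:
  assumes "reduced u" "u \<in> lists (pol_gens n m)" "mset u = mset v"
  shows "wd u \<propto> wd v"
  using assms
proof (induction u arbitrary: v rule: list.induct)
  case Nil
  then show ?case by (simp add: prop_to_refl)
next
  case (Cons x u)
  then have "x \<in> set v" by (metis list.set_intros(1) set_mset_mset)
  then obtain b c where v: "v = b @ x # c" by (meson split_list)
  have ms: "mset u = mset (b @ c)" using Cons.prems(3) v by simp
  have "set (x # u) = set v" using Cons.prems(3) by (metis set_mset_mset)
  then have b: "b \<in> lists (pol_gens n m)" "gen_star x \<notin> set b" and c: "c \<in> lists (pol_gens n m)"
    using Cons.prems(1,2) v by (auto simp: reduced_def lists_eq_set)
  have x: "x \<in> pol_gens n m" using Cons.prems(2) by simp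
  have "letter x * wd u \<propto> letter x * wd (b @ c)"
    using Cons.prems ms x by (intro prop_to_mult_left Cons.IH) (auto simp: reduced_def)
  also have "\<dots> = letter x * wd b * wd c" by (simp add: wd_append mult.assoc)
  also have "\<dots> \<propto> wd b * letter x * wd c"
    using b c x by (intro prop_to_mult_right letter_past_word G_wd)
  finally show ?case by (simp add: v wd_append wd_Cons mult.assoc)
qed

text \<open>The letters in \<open>b\<close> have an index different from that of \<open>x\<close>, so \<open>x\<close> can be moved past them.\<close>

lemma not_reduced_split:
  assumes "\<not> reduced u" "\<And>x. x \<in> set u \<Longrightarrow> gen_star x \<noteq> x"
  obtains a x b c where "u = a @ x # b @ gen_star x # c" "x \<notin> set b" "gen_star x \<notin> set b"
  using assms
proof (induction u arbitrary: thesis)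
  case Nil
  then show ?case by (simp add: reduced_def)
next
  case (Cons y u)
  show ?case
  proof (cases "reduced u")
    case False
    with Cons.prems(3) obtain a x b c where "u = a @ x # b @ gen_star x # c" "x \<notin> set b" "gen_star x \<notin> set b"
      using Cons.IH by (metis list.set_intros(2))
    then show ?thesis using Cons.prems(1)[of "y # a" x b c] by simp
  next
    case True
    then have "gen_star y \<in> set u"
      using Cons.prems(2,3) unfolding reduced_def by (metis gen_star_gen_star set_ConsD)
    then obtain b c where u: "u = b @ gen_star y # c" "gen_star y \<notin> set b" by (meson split_list_first)
    then have "y \<notin> set b" using True by (auto simp: reduced_def)
    then show ?thesis using Cons.prems(1)[of "[]" y b c] u by simp
  qed
qed

text \<open>The grading in which each t_j has degree 1 and its adjoint degree -1; the balance
  condition on the exponents says that the degree is 0.\<close>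

definition weight :: "gen list \<Rightarrow> int" where
  "weight u = (\<Sum>x\<leftarrow>u. case x of Gen _ \<Rightarrow> 1 | GenStar _ \<Rightarrow> - 1 | Fin _ \<Rightarrow> 0)"

lemma weight_simps [simp]:
  "weight [] = 0" "weight (Gen j # u) = 1 + weight u" "weight (GenStar j # u) = weight u - 1"
  "weight (Fin g # u) = weight u" "weight (u @ v) = weight u + weight v"
  by (simp_all add: weight_def)

lemma weight_gen_star: "weight [gen_star x] = - weight [x]"
  by (cases x) simp_all

lemma weight_Cons: "weight (x # u) = weight [x] + weight u"
  using weight_simps(5)[of "[x]" u] by simp

lemma weight_rev_map: "weight (rev (map gen_star u)) = - weight u"
proof (induction u)
  case (Cons x u)
  then show ?case by (cases x) simp_all
qed simp

lemma weight_mset: "mset u = mset v \<Longrightarrow> weight u = weight v"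
  unfolding weight_def by (metis (no_types, lifting) mset_map sum_mset_sum_list)

lemma weight_concat_replicate:
  "weight (concat (map (\<lambda>k. replicate (f k) (C k)) ks)) = (\<Sum>k\<leftarrow>ks. int (f k) * weight [C k])"
proof -
  have "weight (replicate r x) = int r * weight [x]" for r x
    by (induction r) (simp_all add: weight_Cons[of x "replicate _ _"] algebra_simps)
  then show ?thesis by (induction ks) simp_all
qed

definition left_word :: "(nat \<Rightarrow> nat) \<Rightarrow> gen list" where
  "left_word I = concat (map (\<lambda>k. replicate (I k) (Gen k)) [1..<n+1]) @
    concat (map (\<lambda>k. replicate (I k) (GenStar k)) [n+1..<n+m+1])"

definition right_word :: "(nat \<Rightarrow> nat) \<Rightarrow> gen list" where
  "right_word J = concat (map (\<lambda>k. replicate (J k) (Gen k)) (rev [n+1..<n+m+1])) @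
    concat (map (\<lambda>k. replicate (J k) (GenStar k)) (rev [1..<n+1]))"

lemma wd_left_word: "wd (left_word I) =
    prod_list (map (\<lambda>k. t k ^ I k) [1..<n+1]) * prod_list (map (\<lambda>k. ts k ^ I k) [n+1..<n+m+1])"
  by (simp only: left_word_def wd_append wd_concat map_map comp_def wd_replicate)

lemma wd_right_word: "wd (right_word J) =
    prod_list (map (\<lambda>k. t k ^ J k) (rev [n+1..<n+m+1])) * prod_list (map (\<lambda>k. ts k ^ J k) (rev [1..<n+1]))"
  by (simp only: right_word_def wd_append wd_concat map_map comp_def wd_replicate)

lemma D_monom_eq: "D_monom n m I J K g = wd (left_word I) * mid K g * wd (right_word J)"
  unfolding D_monom_def wd_left_word wd_right_word mid_def by (simp only: mult.assoc)

lemma left_word_lists: "left_word I \<in> lists (pol_gens n m)"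
  and right_word_lists: "right_word J \<in> lists (pol_gens n m)"
  by (auto simp: left_word_def right_word_def pol_gens_def lists_eq_set)

lemma weight_left_right:
  "weight (left_word I @ right_word J) =
    int ((\<Sum>k=1..n. I k) + (\<Sum>k=n+1..n+m. J k)) - int ((\<Sum>k=1..n. J k) + (\<Sum>k=n+1..n+m. I k))"
proof -
  have s: "(\<Sum>k\<leftarrow>[a..<b+1]. f k) = (\<Sum>k=a..b. f k)" for a b and f :: "nat \<Rightarrow> int"
    by (simp only: interv_sum_list_conv_sum_set_nat set_upt Suc_eq_plus1[symmetric] atLeastLessThanSuc_atLeastAtMost)
  have r: "(\<Sum>k\<leftarrow>rev ks. f k) = (\<Sum>k\<leftarrow>ks. f k)" for f :: "nat \<Rightarrow> int" and ks
    by (simp add: rev_map[symmetric] sum_list_rev)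
  show ?thesis
    unfolding left_word_def right_word_def weight_simps(5) weight_concat_replicate r s
    by (simp add: sum_negf)
qed

lemma count_list_concat_replicate:
  assumes "distinct ks" "inj C"
  shows "count_list (concat (map (\<lambda>k. replicate (f k) (C k)) ks)) (C l) = (if l \<in> set ks then f l else 0)"
proof -
  have r: "count_list (replicate r x) y = (if x = y then r else 0)" for r and x y :: 'b
    by (induction r) auto
  show ?thesis using assms(1)
    by (induction ks) (auto simp: r inj_eq[OF assms(2)])
qed

lemma inj_Gen: "inj Gen" and inj_GenStar: "inj GenStar"
  by (auto intro: injI)

lemma count_left_right:
  "count_list (left_word I @ right_word J) (Gen k) =
    (if k \<in> {1..n} then I k else if k \<in> {n+1..n+m} then J k else 0)"
  "count_list (left_word I @ right_word J) (GenStar k) =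
    (if k \<in> {1..n} then J k else if k \<in> {n+1..n+m} then I k else 0)"
  unfolding left_word_def right_word_def count_list_append
  by (auto simp: count_list_concat_replicate inj_Gen inj_GenStar
      simp del: upt_Suc)

lemma reduced_normal_form:
  assumes "reduced u" "u \<in> lists (pol_gens n m)"
  obtains I J where "mset u = mset (left_word I @ right_word J)" "\<forall>k\<in>{1..n+m}. I k * J k = 0"
proof -
  \<comment> \<open>The left word carries t_k for k \<le> n but the adjoint of t_k for k > n, hence
    the exchanged roles of the two counts.\<close>
  define I where "I k = (if k \<le> n then count_list u (Gen k) else count_list u (GenStar k))" for k
  define J where "J k = (if k \<le> n then count_list u (GenStar k) else count_list u (Gen k))" for k
  have z: "x \<notin> pol_gens n m \<Longrightarrow> count_list u x = 0" for x
    using assms(2) by (intro count_notin) (auto simp: lists_eq_set)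
  have z': "count_list u (Gen k) = 0" "count_list u (GenStar k) = 0" if "k \<notin> {1..n+m}" for k
    by (rule z; use that in \<open>auto simp: pol_gens_def\<close>)+
  have "mset u = mset (left_word I @ right_word J)"
  proof (rule multiset_eqI)
    fix x
    have "count_list u x = count_list (left_word I @ right_word J) x"
    proof (cases x)
      case (Gen k)
      then show ?thesis unfolding Gen count_left_right using z'[of k] by (auto simp: I_def J_def)
    next
      case (GenStar k)
      then show ?thesis unfolding GenStar count_left_right using z'[of k] by (auto simp: I_def J_def)
    next
      case (Fin g)
      have "x \<notin> pol_gens n m" using Fin by (auto simp: pol_gens_def)
      moreover have "count_list (left_word I @ right_word J) x = 0"
        using \<open>x \<notin> pol_gens n m\<close> left_word_lists[of I] right_word_lists[of J]
        by (intro count_notin) (auto simp: lists_eq_set)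
      ultimately show ?thesis using z by simp
    qed
    then show "count (mset u) x = count (mset (left_word I @ right_word J)) x"
      by (simp only: count_mset)
  qed
  moreover have cz: "count_list u (Gen k) = 0 \<or> count_list u (GenStar k) = 0" for k
    using assms(1) unfolding reduced_def count_list_0_iff by (metis gen_star.simps(1))
  have "I k * J k = 0" for k using cz[of k] by (auto simp: I_def J_def)
  then have "\<forall>k\<in>{1..n+m}. I k * J k = 0" by blast
  ultimately show ?thesis using that by blast
qed

definition D_span :: "gen free set" where
  "D_span = {\<Sum>x\<in>S. const (c x) * x | S c. finite S \<and> S \<subseteq> D_monoms q n m}"

lemma D_span_monom: "x \<in> D_monoms q n m \<Longrightarrow> const c * x \<in> D_span"
  unfolding D_span_def mem_Collect_eq
  by (intro exI[of _ "{x}"] exI[of _ "\<lambda>_. c"]) simp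

lemma D_span_add:
  assumes "a \<in> D_span" "b \<in> D_span"
  shows "a + b \<in> D_span"
proof -
  obtain S c T d where a: "a = (\<Sum>x\<in>S. const (c x) * x)" "finite S" "S \<subseteq> D_monoms q n m"
    and b: "b = (\<Sum>x\<in>T. const (d x) * x)" "finite T" "T \<subseteq> D_monoms q n m"
    using assms unfolding D_span_def by blast
  define e where "e x = (if x \<in> S then c x else 0) + (if x \<in> T then d x else 0)" for x
  have "a = (\<Sum>x\<in>S \<union> T. const (if x \<in> S then c x else 0) * x)"
    unfolding a by (rule sum.mono_neutral_cong_left) (use a b in auto)
  moreover have "b = (\<Sum>x\<in>S \<union> T. const (if x \<in> T then d x else 0) * x)"
    unfolding b by (rule sum.mono_neutral_cong_left) (use a b in auto)
  ultimately have "a + b = (\<Sum>x\<in>S \<union> T. const (e x) * x)"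
    by (simp only: e_def const_add distrib_right sum.distrib)
  then show ?thesis unfolding D_span_def using a b by blast
qed

lemma D_span_0: "0 \<in> D_span"
  unfolding D_span_def mem_Collect_eq by (intro exI[of _ "{}"]) simp

lemma D_span_const_mult:
  assumes "a \<in> D_span"
  shows "const c * a \<in> D_span"
proof -
  obtain S d where a: "a = (\<Sum>x\<in>S. const (d x) * x)" "finite S" "S \<subseteq> D_monoms q n m"
    using assms unfolding D_span_def by blast
  have "const c * a = (\<Sum>x\<in>S. const (c * d x) * x)"
    unfolding a by (simp add: sum_distrib_left const_times mult.assoc)
  then show ?thesis unfolding D_span_def using a
    by (intro CollectI exI[of _ S] exI[of _ "\<lambda>x. c * d x"]) simp
qed

text \<open>The representatives of elements of \<open>D\<close>. Being closed under sums, scalars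
  and equivalence, this set is a suitable target for rewriting.\<close>

definition NF :: "gen free set" where
  "NF = {a. \<exists>b\<in>D_span. a \<approx> b}"

lemma NF_add: "a \<in> NF \<Longrightarrow> b \<in> NF \<Longrightarrow> a + b \<in> NF"
  unfolding NF_def using eqv_add D_span_add by blast

lemma NF_const_mult: "a \<in> NF \<Longrightarrow> const c * a \<in> NF"
  unfolding NF_def using eqv_const D_span_const_mult by blast

lemma NF_eqv: "a \<approx> b \<Longrightarrow> b \<in> NF \<Longrightarrow> a \<in> NF"
  unfolding NF_def using eqv_trans by blast

lemma NF_prop_to: "a \<propto> b \<Longrightarrow> b \<in> NF \<Longrightarrow> a \<in> NF"
  unfolding prop_to_def using NF_const_mult NF_eqv by blast

lemma NF_0: "0 \<in> NF"
  unfolding NF_def using D_span_0 by (auto intro!: bexI[of _ 0] eqv_refl)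

lemma reduced_word_mid_NF:
  assumes "reduced u" "u \<in> lists (pol_gens n m)" "weight u = 0" "g \<in> fin_funs q"
  shows "wd u * mid K g \<in> NF"
proof -
  obtain I J where IJ: "mset u = mset (left_word I @ right_word J)" "\<forall>k\<in>{1..n+m}. I k * J k = 0"
    using reduced_normal_form[OF assms(1,2)] by blast
  obtain g' where g': "g' \<in> fin_funs q" "wd (right_word J) * mid K g \<propto> mid K g' * wd (right_word J)"
    using word_mid[OF right_word_lists assms(4)] by blast
  let ?x = "D_monom n m I J K g'"
  have "wd u * mid K g \<propto> wd (left_word I @ right_word J) * mid K g"
    using assms IJ(1) by (intro prop_to_mult_right reduced_mset_prop_to) auto
  also have "\<dots> = wd (left_word I) * (wd (right_word J) * mid K g)"
    by (simp add: wd_append mult.assoc)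
  also have "\<dots> \<propto> wd (left_word I) * (mid K g' * wd (right_word J))"
    using g'(2) by (intro prop_to_mult_left G_wd left_word_lists)
  also have "\<dots> = ?x" by (simp add: D_monom_eq mult.assoc)
  finally have p: "wd u * mid K g \<propto> ?x" .
  have "weight (left_word I @ right_word J) = 0" using weight_mset[OF IJ(1)] assms(3) by simp
  then have "(\<Sum>k=1..n. I k) + (\<Sum>k=n+1..n+m. J k) = (\<Sum>k=1..n. J k) + (\<Sum>k=n+1..n+m. I k)"
    unfolding weight_left_right by linarith
  then have "?x \<in> D_monoms q n m" unfolding D_monoms_def using g'(1) IJ(2) by blast
  then have "?x \<in> D_span" using D_span_monom[of ?x 1] by simp
  then have "?x \<in> NF" unfolding NF_def using eqv_refl prop_to_carrier(2)[OF p] by blast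
  then show ?thesis using p NF_prop_to by blast
qed

text \<open>\<open>K\<close> and \<open>g\<close> vary in the induction: deleting a pair
  \<open>x\<close>, \<open>gen_star x\<close> leaves \<xi>_k or \<xi>_{k+1}, which the middle factor
  absorbs. The pair has total weight 0, so the shorter word is still balanced.\<close>

lemma word_mid_NF:
  assumes "u \<in> lists (pol_gens n m)" "weight u = 0" "g \<in> fin_funs q"
  shows "wd u * mid K g \<in> NF"
  using assms
proof (induction "length u" arbitrary: u K g rule: less_induct)
  case less
  show ?case
  proof (cases "reduced u")
    case True
    then show ?thesis using reduced_word_mid_NF less.prems by blast
  next
    case False
    have "gen_star x \<noteq> x" if "x \<in> set u" for x
    proof -
      have "x \<in> pol_gens n m" using that less.prems(1) by (auto simp: lists_eq_set)
      then show ?thesis by (auto simp: pol_gens_def)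
    qed
    then obtain a x b c where u: "u = a @ x # b @ gen_star x # c" "gen_star x \<notin> set b"
      using not_reduced_split[OF False] by metis
    have L: "a \<in> lists (pol_gens n m)" "b \<in> lists (pol_gens n m)" "c \<in> lists (pol_gens n m)"
      "x \<in> pol_gens n m" "gen_star x \<in> pol_gens n m"
      using less.prems(1) u by auto
    define k where "k = gen_idx x"
    have k: "k \<in> {1..n+m}" and xk: "x = Gen k \<or> x = GenStar k"
      using L(4) by (auto simp: k_def pol_gens_def)
    then obtain \<alpha> \<beta> where \<alpha>\<beta>:
      "letter x * letter (gen_star x) \<approx> const \<alpha> * xi n m k + const \<beta> * xi n m (k + 1)"
      using t_ts_conv_xi[OF k] ts_t_conv_xi[OF k] by auto
    let ?v = "a @ b @ c"
    have w: "weight ?v = 0"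
      using less.prems(2) u by (simp add: weight_Cons[of x "_ @ _"] weight_Cons[of "gen_star x" c] weight_gen_star)
    let ?M = "mid K g"
    have "wd u * ?M = wd a * (letter x * wd b) * (letter (gen_star x) * wd c * ?M)"
      by (simp add: u wd_append wd_Cons mult.assoc)
    also have "\<dots> \<propto> wd a * (wd b * letter x) * (letter (gen_star x) * wd c * ?M)"
      using L u(2) less.prems(3)
      by (intro prop_to_mult_right prop_to_mult_left letter_past_word G_wd) (auto intro!: free_on_mult G_wd)
    also have "\<dots> = wd (a @ b) * (letter x * letter (gen_star x)) * (wd c * ?M)"
      by (simp add: wd_append mult.assoc)
    finally have 1: "wd u * ?M \<propto> wd (a @ b) * (letter x * letter (gen_star x)) * (wd c * ?M)" .
    have xi_NF: "wd (a @ b) * xi n m l * (wd c * ?M) \<in> NF" if l: "1 \<le> l" "l \<le> n + m + 1" for l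
    proof -
      obtain K' g' where g': "g' \<in> fin_funs q" "xi n m l * ?M \<propto> mid K' g'"
        using xi_mid[OF less.prems(3) l] by blast
      have "wd (a @ b) * xi n m l * (wd c * ?M) = wd (a @ b) * (xi n m l * wd c) * ?M"
        by (simp add: mult.assoc)
      also have "\<dots> \<propto> wd (a @ b) * (wd c * xi n m l) * ?M"
        using L l less.prems(3) by (intro prop_to_mult_right prop_to_mult_left xi_word G_wd) auto
      also have "\<dots> = wd ?v * (xi n m l * ?M)" by (simp add: wd_append mult.assoc)
      also have "\<dots> \<propto> wd ?v * mid K' g'"
        using L g'(2) by (intro prop_to_mult_left G_wd) auto
      finally have "wd (a @ b) * xi n m l * (wd c * ?M) \<propto> wd ?v * mid K' g'" .
      moreover have "wd ?v * mid K' g' \<in> NF"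
        using L w g'(1) u(1) by (intro less.hyps) auto
      ultimately show ?thesis using NF_prop_to by blast
    qed
    have "wd (a @ b) * (letter x * letter (gen_star x)) * (wd c * ?M) \<approx>
        wd (a @ b) * (const \<alpha> * xi n m k + const \<beta> * xi n m (k + 1)) * (wd c * ?M)"
      using L less.prems(3) by (intro eqv_mult_right eqv_mult_left \<alpha>\<beta> G_wd) (auto intro!: free_on_mult G_wd)
    also have "\<dots> = const \<alpha> * (wd (a @ b) * xi n m k * (wd c * ?M)) +
        const \<beta> * (wd (a @ b) * xi n m (k + 1) * (wd c * ?M))"
      by (simp only: distrib_left distrib_right mult.assoc const_left_commute[of "wd _"])
    finally have "wd (a @ b) * (letter x * letter (gen_star x)) * (wd c * ?M) \<in> NF"
      using k by (elim NF_eqv) (auto intro!: NF_add NF_const_mult xi_NF)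
    then show ?thesis using 1 NF_prop_to by blast
  qed
qed

lemma fin_word:
  assumes "u \<in> lists (pol_gens n m)" "g \<in> fin_funs q"
  shows "\<exists>g'\<in>fin_funs q. fin g * wd u \<propto> wd u * fin g'"
  using assms
proof (induction arbitrary: g rule: lists.induct)
  case Nil
  then show ?case by (intro bexI[of _ g]) (simp_all add: prop_to_refl)
next
  case (Cons x u)
  obtain g' where g': "g' \<in> fin_funs q" "fin g * letter x \<approx> letter x * fin g'"
    using fin_letter Cons by blast
  then obtain g'' where g'': "g'' \<in> fin_funs q" "fin g' * wd u \<propto> wd u * fin g''"
    using Cons.IH by blast
  have "fin g * letter x * wd u \<propto> letter x * fin g' * wd u"
    using Cons g' by (intro prop_to_mult_right eqv_imp_prop_to G_wd) auto
  also have "\<dots> = letter x * (fin g' * wd u)" by (simp add: mult.assoc)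
  also have "\<dots> \<propto> letter x * (wd u * fin g'')"
    using Cons g'' by (intro prop_to_mult_left) auto
  finally show ?case using g''(1) by (auto simp: wd_Cons mult.assoc)
qed

text \<open>Finite functions move to the right end at the price of a rescaling, and several of them
  merge into their pointwise product. Removing them leaves the weight unchanged, as
  \<open>Fin g\<close> has degree 0.\<close>

lemma collect_fin:
  assumes "w \<in> lists (fun_gens q n m)"
  shows "w \<in> lists (pol_gens n m) \<or>
    (\<exists>u\<in>lists (pol_gens n m). \<exists>g\<in>fin_funs q. weight u = weight w \<and> wd w \<propto> wd u * fin g)"
  using assms
proof (induction rule: lists.induct)
  case (Cons x w)
  show ?case
  proof (cases "x \<in> pol_gens n m")
    case True
    from Cons.IH show ?thesis
    proof (elim disjE bexE conjE)
      assume "w \<in> lists (pol_gens n m)"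
      then show ?thesis using True by simp
    next
      fix u g assume u: "u \<in> lists (pol_gens n m)" "g \<in> fin_funs q" "weight u = weight w" "wd w \<propto> wd u * fin g"
      have "wd (x # w) \<propto> wd (x # u) * fin g"
        unfolding wd_Cons mult.assoc using True u(4) by (intro prop_to_mult_left) auto
      moreover have "x # u \<in> lists (pol_gens n m)" using True u by simp
      moreover have "weight (x # u) = weight (x # w)" using u(3) weight_Cons by metis
      ultimately show ?thesis using u(2) by blast
    qed
  next
    case False
    then obtain h where h: "x = Fin h" "h \<in> fin_funs q" using Cons.hyps by (auto simp: fun_gens_def)
    from Cons.IH show ?thesis
    proof (elim disjE bexE conjE)
      assume w: "w \<in> lists (pol_gens n m)"
      then obtain h' where "h' \<in> fin_funs q" "fin h * wd w \<propto> wd w * fin h'"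
        using fin_word h(2) by blast
      then show ?thesis using w h by (auto simp: wd_Cons)
    next
      fix u g assume u: "u \<in> lists (pol_gens n m)" "g \<in> fin_funs q" "weight u = weight w" "wd w \<propto> wd u * fin g"
      obtain h' where h': "h' \<in> fin_funs q" "fin h * wd u \<propto> wd u * fin h'"
        using fin_word u(1) h(2) by blast
      have "fin h * wd w \<propto> fin h * (wd u * fin g)" using u(4) h(2) by (intro prop_to_mult_left) auto
      also have "\<dots> = fin h * wd u * fin g" by (simp add: mult.assoc)
      also have "\<dots> \<propto> wd u * fin h' * fin g" using h'(2) u(2) by (intro prop_to_mult_right) auto
      also have "\<dots> = wd u * (fin h' * fin g)" by (simp add: mult.assoc)
      also have "\<dots> \<propto> wd u * fin (\<lambda>x. h' x * g x)"
        using h'(1) u by (intro prop_to_mult_left eqv_imp_prop_to fin_fin G_wd)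
      finally have "wd (x # w) \<propto> wd u * fin (\<lambda>x. h' x * g x)" by (simp add: h(1) wd_Cons)
      moreover have "(\<lambda>x. h' x * g x) \<in> fin_funs q" using h'(1) by (rule fin_funs_closed)
      moreover have "weight u = weight (x # w)" using u(3) h(1) by simp
      ultimately show ?thesis using u(1) by blast
    qed
  qed
qed simp

definition D_words :: "gen list set" where
  "D_words = {w \<in> lists (fun_gens q n m). (\<exists>g. Fin g \<in> set w) \<and> weight w = 0}"

lemma D_words_NF:
  assumes "a \<in> words_in D_words"
  shows "a \<in> NF"
  using assms
proof (induction rule: words_in_induct)
  case zero
  show ?case by (rule NF_0)
next
  case (add w c a)
  have "w \<notin> lists (pol_gens n m)" using add.hyps by (auto simp: D_words_def pol_gens_def)
  then obtain u g where u: "u \<in> lists (pol_gens n m)" "g \<in> fin_funs q" "weight u = weight w" "wd w \<propto> wd u * fin g"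
    using collect_fin[of w] add.hyps by (auto simp: D_words_def)
  have "fin g = mid (\<lambda>_. 0) g" by (simp add: mid_def)
  then have "wd u * fin g \<in> NF" using word_mid_NF[of u g "\<lambda>_. 0"] u add.hyps by (simp add: D_words_def)
  then have "wd w \<in> NF" using u(4) NF_prop_to by blast
  then show ?case using add.IH by (intro NF_add NF_const_mult)
qed

text \<open>Counterpart of \<open>D_words_NF\<close>. A monomial is not a single word, since each
  \<xi>_k is a sum of words; the factors are therefore tracked through the sets containing all their
  words.\<close>

lemma D_monoms_subset: "D_monoms q n m \<subseteq> words_in D_words"
proof
  fix x assume "x \<in> D_monoms q n m"
  then obtain I J K g where x: "x = D_monom n m I J K g" and g: "g \<in> fin_funs q"
    and s: "(\<Sum>k=1..n. I k) + (\<Sum>k=n+1..n+m. J k) = (\<Sum>k=1..n. J k) + (\<Sum>k=n+1..n+m. I k)"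
    unfolding D_monoms_def by blast
  \<comment> \<open>Weight 0 without a finite function, to accommodate the powers of the
    \<xi>_k.\<close>
  let ?Z = "{w \<in> lists (fun_gens q n m). weight w = 0}"
  have Zm: "a * b \<in> words_in ?Z" if "a \<in> words_in ?Z" "b \<in> words_in ?Z" for a b
    by (rule words_in_mult[OF that]) auto
  have Z1: "1 \<in> words_in ?Z" using words_in_wd[of "[]" ?Z] by simp
  have tts: "t k * ts k \<in> words_in ?Z" if "k \<in> {1..n+m}" for k
    using that words_in_wd[of "[Gen k, GenStar k]" ?Z]
    by (simp add: wd_Cons fun_gens_def pol_gens_def)
  have Zx: "xi n m k \<in> words_in ?Z" if "1 \<le> k" for k
    unfolding xi_def using that tts
    by (cases "n < k") (auto intro!: words_in_sum words_in_diff)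
  have Zp: "prod_list (map (\<lambda>k. xi n m k ^ K k) ks) \<in> words_in ?Z" if "\<And>k. k \<in> set ks \<Longrightarrow> 1 \<le> k" for ks
  proof -
    have "xi n m k ^ r \<in> words_in ?Z" if "1 \<le> k" for k r
      by (induction r) (use Z1 Zm[OF Zx[OF that]] in simp_all)
    then show ?thesis using that by (induction ks) (simp_all add: Z1 Zm)
  qed
  have f: "fin g \<in> words_in D_words"
    using g by (simp add: letter_conv_wd words_in_wd D_words_def fun_gens_def)
  have P: "prod_list (map (\<lambda>k. xi n m k ^ K k) [2..<n+1]) \<in> words_in ?Z"
    "prod_list (map (\<lambda>k. xi n m k ^ K k) [n+2..<n+m+1]) \<in> words_in ?Z"
    by (auto intro!: Zp simp del: upt_Suc)
  have M: "mid K g \<in> words_in D_words" unfolding mid_def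
    by (rule words_in_mult[OF words_in_mult[OF P(1) f, of D_words] P(2)]) (auto simp: D_words_def)
  \<comment> \<open>The left word alone need not be balanced; its weight is carried along until the
    right word cancels it.\<close>
  let ?W = "{w \<in> lists (fun_gens q n m). (\<exists>g. Fin g \<in> set w) \<and> weight w = weight (left_word I)}"
  have LM: "wd (left_word I) * mid K g \<in> words_in ?W"
    by (rule words_in_mult[of _ "{left_word I}", OF _ M])
      (use left_word_lists[of I] pol_gens_subset_fun_gens[of n m q] in \<open>auto simp: words_in_wd D_words_def lists_eq_set\<close>)
  have "weight (left_word I @ right_word J) = 0"
    unfolding weight_left_right using s by linarith
  then have w: "weight (left_word I) + weight (right_word J) = 0" by simp
  show "x \<in> words_in D_words" unfolding x D_monom_eq
    by (rule words_in_mult[OF LM, of _ "{right_word J}"])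
      (use right_word_lists[of J] pol_gens_subset_fun_gens[of n m q] w in \<open>auto simp: words_in_wd D_words_def lists_eq_set\<close>)
qed

lemma D_words_subset_G: "words_in D_words \<subseteq> G"
  by (auto simp: words_in_def D_words_def)

lemma D_span_subset: "D_span \<subseteq> words_in D_words"
  unfolding D_span_def using D_monoms_subset
  by (auto intro!: words_in_sum words_in_const_mult)

lemma carrier_D: "carrier (D q n m) = Fun.cls ` words_in D_words"
proof -
  have "carrier (D q n m) = Fun.cls ` D_span"
    unfolding D_def fun_class_eq D_span_def by auto
  also have "\<dots> = Fun.cls ` words_in D_words"
  proof
    show "Fun.cls ` words_in D_words \<subseteq> Fun.cls ` D_span"
    proof safe
      fix a assume "a \<in> words_in D_words"
      then obtain b where "b \<in> D_span" "a \<approx> b" using D_words_NF unfolding NF_def by blast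
      then show "Fun.cls a \<in> Fun.cls ` D_span" by (auto simp: eqv_def Fun.cls_eq_iff)
    qed
  qed (use D_span_subset in blast)
  finally show ?thesis .
qed

lemma D_eq: "D q n m = Fun.Q\<lparr>carrier := Fun.cls ` words_in D_words\<rparr>"
proof -
  have "D q n m = Fun.Q\<lparr>carrier := carrier (D q n m)\<rparr>"
    by (simp add: D_def Fun_eq)
  then show ?thesis by (simp only: carrier_D)
qed

lemma star_algebra_D: "star_algebra (D q n m)"
  unfolding D_eq
proof (rule Fun.star_algebra_sub)
  fix a b assume "a \<in> words_in D_words" "b \<in> words_in D_words"
  then show "a * b \<in> words_in D_words" by (rule words_in_mult) (auto simp: D_words_def)
next
  fix a assume "a \<in> words_in D_words"
  then show "star_free gen_star a \<in> words_in D_words"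
  proof (rule words_in_star_free)
    fix w assume "w \<in> D_words"
    then have "set (map gen_star w) \<subseteq> fun_gens q n m"
      using gen_star_fun_gens[of q n m] by (auto simp: D_words_def)
    moreover have "\<exists>g. Fin g \<in> set (map gen_star w)"
    proof -
      obtain g where "Fin g \<in> set w" using \<open>w \<in> D_words\<close> by (auto simp: D_words_def)
      then have "gen_star (Fin g) \<in> set (map gen_star w)" by (metis imageI set_map)
      then show ?thesis by auto
    qed
    ultimately show "rev (map gen_star w) \<in> D_words"
      using \<open>w \<in> D_words\<close> by (auto simp: D_words_def weight_rev_map lists_eq_set)
  qed
qed (use D_words_subset_G in \<open>auto intro: words_in_add words_in_const_mult\<close>)

end

section \<open>Faithfulness\<close>

text \<open>Consists of lower bounds only: once the earlier entries are fixed, the next one ranges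
  over a whole half line, which is enough to force a polynomial to be zero.\<close>

fun gap_chain :: "int \<Rightarrow> int \<Rightarrow> nat list \<Rightarrow> (nat \<Rightarrow> int) \<Rightarrow> bool" where
  "gap_chain L b [] \<sigma> \<longleftrightarrow> True"
| "gap_chain L b (v # vs) \<sigma> \<longleftrightarrow> b + L \<le> \<sigma> v \<and> gap_chain L (\<sigma> v) vs \<sigma>"

lemma gap_chain_cong: "(\<And>v. v \<in> set vs \<Longrightarrow> \<sigma> v = \<tau> v) \<Longrightarrow> gap_chain L b vs \<sigma> = gap_chain L b vs \<tau>"
  by (induction vs arbitrary: b) simp_all

lemma gap_chain_append:
  "gap_chain L b (us @ vs) \<sigma> \<longleftrightarrow> gap_chain L b us \<sigma> \<and> gap_chain L (if us = [] then b else \<sigma> (last us)) vs \<sigma>"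
  by (induction us arbitrary: b) auto

context quantum_cone
begin

text \<open>Several \<open>a\<close> may share their exponents, so the conclusion is about the sum
  over an exponent class. Fixing the first variable at z leaves the same statement for the others
  with base z; the resulting sums are values at q^(2z) of a polynomial, which thus has infinitely
  many zeros.\<close>

lemma monomials_independent:
  fixes c :: "'a \<Rightarrow> complex" and K :: "'a \<Rightarrow> nat \<Rightarrow> nat"
  assumes "finite A" "distinct vs"
    and "\<And>\<sigma>. gap_chain L b vs \<sigma> \<Longrightarrow>
      (\<Sum>a\<in>A. c a * (\<Prod>k\<in>set vs. of_real (q powi (2 * \<sigma> k)) ^ K a k)) = 0"
  shows "(\<Sum>a | a \<in> A \<and> (\<forall>k\<in>set vs. K a k = \<kappa> k). c a) = 0"
  using assms(2,3)
proof (induction vs arbitrary: b c)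
  case Nil
  then show ?case by simp
next
  case (Cons v vs)
  let ?B = "{a \<in> A. \<forall>k\<in>set vs. K a k = \<kappa> k}"
  define p where "p = (\<Sum>a\<in>?B. Polynomial.monom (c a) (K a v))"
  have root: "poly p (of_real (q powi (2 * z))) = 0" if "b + L \<le> z" for z
  proof -
    have "(\<Sum>a\<in>?B. c a * of_real (q powi (2 * z)) ^ K a v) = 0"
    \<comment> \<open>The power of the fixed variable becomes part of the coefficient, which is why
      \<open>b\<close> and \<open>c\<close> are arbitrary in the induction.\<close>
    proof (rule Cons.IH[where b = z])
      show "distinct vs" using Cons.prems by simp
      fix \<sigma> assume \<sigma>: "gap_chain L z vs \<sigma>"
      define \<tau> where "\<tau> = \<sigma>(v := z)"
      have "gap_chain L z vs \<tau> = gap_chain L z vs \<sigma>"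
        using Cons.prems(1) by (intro gap_chain_cong) (auto simp: \<tau>_def)
      then have "gap_chain L b (v # vs) \<tau>" using \<sigma> that by (simp add: \<tau>_def)
      from Cons.prems(2)[OF this]
      have "(\<Sum>a\<in>A. c a * (\<Prod>k\<in>set (v # vs). of_real (q powi (2 * \<tau> k)) ^ K a k)) = 0" .
      moreover have "(\<Prod>k\<in>set (v # vs). of_real (q powi (2 * \<tau> k)) ^ K a k) =
          complex_of_real (q powi (2 * z)) ^ K a v * (\<Prod>k\<in>set vs. of_real (q powi (2 * \<sigma> k)) ^ K a k)" for a
      proof -
        have "(\<Prod>k\<in>set vs. complex_of_real (q powi (2 * \<tau> k)) ^ K a k) =
            (\<Prod>k\<in>set vs. of_real (q powi (2 * \<sigma> k)) ^ K a k)"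
          using Cons.prems(1) by (intro prod.cong) (auto simp: \<tau>_def)
        then show ?thesis using Cons.prems(1) by (simp add: \<tau>_def)
      qed
      ultimately show "(\<Sum>a\<in>A. c a * of_real (q powi (2 * z)) ^ K a v *
          (\<Prod>k\<in>set vs. of_real (q powi (2 * \<sigma> k)) ^ K a k)) = 0"
        by (simp only: mult.assoc)
    qed
    then show ?thesis by (simp add: p_def poly_sum poly_monom)
  qed
  have "p = 0"
  proof (rule ccontr)
    assume "p \<noteq> 0"
    then have "finite {x. poly p x = 0}" by (rule poly_roots_finite)
    moreover have "(\<lambda>z. complex_of_real (q powi (2 * z))) ` {b + L..} \<subseteq> {x. poly p x = 0}"
      using root by auto
    moreover have "inj_on (\<lambda>z. complex_of_real (q powi (2 * z))) {b + L..}"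
      by (rule inj_onI) (simp add: powi_inj del: of_real_power_int)
    ultimately have "finite {b + L..}" using finite_imageD finite_subset by blast
    then show False by (simp add: infinite_Ici)
  qed
  then have "coeff p (\<kappa> v) = 0" by simp
  moreover have "coeff p (\<kappa> v) = (\<Sum>a\<in>?B. if K a v = \<kappa> v then c a else 0)"
    by (simp add: p_def coeff_sum)
  moreover have "\<dots> = (\<Sum>a | a \<in> A \<and> (\<forall>k\<in>set (v # vs). K a k = \<kappa> k). c a)"
    using assms(1) by (subst sum.If_cases) (auto intro!: sum.cong)
  ultimately show ?case by simp
qed

text \<open>
  Labels so far from the boundary of \<^term>\<open>idx n m\<close> that words of length at most \<open>r\<close> act on them
  without annihilation.
\<close>

definition generic :: "int \<Rightarrow> (nat \<Rightarrow> int) \<Rightarrow> bool" where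
  "generic r i \<longleftrightarrow> (\<forall>k. k \<notin> {1..<n+m} \<longrightarrow> i k = 0) \<and> (\<forall>k\<in>{2..n}. i k \<le> - r) \<and>
    (\<forall>k\<in>{n+1..<n+m}. r + 1 \<le> i k)"

lemma generic_idx: "generic r i \<Longrightarrow> 0 \<le> r \<Longrightarrow> i \<in> idx n m"
  unfolding generic_def idx_def by fastforce

lemma generic_mono: "generic r i \<Longrightarrow> r' \<le> r \<Longrightarrow> generic r' i"
  unfolding generic_def by fastforce

text \<open>Net displacement of the label. Its value at N is 0 even if t_N or its adjoint occurs in
  the word, because these act diagonally.\<close>

definition word_shift :: "gen list \<Rightarrow> nat \<Rightarrow> int" where
  "word_shift w k = (if k \<in> {1..<n+m} then int (count_list w (GenStar k)) - int (count_list w (Gen k)) else 0)"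

lemma word_shift_append: "word_shift (v @ w) k = word_shift v k + word_shift w k"
  by (simp add: word_shift_def)

lemma abs_word_shift: "\<bar>word_shift w k\<bar> \<le> int (length w)"
  using count_le_length[of w "Gen k"] count_le_length[of w "GenStar k"]
  unfolding word_shift_def by auto

lemma generic_word_shift:
  assumes "generic r i" "\<And>k. \<bar>d k\<bar> \<le> l" "\<And>k. k \<notin> {1..<n+m} \<Longrightarrow> d k = 0"
  shows "generic (r - l) (\<lambda>k. i k + d k)"
proof -
  have "- l \<le> d k" "d k \<le> l" for k using assms(2)[of k] by linarith+
  then show ?thesis using assms(1,3) unfolding generic_def by (smt (verit))
qed

lemma word_shift_outside: "k \<notin> {1..<n+m} \<Longrightarrow> word_shift w k = 0"
  by (auto simp: word_shift_def)

lemma amp_nonzero: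
  assumes "1 < j \<Longrightarrow> j < n + m \<Longrightarrow> z \<noteq> 1"
  shows "1 \<le> j \<Longrightarrow> amp j z \<noteq> 0"
proof -
  have "q powi (2 * (z - 1)) \<noteq> 1" if "z \<noteq> 1"
    using powi_inj[of "2 * (z - 1)" 0] that by simp
  then show "1 \<le> j \<Longrightarrow> amp j z \<noteq> 0" using assms m_ge_2 n_pos by (auto simp: amp_def)
qed

text \<open>The dangerous values are \<open>i j = 1\<close> for \<open>t j\<close> and
  \<open>i j = 0\<close> for \<open>ts j\<close>; one unit of distance avoids both.\<close>

lemma generic_1: "generic 1 i \<Longrightarrow> 1 < j \<Longrightarrow> j < n + m \<Longrightarrow> i j \<le> - 1 \<or> 2 \<le> i j"
  unfolding generic_def by (cases "j \<le> n") force+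

text \<open>Each letter moves the label by at most one unit, so a distance equal to the length keeps
  every letter away from a zero amplitude. The target label is the same whether or not the
  coefficient vanishes, which lets monomials be separated by position alone.\<close>

lemma word_act:
  assumes "w \<in> lists (pol_gens n m)"
  shows "\<exists>c. R (wd w) (bv i) = Poly_Mapping.single (\<lambda>k. i k + word_shift w k) c \<and>
    (generic (int (length w)) i \<longrightarrow> c \<noteq> 0)"
  using assms
proof (induction rule: lists.induct)
  case Nil
  have "(\<lambda>k. i k + word_shift [] k) = i" by (rule ext) (auto simp: word_shift_def)
  then show ?case by (intro exI[of _ 1]) simp
next
  case (Cons x w)
  let ?i = "\<lambda>k. i k + word_shift w k"
  obtain c where c: "R (wd w) (bv i) = Poly_Mapping.single ?i c" "generic (int (length w)) i \<Longrightarrow> c \<noteq> 0"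
    using Cons by blast
  have gen: "generic 1 ?i" if "generic (int (length (x # w))) i"
    using generic_word_shift[OF that abs_word_shift[of w] word_shift_outside] by simp
  from Cons.hyps consider j where "x = Gen j" "j \<in> {1..n+m}" | j where "x = GenStar j" "j \<in> {1..n+m}"
    by (auto simp: pol_gens_def)
  then obtain d where d: "act x ?i = Poly_Mapping.single (\<lambda>k. i k + word_shift (x # w) k) d" "generic 1 ?i \<Longrightarrow> d \<noteq> 0"
  proof cases
    case (1 j)
    have "shift j (-1) ?i = (\<lambda>k. i k + word_shift (x # w) k)"
      using 1 by (auto simp: shift_def word_shift_def)
    moreover have "amp j (?i j) \<noteq> 0" if "generic 1 ?i"
    proof (rule amp_nonzero)
      assume "1 < j" "j < n + m"
      then show "?i j \<noteq> 1" using generic_1[OF that] by fastforce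
    qed (use 1 in simp)
    ultimately show ?thesis using that 1 by (simp add: act_Gen)
  next
    case (2 j)
    have "shift j 1 ?i = (\<lambda>k. i k + word_shift (x # w) k)"
      using 2 by (auto simp: shift_def word_shift_def)
    moreover have "amp j (?i j + 1) \<noteq> 0" if "generic 1 ?i"
    proof (rule amp_nonzero)
      assume "1 < j" "j < n + m"
      then show "?i j + 1 \<noteq> 1" using generic_1[OF that] by fastforce
    qed (use 2 in simp)
    ultimately show ?thesis using that 2 by (simp add: act_GenStar)
  qed
  have "R (wd (x # w)) (bv i) = Poly_Mapping.single (\<lambda>k. i k + word_shift (x # w) k) (c * d)"
    using c d by (simp add: wd_Cons rep_mult rep_letter)
  moreover have "c * d \<noteq> 0" if "generic (int (length (x # w))) i"
    using c d gen[OF that] generic_mono[OF that, of "int (length w)"] by simp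
  ultimately show ?case by blast
qed

lemma R_xi_powers:
  assumes "\<And>k. k \<in> set ks \<Longrightarrow> 1 \<le> k \<and> k \<le> n + m" "i \<in> idx n m"
  shows "R (prod_list (map (\<lambda>k. xi n m k ^ K k) ks)) (Poly_Mapping.single i z) =
    Poly_Mapping.single i (z * (\<Prod>k\<leftarrow>ks. of_real (xival k i) ^ K k))"
  using assms(1)
proof (induction ks)
  case (Cons k ks)
  have "R (xi n m k ^ r) (Poly_Mapping.single i z) = Poly_Mapping.single i (z * of_real (xival k i) ^ r)" for r z
  proof (induction r)
    case (Suc r)
    have "R (xi n m k) (Poly_Mapping.single i z) = Poly_Mapping.single i (z * of_real (xival k i))" for z
      using Cons.prems[of k] assms(2) by (subst R_single) (simp add: R_xi)
    with Suc show ?case by (simp add: rep_mult mult_ac)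
  qed simp
  with Cons show ?case by (simp add: rep_mult mult_ac)
qed simp

text \<open>As i_k \<le> 0 for 2 \<le> k \<le> n, the sums S_n, ..., S_2 ascend from S_{n+1}; as i_k
  \<ge> 1 for k > n, so do S_{n+2}, ..., S_N. Both runs are joined into one list, to be used as a
  single chain above S_{n+1}. The index n + 1 is left out because \<xi>_{n+1} enters through
  g.\<close>

definition xi_vars :: "nat list" where
  "xi_vars = rev [2..<n+1] @ [n+2..<n+m+1]"

lemma set_xi_vars: "set xi_vars = {2..n} \<union> {n+2..n+m}"
  by (auto simp: xi_vars_def)

lemma distinct_xi_vars: "distinct xi_vars"
  by (auto simp: xi_vars_def)

lemma R_mid:
  assumes "i \<in> idx n m"
  shows "R (mid K g) (bv i) =
    Poly_Mapping.single i (g (q powi (2 * partial_sum i (n + 1))) *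
      (\<Prod>k\<in>set xi_vars. of_real (xival k i) ^ K k))"
proof -
  have "R (mid K g) (bv i) = Poly_Mapping.single i (g (q powi (2 * partial_sum i (n + 1))) *
      ((\<Prod>k\<leftarrow>[2..<n+1]. of_real (xival k i) ^ K k) * (\<Prod>k\<leftarrow>[n+2..<n+m+1]. of_real (xival k i) ^ K k)))"
  proof -
    have P: "R (prod_list (map (\<lambda>k. xi n m k ^ K k) [2..<n+1])) (Poly_Mapping.single i z) =
        Poly_Mapping.single i (z * (\<Prod>k\<leftarrow>[2..<n+1]. of_real (xival k i) ^ K k))" for z
      by (rule R_xi_powers[OF _ assms]) auto
    have Q: "R (prod_list (map (\<lambda>k. xi n m k ^ K k) [n+2..<n+m+1])) (bv i) =
        Poly_Mapping.single i (1 * (\<Prod>k\<leftarrow>[n+2..<n+m+1]. of_real (xival k i) ^ K k))"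
      by (rule R_xi_powers[OF _ assms]) auto
    show ?thesis
      unfolding mid_def rep_mult Q R_single[of "fin g"] R_fin scale_single P by (simp only: mult_ac mult_1_left)
  qed
  also have "(\<Prod>k\<leftarrow>[2..<n+1]. of_real (xival k i) ^ K k) * (\<Prod>k\<leftarrow>[n+2..<n+m+1]. of_real (xival k i) ^ K k) =
      (\<Prod>k\<in>set xi_vars. complex_of_real (xival k i) ^ K k)"
  proof -
    have "set [2..<n+1] \<inter> set [n+2..<n+m+1] = {}" by auto
    then show ?thesis
      unfolding xi_vars_def set_append set_rev
      by (simp only: prod.union_disjoint finite_set prod.distinct_set_conv_list distinct_upt)
  qed
  finally show ?thesis .
qed

text \<open>Inverse of the passage from a label to its partial sums: S_1 = 0, S_{n+1} = s and the
  other S_j are prescribed, and the entries are their consecutive differences.\<close>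

definition label :: "int \<Rightarrow> (nat \<Rightarrow> int) \<Rightarrow> nat \<Rightarrow> int" where
  "label s \<sigma> j = (let S = (\<lambda>k. if k \<le> 1 then 0 else if k = n + 1 then s else \<sigma> k)
    in if j \<in> {1..<n+m} then S (Suc j) - S j else 0)"

lemma partial_sum_label:
  assumes "1 \<le> j" "j \<le> n + m"
  shows "partial_sum (label s \<sigma>) j = (if j = 1 then 0 else if j = n + 1 then s else \<sigma> j)"
  using assms
proof (induction j rule: dec_induct)
  case (step k)
  have "partial_sum (label s \<sigma>) (Suc k) = partial_sum (label s \<sigma>) k + label s \<sigma> k"
    using step.hyps by (simp add: partial_sum_Suc)
  also have "label s \<sigma> k = (if k = n then s else \<sigma> (Suc k)) - partial_sum (label s \<sigma>) k"
    using step by (simp add: label_def[of s \<sigma> k])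
  finally show ?case using step.hyps by simp
qed simp

lemma gap_chain_upt:
  "gap_chain L b [a..<c] \<sigma> \<Longrightarrow> a < c \<Longrightarrow> b + L \<le> \<sigma> a"
  "gap_chain L b [a..<c] \<sigma> \<Longrightarrow> a \<le> k \<Longrightarrow> Suc k < c \<Longrightarrow> \<sigma> k + L \<le> \<sigma> (Suc k)"
proof -
  show "gap_chain L b [a..<c] \<sigma> \<Longrightarrow> a < c \<Longrightarrow> b + L \<le> \<sigma> a" by (simp add: upt_conv_Cons)
next
  assume ch: "gap_chain L b [a..<c] \<sigma>" and k: "a \<le> k" "Suc k < c"
  have "[a..<c] = [a..<k] @ k # Suc k # [Suc (Suc k)..<c]"
    using k upt_add_eq_append[of a k "c - k"] by (simp add: upt_conv_Cons)
  with ch show "\<sigma> k + L \<le> \<sigma> (Suc k)" by (simp add: gap_chain_append)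
qed

lemma gap_chain_rev_upt:
  "gap_chain L b (rev [a..<c]) \<sigma> \<Longrightarrow> a \<le> c' \<Longrightarrow> c = Suc c' \<Longrightarrow> b + L \<le> \<sigma> c'"
  "gap_chain L b (rev [a..<c]) \<sigma> \<Longrightarrow> a \<le> k \<Longrightarrow> Suc k < c \<Longrightarrow> \<sigma> (Suc k) + L \<le> \<sigma> k"
proof -
  show "gap_chain L b (rev [a..<c]) \<sigma> \<Longrightarrow> a \<le> c' \<Longrightarrow> c = Suc c' \<Longrightarrow> b + L \<le> \<sigma> c'" by simp
next
  assume ch: "gap_chain L b (rev [a..<c]) \<sigma>" and k: "a \<le> k" "Suc k < c"
  have "[a..<c] = [a..<k] @ k # Suc k # [Suc (Suc k)..<c]"
    using k upt_add_eq_append[of a k "c - k"] by (simp add: upt_conv_Cons)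
  with ch show "\<sigma> (Suc k) + L \<le> \<sigma> k" by (simp add: gap_chain_append)
qed

text \<open>The entries are differences of neighbouring partial sums. A gap of \<open>r + 1\<close>
  makes them at least \<open>r + 1\<close> for k > n and at most \<open>- (r + 1)\<close> for 2
  \<le> k \<le> n.\<close>

lemma generic_label:
  assumes "gap_chain (r + 1) s xi_vars \<sigma>" "0 \<le> r"
  shows "generic r (label s \<sigma>)"
proof -
  let ?us = "rev [2..<n+1]" and ?vs = "[n+2..<n+m+1]"
  have u: "gap_chain (r + 1) s ?us \<sigma>"
    and v: "gap_chain (r + 1) (if ?us = [] then s else \<sigma> (last ?us)) ?vs \<sigma>"
    using assms(1) unfolding xi_vars_def gap_chain_append by auto
  have us: "s + (r + 1) \<le> \<sigma> n" if "2 \<le> n" using gap_chain_rev_upt(1)[OF u, of n] that by simp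
  have uk: "\<sigma> (Suc k) + (r + 1) \<le> \<sigma> k" if "2 \<le> k" "Suc k < n + 1" for k
    using gap_chain_rev_upt(2)[OF u, of k] that by simp
  \<comment> \<open>In the chain the index n + 2 is preceded by 2, whereas i_{n+1} is the difference
    between S_{n+2} and S_{n+1} = s; hence the comparison of \<open>\<sigma> 2\<close> with
    \<open>s\<close>.\<close>
  have "s \<le> \<sigma> 2" if "2 \<le> n"
  proof -
    have "s \<le> \<sigma> k" if "2 \<le> k" "k \<le> n" for k
      using that(2,1)
    proof (induction k rule: inc_induct)
      case base
      then show ?case using us assms(2) by simp
    next
      case (step k)
      then show ?case using uk[of k] assms(2) by simp
    qed
    then show ?thesis using that by simp
  qed
  moreover have "last ?us = 2" if "2 \<le> n" using that by (simp add: last_rev upt_conv_Cons)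
  moreover have "?us = [] \<longleftrightarrow> n < 2" by auto
  ultimately have "s \<le> (if ?us = [] then s else \<sigma> (last ?us))" by auto
  then have vs: "s + (r + 1) \<le> \<sigma> (n + 2)"
    using gap_chain_upt(1)[OF v] m_ge_2 by simp
  have vk: "\<sigma> k + (r + 1) \<le> \<sigma> (Suc k)" if "n + 2 \<le> k" "Suc k < n + m + 1" for k
    using gap_chain_upt(2)[OF v] that by blast
  show ?thesis
    unfolding generic_def
  proof (intro conjI allI impI ballI)
    fix k assume k: "k \<in> {2..n}"
    show "label s \<sigma> k \<le> - r"
      using k us uk[of k] m_ge_2 by (cases "k = n") (auto simp: label_def)
  next
    fix k assume k: "k \<in> {n+1..<n+m}"
    show "r + 1 \<le> label s \<sigma> k"
      using k vs vk[of k] n_pos by (cases "k = n + 1") (auto simp: label_def)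
  qed (auto simp: label_def)
qed

text \<open>As I_k J_k = 0, the two exponents are the positive and negative parts of their
  difference, and for k < N the displacement exhibits this difference.\<close>

lemma word_shift_determines:
  assumes "\<forall>k\<in>{1..n+m}. I k * J k = 0" "\<forall>k\<in>{1..n+m}. I' k * J' k = 0"
    and "(\<Sum>k=1..n. I k) + (\<Sum>k=n+1..n+m. J k) = (\<Sum>k=1..n. J k) + (\<Sum>k=n+1..n+m. I k)"
    and "(\<Sum>k=1..n. I' k) + (\<Sum>k=n+1..n+m. J' k) = (\<Sum>k=1..n. J' k) + (\<Sum>k=n+1..n+m. I' k)"
    and "\<And>k. word_shift (left_word I @ right_word J) k = word_shift (left_word I' @ right_word J') k"
    and "k \<in> {1..n+m}"
  shows "I k = I' k \<and> J k = J' k"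
proof -
  have z: "a = a' \<and> b = b'" if "int a - int b = int a' - int b'" "a * b = 0" "a' * b' = 0" for a b a' b' :: nat
    using that by auto
  have less: "I k = I' k \<and> J k = J' k" if k: "k \<in> {1..<n+m}" for k
  proof -
    have "int (I k) - int (J k) = int (I' k) - int (J' k)"
      using assms(5)[of k] k unfolding word_shift_def count_left_right by (auto split: if_splits)
    then show ?thesis using z assms(1,2) k by auto
  qed
  show ?thesis
  proof (cases "k = n + m")
    case True
    \<comment> \<open>The displacement is silent about N. All other exponents already agree, so the
      two balance equations give the difference of the exponents at N.\<close>
    have ins: "{n+1..n+m} = insert (n+m) {n+1..<n+m}" using m_ge_2 by auto
    have "(\<Sum>k=1..n. I k) = (\<Sum>k=1..n. I' k)" "(\<Sum>k=1..n. J k) = (\<Sum>k=1..n. J' k)"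
      "(\<Sum>k=n+1..<n+m. I k) = (\<Sum>k=n+1..<n+m. I' k)" "(\<Sum>k=n+1..<n+m. J k) = (\<Sum>k=n+1..<n+m. J' k)"
      using less m_ge_2 by (auto intro!: sum.cong)
    then have "int (I (n+m)) - int (J (n+m)) = int (I' (n+m)) - int (J' (n+m))"
      using assms(3,4) unfolding ins by simp
    then show ?thesis using z[of "I (n+m)" "J (n+m)" "I' (n+m)" "J' (n+m)"] assms(1,2) n_pos True by simp
  next
    case False
    then show ?thesis using less assms(6) by simp
  qed
qed

lemma left_word_cong: "(\<And>k. k \<in> {1..n+m} \<Longrightarrow> I k = I' k) \<Longrightarrow> left_word I = left_word I'"
  unfolding left_word_def by (intro arg_cong2[where f = append] arg_cong[where f = concat] map_cong) auto

lemma right_word_cong: "(\<And>k. k \<in> {1..n+m} \<Longrightarrow> J k = J' k) \<Longrightarrow> right_word J = right_word J'"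
  unfolding right_word_def by (intro arg_cong2[where f = append] arg_cong[where f = concat] map_cong) auto

lemma mid_cong: "(\<And>k. k \<in> set xi_vars \<Longrightarrow> K k = K' k) \<Longrightarrow> mid K g = mid K' g"
  unfolding mid_def set_xi_vars
  by (intro arg_cong2[where f = "(*)"] arg_cong[where f = prod_list] map_cong) auto

text \<open>Turns a pointwise identity between functions into an identity in \<open>Fun\<close>;
  through it, vanishing at all points of q^(2Z) becomes vanishing modulo the relations.\<close>

lemma fin_sum:
  assumes "finite X" "\<And>x. x \<in> X \<Longrightarrow> g x \<in> fin_funs q"
  shows "(\<lambda>y. \<Sum>x\<in>X. c x * g x y) \<in> fin_funs q \<and>
    fin (\<lambda>y. \<Sum>x\<in>X. c x * g x y) \<approx> (\<Sum>x\<in>X. const (c x) * fin (g x))"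
  using assms
proof (induction X)
  case empty
  \<comment> \<open>The letter for the zero function is a nonzero element of the free algebra; the
    scaling relation with scalar 0 puts it into the ideal.\<close>
  have "fin (\<lambda>x. 0 * (0::complex)) \<approx> const 0 * fin (\<lambda>_. 0)"
    by (rule fin_scale[of "\<lambda>_. 0" 0]) simp
  then show ?case by simp
next
  case (insert x X)
  let ?s = "\<lambda>y. \<Sum>x\<in>X. c x * g x y"
  have IH: "?s \<in> fin_funs q" "fin ?s \<approx> (\<Sum>x\<in>X. const (c x) * fin (g x))"
    using insert by auto
  have x: "(\<lambda>y. c x * g x y) \<in> fin_funs q" using insert by (intro fin_funs_closed) simp
  have "fin (\<lambda>y. c x * g x y + ?s y) \<approx> fin (\<lambda>y. c x * g x y) + fin ?s"
    by (rule fin_add[OF x IH(1)])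
  also have "\<dots> \<approx> const (c x) * fin (g x) + (\<Sum>x\<in>X. const (c x) * fin (g x))"
    using insert.prems by (intro eqv_add IH(2) fin_scale) simp
  finally show ?case using insert.hyps fin_funs_add[OF x IH(1)] by simp
qed

text \<open>Monomials with equal words and equal \<xi>-exponents differ in g only. Evaluation at
  suitable labels shows that in each such group the combined function is zero, and linearity of
  \<open>fin\<close> then makes the group vanish.\<close>

lemma D_span_kernel:
  assumes "a \<in> D_span" "\<And>i. i \<in> idx n m \<Longrightarrow> R a (bv i) = 0"
  shows "a \<in> Fun.I"
proof -
  obtain S c where a: "a = (\<Sum>x\<in>S. const (c x) * x)" and S: "finite S" "S \<subseteq> D_monoms q n m"
    using assms(1) unfolding D_span_def by blast
  have "\<forall>x\<in>S. \<exists>I J K g. x = D_monom n m I J K g \<and> g \<in> fin_funs q \<and> (\<forall>k\<in>{1..n+m}. I k * J k = 0) \<and>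
       (\<Sum>k=1..n. I k) + (\<Sum>k=n+1..n+m. J k) = (\<Sum>k=1..n. J k) + (\<Sum>k=n+1..n+m. I k)"
    using S(2) unfolding D_monoms_def by blast
  then obtain I J K g where x_eq: "\<And>x. x \<in> S \<Longrightarrow> x = D_monom n m (I x) (J x) (K x) (g x)"
    and g: "\<And>x. x \<in> S \<Longrightarrow> g x \<in> fin_funs q"
    and IJ: "\<And>x. x \<in> S \<Longrightarrow> \<forall>k\<in>{1..n+m}. I x k * J x k = 0"
    and wt: "\<And>x. x \<in> S \<Longrightarrow> (\<Sum>k=1..n. I x k) + (\<Sum>k=n+1..n+m. J x k) = (\<Sum>k=1..n. J x k) + (\<Sum>k=n+1..n+m. I x k)"
    unfolding bchoice_iff by blast
  define lw where "lw x = left_word (I x)" for x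
  define rw where "rw x = right_word (J x)" for x
  \<comment> \<open>Grouping is by words and listed exponents rather than by \<open>I\<close>,
    \<open>J\<close>, \<open>K\<close>: these functions are arbitrary outside the relevant indices,
    so different ones can describe the same factors.\<close>
  define key where "key x = (lw x, rw x, map (K x) xi_vars)" for x
  have lists: "lw x \<in> lists (pol_gens n m)" "rw x \<in> lists (pol_gens n m)" for x
    by (simp_all add: lw_def rw_def left_word_lists right_word_lists)
  have x_eq': "x = wd (lw x) * mid (K x) (g x) * wd (rw x)" if "x \<in> S" for x
    using x_eq[OF that] by (simp add: D_monom_eq lw_def rw_def)
  \<comment> \<open>One bound for the words of all monomials of \<open>S\<close> at once.\<close>
  define M where "M = (\<Sum>x\<in>S. int (length (lw x)) + int (length (rw x)))"
  have M: "int (length (lw x)) + int (length (rw x)) \<le> M" if "x \<in> S" for x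
    unfolding M_def using that S(1) member_le_sum[of x S "\<lambda>x. int (length (lw x)) + int (length (rw x))"] by simp
  have vanish: "(\<Sum>x | x \<in> S \<and> key x = key x0. c x * g x y) = 0" if x0: "x0 \<in> S" for x0 y
  proof (cases "y \<in> range (\<lambda>k::int. q powi (2 * k))")
    case False
    have "g x y = 0" if "x \<in> S" for x using g[OF that] False unfolding fin_funs_def by blast
    then show ?thesis by (intro sum.neutral) simp
  next
    case True
    then obtain s where y: "y = q powi (2 * s)" by blast
    let ?A = "{x \<in> S. lw x = lw x0 \<and> rw x = rw x0}"
    have "(\<Sum>x | x \<in> ?A \<and> (\<forall>k\<in>set xi_vars. K x k = K x0 k). c x * g x y) = 0"
    \<comment> \<open>Gap \<open>2 * M + 1\<close> makes \<open>i'\<close> generic of order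
      \<open>2 * M\<close>. Undoing \<open>rw x0\<close> costs at most \<open>M\<close>, and the
      remaining \<open>M\<close> is what the right words of all monomials need.\<close>
    proof (rule monomials_independent[where L = "2 * M + 1" and b = s])
      show "finite ?A" using S(1) by simp
      show "distinct xi_vars" by (rule distinct_xi_vars)
      fix \<sigma> assume \<sigma>: "gap_chain (2 * M + 1) s xi_vars \<sigma>"
      have M0: "0 \<le> M" unfolding M_def by (intro sum_nonneg) simp
      define i' where "i' = label s \<sigma>"
      have i': "generic (2 * M) i'" unfolding i'_def using \<sigma> M0 by (intro generic_label) simp_all
      \<comment> \<open>The starting label is chosen so that \<open>rw x0\<close> leads to
        \<open>i'\<close>; the middle factor then meets exactly the partial sums given by
        \<open>s\<close> and \<open>\<sigma>\<close>.\<close>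
      define i where "i k = i' k + - word_shift (rw x0) k" for k
      have i: "generic M i"
      proof -
        have "generic (2 * M - M) (\<lambda>k. i' k + - word_shift (rw x0) k)"
        proof (rule generic_word_shift[OF i'])
          show "\<bar>- word_shift (rw x0) k\<bar> \<le> M" for k
            using abs_word_shift[of "rw x0" k] M[OF x0] by simp
        qed (simp add: word_shift_outside)
        then show ?thesis by (simp add: i_def[abs_def])
      qed
      have i_idx: "i \<in> idx n m" "i' \<in> idx n m" using generic_idx i i' M0 by auto
      have ii': "(\<lambda>k. i k + word_shift (rw x0) k) = i'" by (simp add: i_def)
      define \<tau> where "\<tau> k = i k + word_shift (lw x0 @ rw x0) k" for k
      have \<tau>: "(\<lambda>k. i' k + word_shift (lw x0) k) = \<tau>"
        by (simp add: \<tau>_def[abs_def] i_def word_shift_append)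
      obtain \<rho> where \<rho>: "R (wd (rw x0)) (bv i) = Poly_Mapping.single i' \<rho>" "\<rho> \<noteq> 0"
        using word_act[OF lists(2)[of x0], of i] generic_mono[OF i, of "int (length (rw x0))"] M[OF x0]
        unfolding ii' by auto
      obtain \<mu> where \<mu>: "R (wd (lw x0)) (bv i') = Poly_Mapping.single \<tau> \<mu>" "\<mu> \<noteq> 0"
        using word_act[OF lists(1)[of x0], of i'] generic_mono[OF i', of "int (length (lw x0))"] M[OF x0] M0
        unfolding \<tau> by auto
      have xv: "xival k i' = q powi (2 * \<sigma> k)" if "k \<in> set xi_vars" for k
        using that unfolding i'_def xival_def set_xi_vars by (subst partial_sum_label) auto
      have S': "partial_sum i' (Suc n) = s"
        unfolding i'_def using n_pos m_ge_2 by (subst partial_sum_label) auto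
      let ?P = "\<lambda>x. \<Prod>k\<in>set xi_vars. complex_of_real (q powi (2 * \<sigma> k)) ^ K x k"
      have in_A: "Poly_Mapping.lookup (R x (bv i)) \<tau> = \<rho> * \<mu> * (g x y * ?P x)" if "x \<in> ?A" for x
      proof -
        have x: "x \<in> S" "lw x = lw x0" "rw x = rw x0" using that by auto
        have m: "R (mid (K x) (g x)) (bv i') = Poly_Mapping.single i' (g x y * ?P x)"
          using i_idx by (simp add: R_mid S' y xv del: of_real_power_int)
        have e1: "R (mid (K x) (g x)) (Poly_Mapping.single i' \<rho>) = Poly_Mapping.single i' (\<rho> * (g x y * ?P x))"
          by (subst R_single) (simp only: m scale_single)
        have e2: "R (wd (lw x0)) (Poly_Mapping.single i' z) = Poly_Mapping.single \<tau> (z * \<mu>)" for z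
          by (subst R_single) (simp only: \<mu>(1) scale_single)
        have "R x (bv i) = R (wd (lw x0) * mid (K x) (g x) * wd (rw x0)) (bv i)"
          using x_eq'[OF x(1)] x by simp
        also have "\<dots> = Poly_Mapping.single \<tau> (\<rho> * \<mu> * (g x y * ?P x))"
          unfolding rep_mult \<rho>(1) e1 e2 by (simp only: mult_ac)
        finally show ?thesis by simp
      qed
      \<comment> \<open>A monomial with other words contributes nothing at \<open>\<tau>\<close>:
        reaching the same label would force the same displacement, hence the same exponents and the
        same words.\<close>
      have not_A: "Poly_Mapping.lookup (R x (bv i)) \<tau> = 0" if "x \<in> S - ?A" for x
      proof -
        let ?i = "\<lambda>k. i k + word_shift (rw x) k"
        have x: "x \<in> S" using that by simp
        have "generic (M - int (length (rw x))) ?i"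
          by (rule generic_word_shift[OF i abs_word_shift word_shift_outside])
        then have "?i \<in> idx n m" using generic_idx M[OF x] by simp
        then have "\<exists>d. R (mid (K x) (g x)) (bv ?i) = Poly_Mapping.single ?i d"
          using R_mid by blast
        then obtain d where d: "R (mid (K x) (g x)) (bv ?i) = Poly_Mapping.single ?i d" by blast
        obtain r where r: "R (wd (rw x)) (bv i) = Poly_Mapping.single ?i r"
          using word_act[OF lists(2)[of x], of i] by blast
        obtain l where l: "R (wd (lw x)) (bv ?i) = Poly_Mapping.single (\<lambda>k. ?i k + word_shift (lw x) k) l"
          using word_act[OF lists(1)[of x], of ?i] by blast
        have e1: "R (mid (K x) (g x)) (Poly_Mapping.single ?i z) = Poly_Mapping.single ?i (z * d)" for z
          by (subst R_single) (simp only: d scale_single)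
        have e2: "R (wd (lw x)) (Poly_Mapping.single ?i z) =
            Poly_Mapping.single (\<lambda>k. ?i k + word_shift (lw x) k) (z * l)" for z
          by (subst R_single) (simp only: l scale_single)
        have "R (wd (lw x) * mid (K x) (g x) * wd (rw x)) (bv i) =
            Poly_Mapping.single (\<lambda>k. ?i k + word_shift (lw x) k) (r * d * l)"
          unfolding rep_mult r e1 e2 ..
        then obtain z where z: "R x (bv i) = Poly_Mapping.single (\<lambda>k. i k + word_shift (lw x @ rw x) k) z"
          using x_eq'[OF x] by (auto simp: word_shift_append ac_simps)
        have "(\<lambda>k. i k + word_shift (lw x @ rw x) k) \<noteq> \<tau>"
        proof
          assume eq: "(\<lambda>k. i k + word_shift (lw x @ rw x) k) = \<tau>"
          have ws: "word_shift (lw x @ rw x) k = word_shift (lw x0 @ rw x0) k" for k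
            using fun_cong[OF eq, of k] by (simp add: \<tau>_def)
          have "I x k = I x0 k \<and> J x k = J x0 k" if "k \<in> {1..n+m}" for k
            using word_shift_determines[OF IJ[OF x] IJ[OF x0] wt[OF x] wt[OF x0] ws[unfolded lw_def rw_def] that] .
          then have "lw x = lw x0" "rw x = rw x0"
            unfolding lw_def rw_def by (auto intro!: left_word_cong right_word_cong)
          then show False using that by simp
        qed
        then show ?thesis by (simp add: z lookup_single)
      qed
      have "0 = Poly_Mapping.lookup (R a (bv i)) \<tau>" using assms(2)[OF i_idx(1)] by simp
      also have "\<dots> = (\<Sum>x\<in>S. c x * Poly_Mapping.lookup (R x (bv i)) \<tau>)"
        unfolding a rep_sum rep_const_mult lookup_sum lookup_scale ..
      also have "\<dots> = (\<Sum>x\<in>?A. c x * Poly_Mapping.lookup (R x (bv i)) \<tau>)"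
        using S(1) not_A by (intro sum.mono_neutral_right) auto
      also have "\<dots> = (\<Sum>x\<in>?A. \<rho> * \<mu> * (c x * g x y * ?P x))"
        using in_A by (intro sum.cong) (simp_all add: mult_ac)
      also have "\<dots> = \<rho> * \<mu> * (\<Sum>x\<in>?A. c x * g x y * ?P x)" by (simp add: sum_distrib_left)
      finally show "(\<Sum>x\<in>?A. c x * g x y * ?P x) = 0" using \<rho>(2) \<mu>(2) by simp
    qed
    moreover have "{x. x \<in> ?A \<and> (\<forall>k\<in>set xi_vars. K x k = K x0 k)} = {x. x \<in> S \<and> key x = key x0}"
      by (auto simp: key_def)
    ultimately show ?thesis by simp
  qed
  \<comment> \<open>Within a group \<open>?l\<close> and \<open>?r\<close> are common factors, so
    what remains between them is a combination of finite functions, and \<open>vanish\<close> says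
    that this combination is zero.\<close>
  have block: "(\<Sum>x | x \<in> S \<and> key x = key x0. const (c x) * x) \<in> Fun.I" if x0: "x0 \<in> S" for x0
  proof -
    let ?X = "{x. x \<in> S \<and> key x = key x0}"
    let ?P = "prod_list (map (\<lambda>k. xi n m k ^ K x0 k) [2..<n+1])"
      and ?Q = "prod_list (map (\<lambda>k. xi n m k ^ K x0 k) [n+2..<n+m+1])"
    let ?l = "wd (lw x0) * ?P" and ?r = "?Q * wd (rw x0)"
    have G: "?l \<in> G" "?r \<in> G"
      by (auto intro!: free_on_mult G_wd lists G_xi_powers simp del: upt_Suc)
    have fX: "finite ?X" "\<And>x. x \<in> ?X \<Longrightarrow> g x \<in> fin_funs q" using S(1) g by auto
    have "fin (\<lambda>_. 0) \<approx> (\<Sum>x\<in>?X. const (c x) * fin (g x))"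
      using fin_sum[of ?X g c, OF fX] unfolding vanish[OF x0] by blast
    moreover have "fin (\<lambda>_. 0) \<approx> 0" using fin_sum[of "{}"] by simp
    ultimately have z: "(\<Sum>x\<in>?X. const (c x) * fin (g x)) \<approx> 0" using eqv_sym eqv_trans by blast
    have "(\<Sum>x\<in>?X. const (c x) * x) = (\<Sum>x\<in>?X. ?l * (const (c x) * fin (g x)) * ?r)"
    proof (rule sum.cong)
      fix x assume x: "x \<in> ?X"
      then have k: "lw x = lw x0" "rw x = rw x0" "\<And>k. k \<in> set xi_vars \<Longrightarrow> K x k = K x0 k"
        by (auto simp: key_def)
      have "mid (K x) (g x) = ?P * fin (g x) * ?Q"
        using mid_cong[OF k(3)] by (simp only: mid_def)
      then have "x = wd (lw x0) * (?P * fin (g x) * ?Q) * wd (rw x0)"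
        using x_eq'[of x] x k by simp
      then have "x = ?l * fin (g x) * ?r" by (simp only: mult.assoc)
      then have "const (c x) * x = const (c x) * (?l * fin (g x) * ?r)" by simp
      then show "const (c x) * x = ?l * (const (c x) * fin (g x)) * ?r"
        by (simp only: mult.assoc const_left_commute[of ?l])
          (simp only: mult.assoc const_left_commute[of "wd _"] const_left_commute[of ?P])
    qed simp
    also have "\<dots> = ?l * (\<Sum>x\<in>?X. const (c x) * fin (g x)) * ?r"
      by (simp only: sum_distrib_left sum_distrib_right)
    also have "\<dots> \<approx> ?l * 0 * ?r"
      using z G by (intro eqv_mult_right eqv_mult_left)
    finally show ?thesis by (simp add: eqv_def)
  qed
  have sum_I: "(\<Sum>y\<in>Y. f y) \<in> Fun.I" if "\<And>y. y \<in> Y \<Longrightarrow> f y \<in> Fun.I" for f :: "'b \<Rightarrow> gen free" and Y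
    using that by (induction Y rule: infinite_finite_induct) (simp_all add: Fun.I_props)
  have "a = (\<Sum>k\<in>key ` S. \<Sum>x | x \<in> S \<and> key x = k. const (c x) * x)"
    unfolding a by (rule sum.image_gen[OF S(1)])
  also have "\<dots> \<in> Fun.I"
  proof (rule sum_I)
    fix k assume "k \<in> key ` S"
    then show "(\<Sum>x | x \<in> S \<and> key x = k. const (c x) * x) \<in> Fun.I" using block by blast
  qed
  finally show ?thesis .
qed

lemma partial_sum_eq: "partial_sum i (n + 1) = (\<Sum>k=1..n. i k)"
  by (simp add: partial_sum_def atLeastLessThanSuc_atLeastAtMost)

text \<open>The difference of two elements with equal action is first replaced by an equivalent
  element of \<open>D_span\<close>. The action does not change, and the kernel statement then
  applies to explicit monomials.\<close>

lemma Fun_T_D_faithful: "faithful_star_representation (D q n m) (H0 n m) Fun.T"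
proof -
  have rep_D: "star_representation (D q n m) (H0 n m) Fun.T"
    unfolding D_eq H0_eq
    by (rule Fun.star_representation_sub[OF star_algebra_D[unfolded D_eq] D_words_subset_G])
  have "inj_on (\<lambda>a. restrict (Fun.T a) (H0 n m)) (carrier (D q n m))"
    unfolding carrier_D
  proof (rule inj_onI, elim imageE)
    fix X Y a b
    assume eq: "restrict (Fun.T X) (H0 n m) = restrict (Fun.T Y) (H0 n m)"
      and X: "X = Fun.cls a" "a \<in> words_in D_words" and Y: "Y = Fun.cls b" "b \<in> words_in D_words"
    have "a - b \<in> NF" using X Y by (intro D_words_NF words_in_diff)
    then obtain d where d: "d \<in> D_span" "a - b \<approx> d" unfolding NF_def by blast
    have "R d (bv i) = 0" if i: "i \<in> idx n m" for i
    proof -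
      have v: "bv i \<in> supported (idx n m)" using i by (simp add: supported_def)
      have "Fun.T X (bv i) = Fun.T Y (bv i)"
        using fun_cong[OF eq, of "bv i"] v by (simp add: H0_eq)
      then have "R a (bv i) = R b (bv i)" by (simp add: X Y Fun.T_cls[OF v])
      moreover have "R (a - b - d) (bv i) = 0"
        using Fun.rep_I[OF _ v] d(2) by (simp add: eqv_def)
      ultimately show ?thesis by (simp add: rep_diff)
    qed
    then have "d \<in> Fun.I" by (rule D_span_kernel[OF d(1)])
    then have "a - b \<in> Fun.I"
      using Fun.I_props(3)[of "a - b - d" d] d(2) by (simp add: eqv_def)
    then show "X = Y" by (simp add: X Y Fun.cls_eq_iff)
  qed
  then show ?thesis
    using rep_D by (intro faithful_star_representation.intro faithful_star_representation_axioms.intro)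
qed

end

theorem theorem6p1:
  fixes q :: real and n m :: nat
  assumes "0 < q" and "q < 1" and "1 \<le> n" and "2 \<le> m"
  shows "star_representation (Pol q n m) (H0 n m) (T0 q n m) \<and>
    (\<exists>T. star_representation (Fun q n m) (H0 n m) T \<and>
         (\<forall>X\<in>carrier (Pol q n m). \<forall>v\<in>H0 n m. T (pol_to_fun q n m X) v = T0 q n m X v) \<and>
         (\<forall>g\<in>fin_funs q. \<forall>i\<in>idx n m.
            T (fun_class q n m (fin g)) (Poly_Mapping.single i 1) =
            Poly_Mapping.single i (g (q powi (2 * (\<Sum>k=1..n. i k))))) \<and>
         faithful_star_representation (D q n m) (H0 n m) T)"
proof -
  interpret quantum_cone q n m
    by unfold_locales (use assms in auto)
  show ?thesis
  \<comment> \<open>One operator family serves all clauses: it agrees with \<open>T0\<close> on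
    polynomial classes, multiplies by g on finite functions, and is injective on
    \<open>D\<close>.\<close>
  proof (intro conjI exI[of _ Fun.T] ballI)
    show "star_representation (Pol q n m) (H0 n m) (T0 q n m)"
      unfolding Pol_eq H0_eq T0_eq by (rule Pol.star_representation_Q)
    show "star_representation (Fun q n m) (H0 n m) Fun.T"
      unfolding Fun_eq H0_eq by (rule Fun.star_representation_Q)
    show "faithful_star_representation (D q n m) (H0 n m) Fun.T"
      by (rule Fun_T_D_faithful)
  next
    fix X v assume "X \<in> carrier (Pol q n m)" and "v \<in> H0 n m"
    then obtain a where a: "a \<in> free_on (pol_gens n m)" "X = Pol.cls a" and v: "v \<in> supported (idx n m)"
      unfolding Pol_eq Pol.carrier_Q H0_eq by blast
    show "Fun.T (pol_to_fun q n m X) v = T0 q n m X v"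
      unfolding a(2) pol_to_fun_cls[OF a(1)] T0_eq Fun.T_cls[OF v] Pol.T_cls[OF v]
      by (rule R_eq_T0_free[OF a(1), symmetric])
  next
    fix g i assume "i \<in> idx n m"
    then have v: "bv i \<in> supported (idx n m)" by (simp add: supported_def)
    show "Fun.T (fun_class q n m (fin g)) (bv i) = Poly_Mapping.single i (g (q powi (2 * (\<Sum>k=1..n. i k))))"
      unfolding fun_class_eq Fun.T_cls[OF v] R_fin partial_sum_eq ..
  qed
qed

end
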